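(* For any $\sigma>0$, $\alpha\ge1$ and integer $L\ge2$, there exists an unbounded code $\mathcal{C}\subset\mathbb{R}^n$ of rate $R=\frac12\ln\frac{1}{2\pi e\sigma^2\alpha^2}$ such that, when used over an AWGN channel with noise variance $\sigma^2$ and no input constraint, the exponent of the average probability of $(L-1)$-list-decoding error of $\mathcal{C}$, $\lim_{n\to\infty}-\frac1n\ln P_{\mathrm{e},\mathrm{avg},L-1}^{\mathrm{ML}}(\mathcal{C})$, is at least $$E_{\mathrm{r},L-1}(\alpha)=\begin{cases}\frac{\alpha^2}{2}-\ln\alpha-\frac12,&1\le\alpha\le\sqrt L,\\[2pt]\frac{L-1}{2}-\frac L2\ln L+(L-1)\ln\alpha,&\alpha>\sqrt L.\end{cases}$$
   Context: The AWGN channel with noise variance $\sigma^2$ and no input constraint maps $x\in\mathbb{R}^n$ to $x+\mathbf{g}$, $\mathbf{g}\sim\mathcal{N}(0,\sigma^2I_n)$. An unbounded code is a (countable, locally finite) set $\mathcal{C}\subset\mathbb{R}^n$; its rate is $$R(\mathcal{C})=\limsup_{K\to\infty}\frac1n\ln\frac{|\mathcal{C}\cap K\mathcal{B}|}{|K\mathcal{B}|},$$ where $\mathcal{B}\subset\mathbb{R}^n$ is an arbitrary centrally symmetric connected compact set with nonempty interior (e.g. the unit ball or $[-1,1]^n$), numerators are cardinalities and denominators are Lebesgue volumes. The maximum-likelihood $(L-1)$-list-decoder outputs the $L-1$ codewords nearest to the channel output; the error probability of $x\in\mathcal{C}$ is $$P_{\mathrm{e},L-1}^{\mathrm{ML}}(x,\mathcal{C})=\Pr\left[\exists\text{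 distinct }x_1,\dots,x_{L-1}\in\mathcal{C}\setminus\{x\}\ \forall i:\ \|x_i-(x+\mathbf{g})\|_2<\|\mathbf{g}\|_2\right].$$ The average probability of error is the average over codewords, $P_{\mathrm{e},\mathrm{avg},L-1}^{\mathrm{ML}}(\mathcal{C})=\limsup_{K\to\infty}\frac{1}{|\mathcal{C}\cap K\mathcal{B}|}\sum_{x\in\mathcal{C}\cap K\mathcal{B}}P_{\mathrm{e},L-1}^{\mathrm{ML}}(x,\mathcal{C})$. Throughout, "a code" means a sequence of codes of increasing dimensions $n$, its rate being understood asymptotically as $n\to\infty$. *)

theory Defs
  imports "HOL-Probability.Probability"
begin

text \<open>
  Since the dimension \<open>n\<close> tends to infinity, a point of \<open>n\<close>-dimensional space is an extensional
  function in \<open>{..<n} \<rightarrow>\<^sub>E UNIV\<close>.  This is at once the space of the product measures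
  \<open>PiM {..<n}\<close> and the underlying set of the library's product topology
  \<open>powertop_real {..<n}\<close>; the Euclidean norm is \<open>L2_set x {..<n}\<close>.
\<close>

abbreviation Rn :: "nat \<Rightarrow> (nat \<Rightarrow> real) set" where
  "Rn n \<equiv> {..<n} \<rightarrow>\<^sub>E UNIV"

definition vadd :: "nat \<Rightarrow> (nat \<Rightarrow> real) \<Rightarrow> (nat \<Rightarrow> real) \<Rightarrow> nat \<Rightarrow> real" where
  "vadd n x y = (\<lambda>i\<in>{..<n}. x i + y i)"

definition vscale :: "nat \<Rightarrow> real \<Rightarrow> (nat \<Rightarrow> real) \<Rightarrow> nat \<Rightarrow> real" where
  "vscale n c x = (\<lambda>i\<in>{..<n}. c * x i)"

definition vnorm :: "nat \<Rightarrow> (nat \<Rightarrow> real) \<Rightarrow> real" where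
  "vnorm n x = L2_set x {..<n}"

definition vdist :: "nat \<Rightarrow> (nat \<Rightarrow> real) \<Rightarrow> (nat \<Rightarrow> real) \<Rightarrow> real" where
  "vdist n x y = L2_set (\<lambda>i. x i - y i) {..<n}"

definition vol :: "nat \<Rightarrow> (nat \<Rightarrow> real) set \<Rightarrow> real" where
  "vol n A = measure (\<Pi>\<^sub>M i\<in>{..<n}. lborel) A"

text \<open>The noise \<open>N(0, \<sigma>\<^sup>2 I\<^sub>n)\<close>; the second argument of \<open>normal_density\<close> is the standard
  deviation.\<close>

definition gaussian_noise :: "nat \<Rightarrow> real \<Rightarrow> (nat \<Rightarrow> real) measure" where
  "gaussian_noise n \<sigma> = (\<Pi>\<^sub>M i\<in>{..<n}. density lborel (\<lambda>t. ennreal (normal_density 0 \<sigma> t)))"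

text \<open>Extended logarithm on nonnegative values, with \<open>ln 0 = -\<infinity>\<close> (the real \<open>ln\<close> has \<open>ln 0 = 0\<close>).\<close>

definition eln :: "ereal \<Rightarrow> ereal" where
  "eln x = (if x \<le> 0 then -\<infinity> else if x = \<infinity> then \<infinity> else ereal (ln (real_of_ereal x)))"

definition reference_body :: "nat \<Rightarrow> (nat \<Rightarrow> real) set \<Rightarrow> bool" where
  "reference_body n B \<longleftrightarrow>
     (\<forall>x\<in>B. vscale n (-1) x \<in> B) \<and>
     connectedin (powertop_real {..<n}) B \<and>
     compactin (powertop_real {..<n}) B \<and>
     (powertop_real {..<n}) interior_of B \<noteq> {}"

definition unbounded_code :: "nat \<Rightarrow> (nat \<Rightarrow> real) set \<Rightarrow> bool" where
  "unbounded_code n C \<longleftrightarrow> C \<subseteq> Rn n \<and> countable C \<and> (\<forall>r. finite {x \<in> C. vnorm n x \<le> r})"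

definition code_rate :: "nat \<Rightarrow> (nat \<Rightarrow> real) set \<Rightarrow> (nat \<Rightarrow> real) set \<Rightarrow> ereal" where
  "code_rate n B C =
     Limsup at_top (\<lambda>K::real. ereal (1 / real n) *
       eln (ereal (real (card (C \<inter> vscale n K ` B)) / vol n (vscale n K ` B))))"

definition list_error_prob ::
    "nat \<Rightarrow> real \<Rightarrow> nat \<Rightarrow> (nat \<Rightarrow> real) set \<Rightarrow> (nat \<Rightarrow> real) \<Rightarrow> real" where
  "list_error_prob n \<sigma> L C x =
     measure (gaussian_noise n \<sigma>)
       {g \<in> space (gaussian_noise n \<sigma>).
          \<exists>xs. length xs = L - 1 \<and> distinct xs \<and> set xs \<subseteq> C - {x} \<and>
               (\<forall>y\<in>set xs. vdist n y (vadd n x g) < vnorm n g)}"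

definition avg_list_error_prob ::
    "nat \<Rightarrow> (nat \<Rightarrow> real) set \<Rightarrow> real \<Rightarrow> nat \<Rightarrow> (nat \<Rightarrow> real) set \<Rightarrow> ereal" where
  "avg_list_error_prob n B \<sigma> L C =
     Limsup at_top (\<lambda>K::real. ereal
       ((1 / real (card (C \<inter> vscale n K ` B))) *
        (\<Sum>x\<in>C \<inter> vscale n K ` B. list_error_prob n \<sigma> L C x)))"

definition Er :: "nat \<Rightarrow> real \<Rightarrow> real" where
  "Er L \<alpha> =
     (if \<alpha> \<le> sqrt (real L) then \<alpha>\<^sup>2 / 2 - ln \<alpha> - 1 / 2
      else (real L - 1) / 2 - real L / 2 * ln (real L) + (real L - 1) * ln \<alpha>)"

end

theory Submission
  imports Defs
begin

text \<open>
  In each dimension \<open>n\<close> the code is periodic up to a choice of two contents for its cells, and its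
  average error probability is tuned to \<open>\<phi> = exp (- n Er)\<close> up to constant factors.

  The good content of a cell comes from random coding.  Throw \<open>2 M\<close> independent uniform points into a
  cube of side \<open>A\<close>.  A codeword suffers a list error only if \<open>L - 1\<close> others lie in a ball whose radius
  is the norm of the noise; the conditional probability of this is at most \<open>min 1 (w ^ (L - 1))\<close>, where
  \<open>w\<close> bounds the expected number of points in the ball, and thus at most \<open>w powr s\<close> for every
  \<open>s \<le> L - 1\<close>.  The mean over the noise is a Gaussian moment, and \<open>s = min (\<alpha>\<^sup>2) L - 1\<close> gives
  exactly \<open>\<phi>\<close> (\<open>gaussian_list_moment\<close>).  Keeping the better half of the points yields a finite
  code all of whose codewords have error probability at most \<open>2 \<phi>\<close> (\<open>good_finite_code\<close>).
  Copies of the cube are separated by gaps wider than the typical noise, so decoding errors across cells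
  add only \<open>\<phi>\<close> (\<open>list_error_pcode_le\<close>).

  The theorem asks for a limit of the exponents and not only for a bound, and there is no matching
  converse for large \<open>\<alpha>\<close>.  Therefore some cells get a bad content of the same size \<open>M\<close>, a tight row of
  points each of which has an error probability bounded below independently of \<open>n\<close>
  (\<open>clustered_cell\<close>).  If the fraction of bad codewords in the dilates of the body has limit superior
  between \<open>\<phi>\<close> and \<open>2 \<phi>\<close>, the average error probability lies between a constant multiple of
  \<open>\<phi>\<close> and \<open>5 \<phi>\<close>, and its exponent converges to \<open>Er\<close>.

  The reference body may have a boundary of positive measure, so that counts in its dilates need not
  be asymptotic to volumes.  They are bounded above by the volume of a small enlargement, since the body
  is compact (\<open>hits_upper\<close>), and a suitable shift of the code attains the volume along some sequence
  of dilates (\<open>simultaneous_shift\<close>), which is all that a rate defined by a limit superior needs.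
  The fraction of bad codewords is adjusted without knowing any asymptotics: the cells are switched
  to bad one residue class at a time, each step changes the fraction by at most \<open>\<phi>\<close>, and the walk from
  no bad cell to only bad cells must stop in the required window (\<open>intermediate_fraction\<close>).
\<close>

section \<open>Lebesgue measure on the extensional product\<close>

abbreviation Leb :: "nat \<Rightarrow> (nat \<Rightarrow> real) measure" where
  "Leb n \<equiv> (\<Pi>\<^sub>M i\<in>{..<n}. lborel)"

interpretation lebesgue_factors: product_sigma_finite "\<lambda>_::nat. lborel :: real measure"
  by (simp add: product_sigma_finite_def sigma_finite_lborel)

text \<open>Translations and dilations at once, restricted to the index set so that the values stay
  extensional.\<close>

definition affmap :: "nat \<Rightarrow> real \<Rightarrow> (nat \<Rightarrow> real) \<Rightarrow> (nat \<Rightarrow> real) \<Rightarrow> nat \<Rightarrow> real" where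
  "affmap n c t x = (\<lambda>i\<in>{..<n}. t i + c * x i)"

lemma affmap_in_Rn [simp]: "affmap n c t x \<in> Rn n"
  by (auto simp: affmap_def)

lemma affmap_nth [simp]: "i < n \<Longrightarrow> affmap n c t x i = t i + c * x i"
  by (auto simp: affmap_def)

lemma affmap_measurable [measurable]: "affmap n c t \<in> measurable (Leb n) (Leb n)"
  unfolding affmap_def by measurable

lemma Rn_eqI: "x \<in> Rn n \<Longrightarrow> y \<in> Rn n \<Longrightarrow> (\<And>i. i < n \<Longrightarrow> x i = y i) \<Longrightarrow> x = y"
  by (metis PiE_ext lessThan_iff)

lemma space_Leb: "space (Leb n) = Rn n"
  by (simp add: space_PiM)

lemma emeasure_lborel_affine:
  fixes c t :: real
  assumes [measurable]: "A \<in> sets borel" and "c > 0"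
  shows "emeasure lborel A = ennreal c * emeasure lborel ((\<lambda>x. t + c * x) -` A)"
proof -
  have "emeasure lborel A = (\<integral>\<^sup>+x. indicator A x \<partial>lborel)" by simp
  also have "\<dots> = ennreal \<bar>c\<bar> * (\<integral>\<^sup>+x. indicator A (t + c * x) \<partial>lborel)"
    by (rule nn_integral_real_affine) (use \<open>c > 0\<close> in auto)
  also have "(\<integral>\<^sup>+x. indicator A (t + c * x) \<partial>lborel) = (\<integral>\<^sup>+x. indicator ((\<lambda>x. t + c * x) -` A) x \<partial>lborel)"
    by (intro nn_integral_cong) (auto simp: indicator_def)
  also have "\<dots> = emeasure lborel ((\<lambda>x. t + c * x) -` A)"
    by (intro nn_integral_indicator) (auto intro!: measurable_sets_borel[where M=borel])
  finally show ?thesis using \<open>c > 0\<close> by simp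
qed

lemma Leb_distr_affmap:
  assumes c: "c > 0"
  shows "scale_measure (ennreal (c ^ n)) (distr (Leb n) (Leb n) (affmap n c t)) = Leb n"
proof (rule lebesgue_factors.PiM_eqI)
  fix A :: "nat \<Rightarrow> real set"
  assume A: "\<And>i. i \<in> {..<n} \<Longrightarrow> A i \<in> sets lborel"
  then have A': "\<And>i. i < n \<Longrightarrow> A i \<in> sets borel" by auto
  have P: "Pi\<^sub>E {..<n} A \<in> sets (Leb n)" using A by (intro sets_PiM_I_finite) auto
  have pre: "affmap n c t -` Pi\<^sub>E {..<n} A \<inter> space (Leb n) = Pi\<^sub>E {..<n} (\<lambda>i. (\<lambda>x. t i + c * x) -` A i)"
    by (auto simp: space_PiM PiE_iff affmap_def extensional_def)
  have m: "(\<lambda>x. t i + c * x) -` A i \<in> sets borel" if "i < n" for i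
    using A'[OF that] by (auto intro!: measurable_sets_borel[where M=borel])
  have "emeasure (scale_measure (ennreal (c ^ n)) (distr (Leb n) (Leb n) (affmap n c t))) (Pi\<^sub>E {..<n} A)
     = ennreal (c ^ n) * (\<Prod>i<n. emeasure lborel ((\<lambda>x. t i + c * x) -` A i))"
    by (subst lebesgue_factors.emeasure_PiM[symmetric]) (use m in \<open>auto simp: emeasure_distr P pre\<close>)
  also have "ennreal (c ^ n) * (\<Prod>i<n. emeasure lborel ((\<lambda>x. t i + c * x) -` A i))
     = (\<Prod>i<n. ennreal c) * (\<Prod>i<n. emeasure lborel ((\<lambda>x. t i + c * x) -` A i))"
    using c by (simp add: ennreal_power)
  also have "(\<Prod>i<n. ennreal c) * (\<Prod>i<n. emeasure lborel ((\<lambda>x. t i + c * x) -` A i))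
     = (\<Prod>i<n. emeasure lborel (A i))"
    unfolding prod.distrib[symmetric]
    by (intro prod.cong refl emeasure_lborel_affine[symmetric]) (use A' c in auto)
  finally show "emeasure (scale_measure (ennreal (c ^ n)) (distr (Leb n) (Leb n) (affmap n c t))) (Pi\<^sub>E {..<n} A)
     = (\<Prod>i\<in>{..<n}. emeasure lborel (A i))" .
qed simp_all

lemma emeasure_Leb_affmap_vimage:
  assumes c: "c > 0" and X: "X \<in> sets (Leb n)"
  shows "emeasure (Leb n) X = ennreal (c ^ n) * emeasure (Leb n) {x \<in> Rn n. affmap n c t x \<in> X}"
proof -
  have "emeasure (Leb n) X = emeasure (scale_measure (ennreal (c ^ n)) (distr (Leb n) (Leb n) (affmap n c t))) X"
    by (simp add: Leb_distr_affmap[OF c])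
  also have "\<dots> = ennreal (c ^ n) * emeasure (Leb n) (affmap n c t -` X \<inter> space (Leb n))"
    using X by (simp add: emeasure_distr)
  also have "affmap n c t -` X \<inter> space (Leb n) = {x \<in> Rn n. affmap n c t x \<in> X}"
    by (auto simp: space_Leb)
  finally show ?thesis .
qed

lemma vscale_eq_affmap: "vscale n c = affmap n c (\<lambda>_. 0)"
  by (auto simp: vscale_def affmap_def fun_eq_iff)

lemma affmap_inverse:
  assumes "c > 0" "x \<in> Rn n"
  shows "affmap n (1/c) (\<lambda>i. - t i / c) (affmap n c t x) = x" "affmap n c t (affmap n (1/c) (\<lambda>i. - t i / c) x) = x"
  using assms by (auto simp: affmap_def fun_eq_iff PiE_def extensional_def field_simps)

lemma affmap_image_eq:
  assumes "c > 0" "X \<subseteq> Rn n"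
  shows "affmap n c t ` X = {x \<in> Rn n. affmap n (1/c) (\<lambda>i. - t i / c) x \<in> X}"
proof (intro equalityI subsetI)
  fix y assume "y \<in> affmap n c t ` X"
  then obtain x where x: "x \<in> X" "y = affmap n c t x" by auto
  then have "affmap n (1/c) (\<lambda>i. - t i / c) y = x" using affmap_inverse(1)[OF assms(1)] assms(2) by blast
  then show "y \<in> {x \<in> Rn n. affmap n (1/c) (\<lambda>i. - t i / c) x \<in> X}" using x by simp
next
  fix y assume "y \<in> {x \<in> Rn n. affmap n (1/c) (\<lambda>i. - t i / c) x \<in> X}"
  then show "y \<in> affmap n c t ` X" using affmap_inverse(2)[OF assms(1), of y n t] by (metis (lifting) image_eqI mem_Collect_eq)
qed

lemma sets_Leb_affmap_image:
  assumes "c > 0" "X \<in> sets (Leb n)"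
  shows "affmap n c t ` X \<in> sets (Leb n)"
proof -
  have X: "X \<subseteq> Rn n" using sets.sets_into_space[OF assms(2)] by (simp add: space_Leb)
  have "affmap n (1/c) (\<lambda>i. - t i / c) -` X \<inter> space (Leb n) \<in> sets (Leb n)"
    by (rule measurable_sets[OF affmap_measurable assms(2)])
  then show ?thesis
    unfolding affmap_image_eq[OF assms(1) X]
    by (simp add: vimage_def space_Leb Int_def conj_commute)
qed

lemma emeasure_Leb_affmap_image:
  assumes c: "c > 0" and X: "X \<in> sets (Leb n)"
  shows "emeasure (Leb n) (affmap n c t ` X) = ennreal (c ^ n) * emeasure (Leb n) X"
proof -
  have sub: "X \<subseteq> Rn n" using sets.sets_into_space[OF X] by (simp add: space_Leb)
  have "emeasure (Leb n) (affmap n c t ` X)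
      = ennreal (c ^ n) * emeasure (Leb n) {x \<in> Rn n. affmap n c t x \<in> affmap n c t ` X}"
    by (rule emeasure_Leb_affmap_vimage[OF c sets_Leb_affmap_image[OF c X]])
  also have "{x \<in> Rn n. affmap n c t x \<in> affmap n c t ` X} = X"
  proof (intro equalityI subsetI)
    fix x assume "x \<in> {x \<in> Rn n. affmap n c t x \<in> affmap n c t ` X}"
    then obtain x' where "x \<in> Rn n" "x' \<in> X" "affmap n c t x = affmap n c t x'" by auto
    then show "x \<in> X" using affmap_inverse(1)[OF c, of _ n t] sub by (metis subsetD)
  qed (use sub in auto)
  finally show ?thesis .
qed

lemma measure_Leb_affmap_image:
  assumes "c > 0" "X \<in> sets (Leb n)"
  shows "measure (Leb n) (affmap n c t ` X) = c ^ n * measure (Leb n) X"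
  using emeasure_Leb_affmap_image[OF assms, of t] assms(1)
  by (simp add: measure_def enn2real_mult)

definition cube :: "nat \<Rightarrow> (nat \<Rightarrow> real) \<Rightarrow> real \<Rightarrow> (nat \<Rightarrow> real) set" where
  "cube n a l = (\<Pi>\<^sub>E i\<in>{..<n}. {a i..<a i + l})"

lemma mem_cube: "x \<in> cube n a l \<longleftrightarrow> x \<in> Rn n \<and> (\<forall>i<n. a i \<le> x i \<and> x i < a i + l)"
  by (auto simp: cube_def PiE_iff)

lemma sets_cube [measurable, simp]: "cube n a l \<in> sets (Leb n)"
  unfolding cube_def by (intro sets_PiM_I_finite) auto

lemma emeasure_cube: "l \<ge> 0 \<Longrightarrow> emeasure (Leb n) (cube n a l) = ennreal (l ^ n)"
  unfolding cube_def by (subst lebesgue_factors.emeasure_PiM) (auto simp: ennreal_power)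

lemma measure_cube: "l \<ge> 0 \<Longrightarrow> measure (Leb n) (cube n a l) = l ^ n"
  by (simp add: measure_def emeasure_cube)

lemma affmap_cube:
  assumes "c > 0"
  shows "affmap n c t ` cube n a l = cube n (\<lambda>i. t i + c * a i) (c * l)"
proof -
  have *: "cube n a l \<subseteq> Rn n" by (auto simp: mem_cube)
  show ?thesis
    unfolding affmap_image_eq[OF assms *] using assms
    by (auto simp: mem_cube field_simps)
qed

subsection \<open>Reference bodies\<close>

text \<open>Compactness in the topology of the extensional product is compactness in the product topology on
  the whole function type, where closedness, Borel measurability and continuity are at hand.\<close>

lemma compact_if_compactin_powertop:
  fixes n :: nat
  assumes "compactin (powertop_real {..<n}) B"
  shows "compact B"
proof -
  have "continuous_map (powertop_real {..<n}) (product_topology (\<lambda>i. euclideanreal) UNIV) (\<lambda>x. x)"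
  proof (subst continuous_map_componentwise_UNIV, safe)
    fix i :: nat
    show "continuous_map (powertop_real {..<n}) euclideanreal (\<lambda>x. x i)"
    proof (cases "i < n")
      case True then show ?thesis by (intro continuous_map_product_projection) auto
    next
      case False
      \<comment> \<open>outside the index set an extensional function has the constant value \<open>undefined\<close>\<close>
      have "continuous_map (powertop_real {..<n}) euclideanreal (\<lambda>x. undefined)" by simp
      then show ?thesis
        by (rule continuous_map_eq) (use False in \<open>auto simp: PiE_def extensional_def\<close>)
    qed
  qed
  then have "compactin euclidean ((\<lambda>x. x) ` B)"
    unfolding euclidean_product_topology by (rule image_compactin[OF assms])
  then show "compact B" by simp
qed

lemma reference_body_compact:
  assumes "reference_body n B"
  shows "compact B" "B \<subseteq> Rn n"
proof -
  have c: "compactin (powertop_real {..<n}) B" using assms by (simp add: reference_body_def)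
  then show "compact B" by (rule compact_if_compactin_powertop)
  show "B \<subseteq> Rn n" using compactin_subset_topspace[OF c] by simp
qed

lemma compact_sets_Leb:
  assumes "compact B" "B \<subseteq> Rn n"
  shows "B \<in> sets (Leb n)"
proof -
  have "(\<lambda>x. x) \<in> borel_measurable (Leb n)"
  proof (rule measurable_coordinatewise_then_product)
    fix i
    show "(\<lambda>x. x i) \<in> borel_measurable (Leb n)"
    proof (cases "i < n")
      case True
      then have "(\<lambda>x. x i) \<in> measurable (Leb n) lborel" by (intro measurable_component_singleton) auto
      then show ?thesis by simp
    next
      case False
      have "(\<lambda>x. undefined :: real) \<in> borel_measurable (Leb n)" by simp
      then show ?thesis
        by (rule measurable_cong[THEN iffD1, rotated]) (use False in \<open>auto simp: space_Leb PiE_def extensional_def\<close>)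
    qed
  qed
  moreover have "B \<in> sets borel" using compact_imp_closed[OF assms(1)] by simp
  ultimately have "(\<lambda>x. x) -` B \<inter> space (Leb n) \<in> sets (Leb n)" by (rule measurable_sets)
  then show ?thesis using assms(2) by (simp add: space_Leb Int_absorb2)
qed

lemma reference_body_cube:
  assumes "reference_body n B"
  obtains a l where "l > 0" "cube n a l \<subseteq> B"
proof -
  obtain q where q: "q \<in> (powertop_real {..<n}) interior_of B" using assms by (auto simp: reference_body_def)
  then obtain U where U: "openin (powertop_real {..<n}) U" "q \<in> U" "U \<subseteq> B"
    by (auto simp: interior_of_def)
  have "\<exists>V. finite {i \<in> {..<n}. V i \<noteq> topspace euclideanreal} \<and>
      (\<forall>i\<in>{..<n}. openin euclideanreal (V i)) \<and> q \<in> Pi\<^sub>E {..<n} V \<and> Pi\<^sub>E {..<n} V \<subseteq> U"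
    using U(1)[unfolded openin_product_topology_alt] U(2) by (rule bspec)
  then obtain V where V: "\<forall>i\<in>{..<n}. openin euclideanreal (V i)" "q \<in> Pi\<^sub>E {..<n} V" "Pi\<^sub>E {..<n} V \<subseteq> U"
    by blast
  have "\<forall>i\<in>{..<n}. \<exists>e>0. ball (q i) e \<subseteq> V i"
  proof
    fix i assume "i \<in> {..<n}"
    then have "open (V i)" "q i \<in> V i" using V(1,2) by (auto simp: PiE_iff)
    then show "\<exists>e>0. ball (q i) e \<subseteq> V i" by (meson open_contains_ball)
  qed
  then obtain e where e: "\<And>i. i < n \<Longrightarrow> e i > 0 \<and> ball (q i) (e i) \<subseteq> V i"
    by (metis lessThan_iff)
  define l where "l = Min (insert 1 (e ` {..<n}))"
  have l: "l > 0" "\<And>i. i < n \<Longrightarrow> l \<le> e i" unfolding l_def using e by auto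
  have "cube n q l \<subseteq> Pi\<^sub>E {..<n} V"
  proof
    fix x assume x: "x \<in> cube n q l"
    have "x i \<in> V i" if "i < n" for i
    proof -
      have "x i \<in> ball (q i) (e i)" using x that l(2)[OF that] by (auto simp: mem_cube dist_real_def)
      then show ?thesis using e[OF that] by auto
    qed
    then show "x \<in> Pi\<^sub>E {..<n} V" using x by (auto simp: mem_cube PiE_iff)
  qed
  then show ?thesis using that l(1) U V by blast
qed

text \<open>The closed neighbourhood of radius \<open>e\<close> for the maximum norm, which fits the cubes below.\<close>

definition enl :: "nat \<Rightarrow> (nat \<Rightarrow> real) set \<Rightarrow> real \<Rightarrow> (nat \<Rightarrow> real) set" where
  "enl n B e = {y \<in> Rn n. \<exists>x\<in>B. \<forall>i<n. \<bar>x i - y i\<bar> \<le> e}"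

text \<open>The enlargement is the image of \<open>B\<close> times a closed cube under addition.\<close>

lemma compact_enl:
  assumes "compact B" "B \<subseteq> Rn n" "e \<ge> 0"
  shows "compact (enl n B e)"
proof -
  define D where "D = (PiE {..<n} (\<lambda>_. {-e..e}))"
  define f where "f = (\<lambda>(x::nat\<Rightarrow>real,d::nat\<Rightarrow>real). \<lambda>i. if i < n then x i + d i else undefined)"
  have "compactin (powertop_real {..<n}) D"
    unfolding D_def by (rule compactin_PiE[THEN iffD2]) auto
  then have D: "compact D" by (rule compact_if_compactin_powertop)
  have cf: "continuous_on (B \<times> D) f"
  proof (rule continuous_on_coordinatewise_then_product)
    fix i
    have f1: "continuous_on (B \<times> D) (\<lambda>z. fst z i)"
      by (rule continuous_on_product_then_coordinatewise) (auto intro: continuous_intros)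
    have f2: "continuous_on (B \<times> D) (\<lambda>z. snd z i)"
      by (rule continuous_on_product_then_coordinatewise) (auto intro: continuous_intros)
    show "continuous_on (B \<times> D) (\<lambda>z. f z i)"
      by (cases "i < n") (auto simp: f_def case_prod_beta intro!: continuous_intros f1 f2)
  qed
  have "f ` (B \<times> D) = enl n B e"
  proof (intro equalityI subsetI)
    fix y assume "y \<in> f ` (B \<times> D)"
    then obtain x d where xd: "x \<in> B" "d \<in> D" "y = f (x, d)" by auto
    have "\<forall>i<n. \<bar>x i - y i\<bar> \<le> e"
    proof (intro allI impI)
      fix i assume "i < n"
      then have "- e \<le> d i \<and> d i \<le> e" using xd(2) by (auto simp: D_def PiE_iff)
      then show "\<bar>x i - y i\<bar> \<le> e" using \<open>i < n\<close> by (auto simp: xd(3) f_def abs_le_iff)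
    qed
    moreover have "y \<in> Rn n" by (auto simp: xd(3) f_def PiE_iff extensional_def)
    ultimately show "y \<in> enl n B e" using xd(1) by (auto simp: enl_def)
  next
    fix y assume y: "y \<in> enl n B e"
    then obtain x where x: "x \<in> B" "\<forall>i<n. \<bar>x i - y i\<bar> \<le> e" by (auto simp: enl_def)
    have "y = f (x, \<lambda>i\<in>{..<n}. y i - x i)"
      using y by (auto simp: f_def enl_def PiE_def extensional_def fun_eq_iff)
    moreover have "(\<lambda>i\<in>{..<n}. y i - x i) \<in> D" using x(2) by (auto simp: D_def abs_le_iff)
    ultimately show "y \<in> f ` (B \<times> D)" using x(1) by blast
  qed
  then show ?thesis using compact_continuous_image[OF cf compact_Times[OF assms(1) D]] by simp
qed

lemma enl_sub_Rn: "enl n B e \<subseteq> Rn n" by (auto simp: enl_def)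

lemma compact_bounded_Rn:
  assumes "compact B" "B \<subseteq> Rn n"
  obtains b where "b > 0" "\<And>x i. x \<in> B \<Longrightarrow> i < n \<Longrightarrow> \<bar>x i\<bar> \<le> b"
proof -
  have "\<exists>b. \<forall>x\<in>B. \<bar>x i\<bar> \<le> b" for i
  proof -
    have "continuous_on B (\<lambda>x. x i)" by (rule continuous_on_product_then_coordinatewise) (auto intro: continuous_intros)
    then have "compact ((\<lambda>x. x i) ` B)" using assms(1) compact_continuous_image by blast
    then have "bounded ((\<lambda>x. x i) ` B)" by (rule compact_imp_bounded)
    then show ?thesis by (auto simp: bounded_iff)
  qed
  then obtain b where b: "\<And>i x. x \<in> B \<Longrightarrow> \<bar>x i\<bar> \<le> b i" by metis
  define c where "c = Max (insert 1 (b ` {..<n}))"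
  have "c > 0" unfolding c_def by (simp add: Max_gr_iff)
  moreover have "\<bar>x i\<bar> \<le> c" if "x \<in> B" "i < n" for x i
  proof -
    have "b i \<le> c" unfolding c_def using that(2) by (intro Max_ge) auto
    then show ?thesis using b[OF that(1), of i] by linarith
  qed
  ultimately show ?thesis using that by blast
qed

lemma emeasure_compact_finite:
  assumes "compact B" "B \<subseteq> Rn n"
  shows "emeasure (Leb n) B < \<infinity>"
proof -
  obtain b where b: "b > 0" "\<And>x i. x \<in> B \<Longrightarrow> i < n \<Longrightarrow> \<bar>x i\<bar> \<le> b" using compact_bounded_Rn[OF assms] by blast
  have "B \<subseteq> cube n (\<lambda>_. -b) (2*b+1)"
    using b assms(2) by (force simp: mem_cube abs_le_iff)
  then have "emeasure (Leb n) B \<le> ennreal ((2*b+1)^n)"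
    using b(1) by (subst emeasure_cube[symmetric, of _ n "\<lambda>_. -b"]) (auto intro!: emeasure_mono)
  then show ?thesis by (rule order.strict_trans1) simp
qed

lemma enl_mono:
  assumes "d \<le> e" shows "enl n B d \<subseteq> enl n B e"
proof
  fix y assume "y \<in> enl n B d"
  then obtain x where "y \<in> Rn n" "x \<in> B" "\<forall>i<n. \<bar>x i - y i\<bar> \<le> d" by (auto simp: enl_def)
  moreover from this(3) assms have "\<forall>i<n. \<bar>x i - y i\<bar> \<le> e" by fastforce
  ultimately show "y \<in> enl n B e" by (auto simp: enl_def)
qed

text \<open>Since \<open>B\<close> is closed, it is the intersection of its enlargements; continuity from above applies
  because they have finite measure.\<close>

lemma enl_measure_le:
  assumes B: "compact B" "B \<subseteq> Rn n" and e: "e > 0"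
  obtains d where "d > 0" "measure (Leb n) (enl n B d) \<le> measure (Leb n) B + e"
proof -
  define X where "X m = enl n B (1 / real (Suc m))" for m
  have cX: "compact (X m)" for m unfolding X_def by (rule compact_enl[OF B]) simp
  have sX: "X m \<subseteq> Rn n" for m unfolding X_def by (rule enl_sub_Rn)
  have X: "X m \<in> sets (Leb n)" "emeasure (Leb n) (X m) < \<infinity>" for m
    using compact_sets_Leb[OF cX sX] emeasure_compact_finite[OF cX sX] by blast+
  have dec: "decseq X"
    unfolding decseq_def X_def by (intro allI impI enl_mono) (simp add: frac_le)
  have "(\<Inter>m. X m) = B"
  proof (intro equalityI subsetI)
    fix y assume y: "y \<in> (\<Inter>m. X m)"
    then have yR: "y \<in> Rn n" by (auto simp: X_def enl_def)
    have "\<forall>m. \<exists>x\<in>B. \<forall>i<n. \<bar>x i - y i\<bar> \<le> 1 / real (Suc m)" using y by (auto simp: X_def enl_def)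
    then obtain x where x: "\<And>m. x m \<in> B" "\<And>m i. i < n \<Longrightarrow> \<bar>x m i - y i\<bar> \<le> 1 / real (Suc m)" by metis
    have "(\<lambda>m. x m i) \<longlonglongrightarrow> y i" for i
    proof (cases "i < n")
      case True
      have "(\<lambda>m. x m i - y i) \<longlonglongrightarrow> 0"
        by (rule Lim_null_comparison[OF _ LIMSEQ_inverse_real_of_nat])
           (use x(2)[OF True] in \<open>auto simp: inverse_eq_divide\<close>)
      then show ?thesis by (simp add: LIM_zero_iff)
    next
      case False
      then have "x m i = y i" for m using x(1)[of m] B(2) yR by (auto simp: PiE_def extensional_def subset_eq)
      then show ?thesis by simp
    qed
    then have "x \<longlonglongrightarrow> y"
      unfolding limitin_canonical_iff[symmetric] euclidean_product_topology[symmetric]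
      by (subst limitin_componentwise) auto
    then show "y \<in> B" using closed_sequentially[OF compact_imp_closed[OF B(1)]] x(1) by blast
  next
    fix y assume "y \<in> B" then show "y \<in> (\<Inter>m. X m)" using B(2) by (auto simp: X_def enl_def intro!: bexI[of _ y])
  qed
  moreover have "(\<lambda>i. measure (Leb n) (X i)) \<longlonglongrightarrow> measure (Leb n) (\<Inter>i. X i)"
    by (rule Lim_measure_decseq) (use X dec in \<open>auto simp: less_top\<close>)
  ultimately have "(\<lambda>i. measure (Leb n) (X i)) \<longlonglongrightarrow> measure (Leb n) B" by simp
  then have "eventually (\<lambda>i. measure (Leb n) (X i) < measure (Leb n) B + e) sequentially"
    by (rule order_tendstoD) (use e in simp)
  then obtain m where "measure (Leb n) (X m) < measure (Leb n) B + e" by (auto simp: eventually_sequentially)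
  then show ?thesis using that[of "1 / real (Suc m)"] by (auto simp: X_def)
qed

section \<open>Counting lattice points in large dilates\<close>

abbreviation Zn :: "nat \<Rightarrow> (nat \<Rightarrow> int) set" where
  "Zn n \<equiv> {..<n} \<rightarrow>\<^sub>E UNIV"

definition lat :: "nat \<Rightarrow> real \<Rightarrow> (nat \<Rightarrow> real) \<Rightarrow> (nat \<Rightarrow> int) \<Rightarrow> nat \<Rightarrow> real" where
  "lat n T v z = (\<lambda>i\<in>{..<n}. v i + T * of_int (z i))"

text \<open>The lattice points \<open>v + T z\<close> lying in \<open>X\<close>, recorded by their integer coordinates.\<close>

definition hits :: "nat \<Rightarrow> real \<Rightarrow> (nat \<Rightarrow> real) \<Rightarrow> (nat \<Rightarrow> real) set \<Rightarrow> (nat \<Rightarrow> int) set" where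
  "hits n T v X = {z \<in> Zn n. lat n T v z \<in> X}"

lemma lat_in_Rn [simp]: "lat n T v z \<in> Rn n"
  by (auto simp: lat_def)

lemma lat_nth [simp]: "i < n \<Longrightarrow> lat n T v z i = v i + T * of_int (z i)"
  by (auto simp: lat_def)

lemma countable_Zn [simp]: "countable (Zn n)"
  by (intro countable_PiE) auto

lemma Zn_eqI: "x \<in> Zn n \<Longrightarrow> y \<in> Zn n \<Longrightarrow> (\<And>i. i < n \<Longrightarrow> x i = y i) \<Longrightarrow> x = y"
  by (metis PiE_ext lessThan_iff)

lemma int_eq_if_cells_meet:
  fixes T v x :: real and y z :: int
  assumes "T > 0" "v + T * of_int z \<le> x" "x < v + T * of_int z + T"
      "v + T * of_int y \<le> x" "x < v + T * of_int y + T"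
  shows "z = y"
proof -
  have "T * of_int z < T * (of_int y + 1)" "T * of_int y < T * (of_int z + 1)"
    using assms by (auto simp: distrib_left)
  then have "real_of_int z < of_int y + 1" "real_of_int y < of_int z + 1"
    using assms(1) by auto
  then show ?thesis by linarith
qed

lemma lattice_cubes_disjoint:
  assumes "T > 0"
  shows "disjoint_family_on (\<lambda>z. cube n (lat n T v z) T) (Zn n)"
  unfolding disjoint_family_on_def
proof (intro ballI impI)
  fix z y assume zy: "z \<in> Zn n" "y \<in> Zn n" "z \<noteq> y"
  show "cube n (lat n T v z) T \<inter> cube n (lat n T v y) T = {}"
  proof (rule ccontr)
    assume "cube n (lat n T v z) T \<inter> cube n (lat n T v y) T \<noteq> {}"
    then obtain x where x: "x \<in> cube n (lat n T v z) T" "x \<in> cube n (lat n T v y) T" by auto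
    have "z i = y i" if "i < n" for i
      using x that assms by (intro int_eq_if_cells_meet[of T "v i" "z i" "x i"]) (auto simp: mem_cube)
    then show False using zy Zn_eqI by blast
  qed
qed

lemma lattice_cubes_cover:
  assumes "T > 0" "x \<in> Rn n"
  obtains z where "z \<in> Zn n" "x \<in> cube n (lat n T v z) T"
proof
  define z where "z = (\<lambda>i\<in>{..<n}. \<lfloor>(x i - v i) / T\<rfloor>)"
  show "z \<in> Zn n" by (auto simp: z_def)
  have "T * of_int \<lfloor>(x i - v i) / T\<rfloor> \<le> x i - v i" "x i - v i < T * of_int \<lfloor>(x i - v i) / T\<rfloor> + T" for i
    using floor_divide_lower[OF assms(1), of "x i - v i"] floor_divide_upper[OF assms(1), of "x i - v i"]
    by (auto simp: algebra_simps)
  then have "v i + T * of_int \<lfloor>(x i - v i) / T\<rfloor> \<le> x i \<and> x i < v i + T * of_int \<lfloor>(x i - v i) / T\<rfloor> + T" for i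
    by (simp add: algebra_simps)
  then show "x \<in> cube n (lat n T v z) T"
    using assms(2) by (auto simp: mem_cube z_def)
qed

lemma enl_vscale_subset:
  assumes "K > 0"
  shows "enl n (vscale n K ` B) T \<subseteq> vscale n K ` enl n B (T / K)"
proof
  fix y assume "y \<in> enl n (vscale n K ` B) T"
  then obtain x where x: "y \<in> Rn n" "x \<in> B" "\<forall>i<n. \<bar>vscale n K x i - y i\<bar> \<le> T"
    unfolding enl_def by blast
  define w where "w = vscale n (1/K) y"
  have "\<bar>x i - w i\<bar> \<le> T / K" if "i < n" for i
  proof -
    have "\<bar>K * (x i - w i)\<bar> \<le> T" using x(3) that assms by (auto simp: w_def vscale_def algebra_simps)
    then have "K * \<bar>x i - w i\<bar> \<le> T" using assms by (simp only: abs_mult abs_of_pos)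
    then show ?thesis using assms by (simp add: field_simps)
  qed
  then have "w \<in> enl n B (T / K)" using x(2) by (auto simp: enl_def w_def vscale_def)
  moreover have "y = vscale n K w" using x(1) assms
    by (auto simp: w_def vscale_def fun_eq_iff PiE_def extensional_def)
  ultimately show "y \<in> vscale n K ` enl n B (T / K)" by blast
qed

lemma compact_vscale:
  assumes "compact B" "B \<subseteq> Rn n"
  shows "compact (vscale n K ` B)" "vscale n K ` B \<subseteq> Rn n"
proof -
  have "continuous_on B (vscale n K)"
  proof (rule continuous_on_coordinatewise_then_product)
    fix i
    have "continuous_on B (\<lambda>x. x i)"
      by (rule continuous_on_product_then_coordinatewise) (auto intro: continuous_intros)
    then show "continuous_on B (\<lambda>x. vscale n K x i)"
      by (cases "i < n") (auto simp: vscale_def intro!: continuous_intros)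
  qed
  then show "compact (vscale n K ` B)" using assms(1) compact_continuous_image by blast
  show "vscale n K ` B \<subseteq> Rn n" unfolding vscale_eq_affmap using affmap_in_Rn by blast
qed

text \<open>The half-open cells attached to lattice points in a set lie in an enlargement of the set, and
  after rescaling this enlargement shrinks to the compact set itself.\<close>

lemma hits_upper:
  assumes B: "compact B" "B \<subseteq> Rn n" and T: "T > 0" and e: "e > 0"
  shows "\<exists>K0>0. \<forall>K\<ge>K0. \<forall>v. finite (hits n T v (vscale n K ` B)) \<and>
     real (card (hits n T v (vscale n K ` B))) * T ^ n \<le> K ^ n * (measure (Leb n) B + e)"
proof -
  obtain d where d: "d > 0" "measure (Leb n) (enl n B d) \<le> measure (Leb n) B + e"
    using enl_measure_le[OF B e] by blast
  show ?thesis
  proof (intro exI[of _ "T / d"] conjI allI impI)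
    show "T / d > 0" using T d by simp
    fix K v assume K: "T / d \<le> K"
    then have K0: "K > 0" using T d by (meson divide_pos_pos less_le_trans)
    then have Td: "T / K \<le> d" using K d(1) by (simp add: field_simps)
    define H where "H = hits n T v (vscale n K ` B)"
    define E where "E = vscale n K ` enl n B d"
    have sd: "enl n B d \<in> sets (Leb n)"
      by (rule compact_sets_Leb[OF compact_enl[OF B] enl_sub_Rn]) (use d in simp)
    have sE: "E \<in> sets (Leb n)"
      unfolding E_def vscale_eq_affmap by (rule sets_Leb_affmap_image[OF K0 sd])
    have mE: "measure (Leb n) E = K ^ n * measure (Leb n) (enl n B d)"
      unfolding E_def vscale_eq_affmap by (rule measure_Leb_affmap_image[OF K0 sd])
    have cenl: "compact (enl n B d)" using compact_enl[OF B] d(1) by simp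
    have fE: "emeasure (Leb n) E < \<infinity>"
      unfolding E_def by (rule emeasure_compact_finite[OF compact_vscale[OF cenl enl_sub_Rn]])
    have sub: "cube n (lat n T v z) T \<subseteq> E" if "z \<in> H" for z
    proof
      fix y assume y: "y \<in> cube n (lat n T v z) T"
      have "lat n T v z \<in> vscale n K ` B" using that by (auto simp: H_def hits_def)
      moreover have "\<forall>i<n. \<bar>lat n T v z i - y i\<bar> \<le> T" using y by (auto simp: mem_cube)
      ultimately have "y \<in> enl n (vscale n K ` B) T" using y unfolding enl_def mem_cube by blast
      then show "y \<in> E" unfolding E_def
        using enl_vscale_subset[OF K0] enl_mono[OF Td] by blast
    qed
    have bound: "real (card Z) * T ^ n \<le> K ^ n * (measure (Leb n) B + e)" if Z: "finite Z" "Z \<subseteq> H" for Z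
    proof -
      have "disjoint_family_on (\<lambda>z. cube n (lat n T v z) T) Z"
        by (rule disjoint_family_on_mono[OF _ lattice_cubes_disjoint[OF T]]) (use Z in \<open>auto simp: H_def hits_def\<close>)
      then have "measure (Leb n) (\<Union>z\<in>Z. cube n (lat n T v z) T) = (\<Sum>z\<in>Z. measure (Leb n) (cube n (lat n T v z) T))"
        using Z T by (intro measure_finite_Union) (auto simp: emeasure_cube)
      also have "\<dots> = real (card Z) * T ^ n" using T by (simp add: measure_cube)
      finally have "real (card Z) * T ^ n = measure (Leb n) (\<Union>z\<in>Z. cube n (lat n T v z) T)" ..
      also have "\<dots> \<le> measure (Leb n) E"
        by (rule measure_mono_fmeasurable) (use Z sub sE fE in \<open>auto simp: fmeasurable_def intro!: sets.finite_UN\<close>)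
      also have "\<dots> \<le> K ^ n * (measure (Leb n) B + e)" unfolding mE
        by (rule mult_left_mono) (use d K0 in auto)
      finally show ?thesis .
    qed
    have "finite H"
    proof (rule finite_if_finite_subsets_card_bdd[of _ "nat \<lceil>K ^ n * (measure (Leb n) B + e) / T ^ n\<rceil>", THEN conjunct1])
      fix Z assume "Z \<subseteq> H" "finite Z"
      then have "real (card Z) \<le> K ^ n * (measure (Leb n) B + e) / T ^ n"
        using bound T by (simp add: field_simps)
      then show "card Z \<le> nat \<lceil>K ^ n * (measure (Leb n) B + e) / T ^ n\<rceil>" by linarith
    qed
    then show "finite (hits n T v (vscale n K ` B))"
      "real (card (hits n T v (vscale n K ` B))) * T ^ n \<le> K ^ n * (measure (Leb n) B + e)"
      using bound[of H] by (auto simp: H_def)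
  qed
qed

lemma card_int_interval_ge:
  fixes a w :: real
  shows "finite {k::int. a \<le> of_int k \<and> of_int k < a + w}"
    "real (card {k::int. a \<le> of_int k \<and> of_int k < a + w}) \<ge> w - 1"
proof -
  have eq: "{k::int. a \<le> of_int k \<and> of_int k < a + w} = {\<lceil>a\<rceil>..<\<lceil>a + w\<rceil>}"
    by (auto simp: ceiling_le_iff less_ceiling_iff)
  show "finite {k::int. a \<le> of_int k \<and> of_int k < a + w}" unfolding eq by simp
  have "w - 1 \<le> of_int (\<lceil>a + w\<rceil> - \<lceil>a\<rceil>)" by linarith
  then show "real (card {k::int. a \<le> of_int k \<and> of_int k < a + w}) \<ge> w - 1"
    unfolding eq by simp
qed

text \<open>A lower bound by volume is not available for the body itself, which the lattice may avoid
  on its boundary, but it holds for a cube inside.\<close>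

lemma hits_lower:
  assumes l: "l > 0" "cube n a l \<subseteq> B" and T: "T > 0" and K: "K * l \<ge> 2 * T"
    and fin: "finite (hits n T v (vscale n K ` B))"
  shows "real (card (hits n T v (vscale n K ` B))) * T ^ n \<ge> (K * l / 2) ^ n"
proof -
  have "K * l > 0" using K T by simp
  then have K0: "K > 0" using l(1) zero_less_mult_pos2 by blast
  define W where "W i = {k::int. (K * a i - v i) / T \<le> of_int k \<and> of_int k < (K * a i - v i) / T + K * l / T}" for i
  have sub: "Pi\<^sub>E {..<n} W \<subseteq> hits n T v (vscale n K ` B)"
  proof
    fix z assume z: "z \<in> Pi\<^sub>E {..<n} W"
    have "lat n T v z \<in> cube n (\<lambda>i. K * a i) (K * l)"
    proof -
      have "K * a i \<le> v i + T * of_int (z i) \<and> v i + T * of_int (z i) < K * a i + K * l" if "i < n" for i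
      proof -
        have "(K * a i - v i) / T \<le> of_int (z i)" "of_int (z i) < (K * a i - v i + K * l) / T"
          using z that by (auto simp: W_def PiE_iff add_divide_distrib)
        then show ?thesis using T by (auto simp: field_simps)
      qed
      then show ?thesis by (auto simp: mem_cube)
    qed
    also have "cube n (\<lambda>i. K * a i) (K * l) = vscale n K ` cube n a l"
      unfolding vscale_eq_affmap by (subst affmap_cube[OF K0]) simp
    finally show "z \<in> hits n T v (vscale n K ` B)"
      using z l(2) by (auto simp: hits_def PiE_iff)
  qed
  have W: "real (card (W i)) * T \<ge> K * l / 2" for i
  proof -
    have "real (card (W i)) \<ge> K * l / T - 1"
      unfolding W_def by (rule card_int_interval_ge)
    then have "real (card (W i)) * T \<ge> K * l - T" using T by (simp add: field_simps)
    then show ?thesis using K by linarith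
  qed
  have "(K * l / 2) ^ n = (\<Prod>i<n. K * l / 2)" by simp
  also have "\<dots> \<le> (\<Prod>i<n. real (card (W i)) * T)"
    by (rule prod_mono) (use W K0 l in \<open>auto intro: mult_nonneg_nonneg\<close>)
  also have "\<dots> = real (card (Pi\<^sub>E {..<n} W)) * T ^ n"
    by (simp add: card_PiE prod.distrib)
  also have "\<dots> \<le> real (card (hits n T v (vscale n K ` B))) * T ^ n"
    by (rule mult_right_mono) (use T card_mono[OF fin sub] in auto)
  finally show ?thesis .
qed

lemma lat_vadd: "lat n T (vadd n p u) z = affmap n 1 (lat n T p z) u"
  by (auto simp: lat_def affmap_def vadd_def fun_eq_iff)

text \<open>Averaging the count over all shifts of the lattice gives the volume exactly, because the
  translates of the fundamental cell tile space.\<close>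

lemma nn_integral_hits:
  assumes T: "T > 0" and X: "X \<in> sets (Leb n)"
  shows "(\<lambda>u. emeasure (count_space (Zn n)) (hits n T (vadd n p u) X)) \<in> borel_measurable (Leb n)"
    "(\<integral>\<^sup>+u. emeasure (count_space (Zn n)) (hits n T (vadd n p u) X) * indicator (cube n (\<lambda>_. 0) T) u \<partial>Leb n)
       = emeasure (Leb n) X"
proof -
  define Y where "Y z = {u \<in> Rn n. affmap n 1 (lat n T p z) u \<in> X}" for z
  have Y: "Y z \<in> sets (Leb n)" for z
  proof -
    have "affmap n 1 (lat n T p z) -` X \<inter> space (Leb n) \<in> sets (Leb n)"
      by (rule measurable_sets[OF affmap_measurable X])
    then show ?thesis by (simp add: Y_def vimage_def space_Leb Int_def conj_commute)
  qed
  have eq: "emeasure (count_space (Zn n)) (hits n T (vadd n p u) X) = (\<integral>\<^sup>+z. indicator (Y z) u \<partial>count_space (Zn n))"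
    if "u \<in> Rn n" for u
  proof -
    have "emeasure (count_space (Zn n)) (hits n T (vadd n p u) X) = (\<integral>\<^sup>+z. indicator (hits n T (vadd n p u) X) z \<partial>count_space (Zn n))"
      by (rule nn_integral_indicator[symmetric]) (auto simp: hits_def)
    also have "\<dots> = (\<integral>\<^sup>+z. indicator (Y z) u \<partial>count_space (Zn n))"
      by (rule nn_integral_cong) (use that in \<open>auto simp: hits_def lat_vadd Y_def indicator_def\<close>)
    finally show ?thesis .
  qed
  have m: "(\<lambda>u. \<integral>\<^sup>+z. indicator (Y z) u \<partial>count_space (Zn n)) \<in> borel_measurable (Leb n)"
  proof (rule sigma_finite_measure.borel_measurable_nn_integral[OF sigma_finite_measure_count_space_countable[OF countable_Zn]])
    define I where "I = (indicator (\<Union>z\<in>Zn n. Y z \<times> {z}) :: _ \<Rightarrow> ennreal)"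
    have "(\<Union>z\<in>Zn n. Y z \<times> {z}) \<in> sets (Leb n \<Otimes>\<^sub>M count_space (Zn n))"
      by (intro sets.countable_UN' countable_Zn pair_measureI) (use Y in auto)
    then have "I \<in> borel_measurable (Leb n \<Otimes>\<^sub>M count_space (Zn n))"
      unfolding I_def by (rule borel_measurable_indicator)
    moreover have "(case w of (u, z) \<Rightarrow> indicator (Y z) u) = I w" if "w \<in> space (Leb n \<Otimes>\<^sub>M count_space (Zn n))" for w
      using that by (cases w) (auto simp: I_def space_pair_measure split: split_indicator)
    ultimately show "(\<lambda>(u, z). indicator (Y z) u :: ennreal) \<in> borel_measurable (Leb n \<Otimes>\<^sub>M count_space (Zn n))"
      using measurable_cong[of "Leb n \<Otimes>\<^sub>M count_space (Zn n)" "\<lambda>(u, z). indicator (Y z) u" I borel] by simp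
  qed
  then show "(\<lambda>u. emeasure (count_space (Zn n)) (hits n T (vadd n p u) X)) \<in> borel_measurable (Leb n)"
    by (rule measurable_cong[THEN iffD2, rotated]) (simp add: eq space_Leb)
  have "(\<integral>\<^sup>+u. emeasure (count_space (Zn n)) (hits n T (vadd n p u) X) * indicator (cube n (\<lambda>_. 0) T) u \<partial>Leb n)
      = (\<integral>\<^sup>+u. (\<integral>\<^sup>+z. indicator (Y z \<inter> cube n (\<lambda>_. 0) T) u \<partial>count_space (Zn n)) \<partial>Leb n)"
    by (rule nn_integral_cong) (simp add: eq space_Leb indicator_inter_arith nn_integral_multc)
  also have "\<dots> = (\<integral>\<^sup>+z. (\<integral>\<^sup>+u. indicator (Y z \<inter> cube n (\<lambda>_. 0) T) u \<partial>Leb n) \<partial>count_space (Zn n))"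
    by (rule nn_integral_count_space_nn_integral) (use Y in auto)
  also have "\<dots> = (\<integral>\<^sup>+z. emeasure (Leb n) (X \<inter> cube n (lat n T p z) T) \<partial>count_space (Zn n))"
  proof (rule nn_integral_cong)
    fix z
    have img: "affmap n 1 (lat n T p z) ` (Y z \<inter> cube n (\<lambda>_. 0) T) = X \<inter> cube n (lat n T p z) T"
    proof -
      have "affmap n 1 (lat n T p z) ` cube n (\<lambda>_. 0) T = cube n (lat n T p z) T"
        by (subst affmap_cube) auto
      moreover have "affmap n 1 (lat n T p z) ` (Y z \<inter> cube n (\<lambda>_. 0) T) = X \<inter> affmap n 1 (lat n T p z) ` cube n (\<lambda>_. 0) T"
        by (auto simp: Y_def mem_cube)
      ultimately show ?thesis by simp
    qed
    have "(\<integral>\<^sup>+u. indicator (Y z \<inter> cube n (\<lambda>_. 0) T) u \<partial>Leb n) = emeasure (Leb n) (Y z \<inter> cube n (\<lambda>_. 0) T)"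
      by (rule nn_integral_indicator) (use Y in auto)
    also have "\<dots> = emeasure (Leb n) (X \<inter> cube n (lat n T p z) T)"
      using emeasure_Leb_affmap_image[of 1 "Y z \<inter> cube n (\<lambda>_. 0) T" n "lat n T p z"] Y by (simp add: img)
    finally show "(\<integral>\<^sup>+u. indicator (Y z \<inter> cube n (\<lambda>_. 0) T) u \<partial>Leb n) = emeasure (Leb n) (X \<inter> cube n (lat n T p z) T)" .
  qed
  also have "\<dots> = emeasure (Leb n) (\<Union>z\<in>Zn n. X \<inter> cube n (lat n T p z) T)"
    by (rule emeasure_UN_countable[symmetric])
      (use X lattice_cubes_disjoint[OF T, of n p] in \<open>auto simp: disjoint_family_on_def\<close>)
  also have "(\<Union>z\<in>Zn n. X \<inter> cube n (lat n T p z) T) = X"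
  proof (intro equalityI subsetI)
    fix x assume "x \<in> X"
    then have "x \<in> Rn n" using sets.sets_into_space[OF X] by (auto simp: space_Leb)
    from lattice_cubes_cover[OF T this, of p] obtain z where "z \<in> Zn n" "x \<in> cube n (lat n T p z) T" .
    then show "x \<in> (\<Union>z\<in>Zn n. X \<inter> cube n (lat n T p z) T)" using \<open>x \<in> X\<close> by blast
  qed auto
  finally show "(\<integral>\<^sup>+u. emeasure (count_space (Zn n)) (hits n T (vadd n p u) X) * indicator (cube n (\<lambda>_. 0) T) u \<partial>Leb n)
       = emeasure (Leb n) X" .
qed

lemma frequently_filterlim:
  assumes "filterlim f F G" "\<exists>\<^sub>F x in G. P (f x)"
  shows "\<exists>\<^sub>F y in F. P y"
  using assms unfolding frequently_def filterlim_iff by blast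

text \<open>The body may have a boundary of positive measure, so a given lattice may miss a large part of
  every dilate.  The reverse Fatou lemma yields a shift for which this does not happen.  As each
  count is asymptotically bounded by its mean, and the mean of the sum is attained in the limit
  superior, all finitely many offsets attain their means at the same scales.\<close>

lemma simultaneous_shift:
  assumes B: "compact B" "B \<subseteq> Rn n" and T: "T > 0" and X: "finite X"
  shows "\<exists>u. \<forall>e>0. \<exists>\<^sub>F K in at_top. \<forall>p\<in>X.
     real (card (hits n T (vadd n p u) (vscale n K ` B))) * T ^ n \<ge> K ^ n * (measure (Leb n) B - e)"
proof -
  define b where "b = measure (Leb n) B"
  have b0: "b \<ge> 0" by (simp add: b_def)
  define N where "N K p u = real (card (hits n T (vadd n p u) (vscale n K ` B))) * T ^ n / K ^ n" for K p u
  obtain K1 where K1: "K1 > 0" "\<And>K v. K \<ge> K1 \<Longrightarrow> finite (hits n T v (vscale n K ` B)) \<and>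
     real (card (hits n T v (vscale n K ` B))) * T ^ n \<le> K ^ n * (b + 1)"
    using hits_upper[OF B T, of 1] unfolding b_def by auto
  define m0 where "m0 = nat \<lceil>K1\<rceil> + 1"
  define r where "r m = real (m + m0)" for m
  let ?e = "\<lambda>m p u. emeasure (count_space (Zn n)) (hits n T (vadd n p u) (vscale n (r m) ` B))"
  have r: "r m \<ge> K1" "r m > 0" for m unfolding r_def m0_def by linarith+
  have rlim: "filterlim r at_top sequentially"
    unfolding r_def by (rule filterlim_compose[OF filterlim_real_sequentially filterlim_add_const_nat_at_top])
  define Q where "Q = cube n (\<lambda>_. 0) T"
  define f where "f m u = (\<Sum>p\<in>X. ennreal (T ^ n / r m ^ n) * ?e m p u)" for m u
  have f_eq: "f m u = ennreal (\<Sum>p\<in>X. N (r m) p u)" for m u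
  proof -
    have "ennreal (T ^ n / r m ^ n) * ?e m p u
       = ennreal (N (r m) p u)" for p
    proof -
      have "?e m p u
         = ennreal (real (card (hits n T (vadd n p u) (vscale n (r m) ` B))))"
        using K1(2)[OF r(1)] by (subst emeasure_count_space_finite) (auto simp: hits_def ennreal_of_nat_eq_real_of_nat)
      then show ?thesis
        using T r(2)[of m] by (simp add: N_def ennreal_mult[symmetric] mult.commute)
    qed
    then have "f m u = (\<Sum>p\<in>X. ennreal (N (r m) p u))" by (simp add: f_def)
    also have "\<dots> = ennreal (\<Sum>p\<in>X. N (r m) p u)"
      by (rule sum_ennreal) (use T r(2)[of m] in \<open>auto simp: N_def\<close>)
    finally show ?thesis .
  qed
  have sB: "vscale n (r m) ` B \<in> sets (Leb n)" for m
    by (rule compact_sets_Leb[OF compact_vscale[OF B]])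
  have hm [measurable]: "(\<lambda>u. ?e m p u) \<in> borel_measurable (Leb n)" for p m
    by (rule nn_integral_hits(1)[OF T sB])
  have fm [measurable]: "f m \<in> borel_measurable (Leb n)" for m
    unfolding f_def by measurable
  have Qm [measurable]: "Q \<in> sets (Leb n)" unfolding Q_def by simp
  have eQ: "emeasure (Leb n) Q = ennreal (T ^ n)" unfolding Q_def using T by (simp add: emeasure_cube)
  have int: "(\<integral>\<^sup>+u. f m u * indicator Q u \<partial>Leb n) = ennreal (real (card X) * b * T ^ n)" for m
  proof -
    have "(\<integral>\<^sup>+u. f m u * indicator Q u \<partial>Leb n)
       = (\<integral>\<^sup>+u. (\<Sum>p\<in>X. ennreal (T ^ n / r m ^ n) * (?e m p u * indicator Q u)) \<partial>Leb n)"
      by (rule nn_integral_cong) (simp add: f_def sum_distrib_right mult.assoc)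
    also have "\<dots> = (\<Sum>p\<in>X. ennreal (T ^ n / r m ^ n) * (\<integral>\<^sup>+u. ?e m p u * indicator Q u \<partial>Leb n))"
      by (subst nn_integral_sum) (auto simp: nn_integral_cmult)
    also have "\<dots> = (\<Sum>p\<in>X. ennreal (T ^ n / r m ^ n) * emeasure (Leb n) (vscale n (r m) ` B))"
      unfolding Q_def by (subst nn_integral_hits(2)[OF T sB]) simp
    also have "emeasure (Leb n) (vscale n (r m) ` B) = ennreal (r m ^ n * b)"
    proof -
      have "emeasure (Leb n) (vscale n (r m) ` B) = ennreal (r m ^ n) * emeasure (Leb n) B"
        unfolding vscale_eq_affmap by (rule emeasure_Leb_affmap_image[OF r(2) compact_sets_Leb[OF B]])
      also have "emeasure (Leb n) B = ennreal b"
        unfolding b_def using emeasure_compact_finite[OF B] by (intro emeasure_eq_ennreal_measure) auto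
      finally show ?thesis using r(2)[of m] b0 by (simp add: ennreal_mult)
    qed
    also have "(\<Sum>p\<in>X. ennreal (T ^ n / r m ^ n) * ennreal (r m ^ n * b)) = ennreal (real (card X) * b * T ^ n)"
    proof -
      have "ennreal (T ^ n / r m ^ n) * ennreal (r m ^ n * b) = ennreal (b * T ^ n)"
        using r(2)[of m] T b0 by (simp add: ennreal_mult[symmetric])
      then show ?thesis using b0 T by (simp add: ennreal_of_nat_eq_real_of_nat ennreal_mult[symmetric] mult.assoc)
    qed
    finally show ?thesis .
  qed
  define c where "c = real (card X) * b"
  have bound: "f m u \<le> ennreal (real (card X) * (b + 1))" for m u
  proof -
    have "N (r m) p u \<le> b + 1" for p
      using K1(2)[OF r(1)[of m], of "vadd n p u"] r(2)[of m] by (simp add: N_def field_simps)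
    then have "(\<Sum>p\<in>X. N (r m) p u) \<le> real (card X) * (b + 1)"
      by (intro sum_bounded_above)
    then show ?thesis unfolding f_eq by (intro ennreal_leI)
  qed
  have "limsup (\<lambda>m. \<integral>\<^sup>+u. f m u * indicator Q u \<partial>Leb n) \<le> (\<integral>\<^sup>+u. limsup (\<lambda>m. f m u * indicator Q u) \<partial>Leb n)"
  proof (rule nn_integral_limsup[where w="\<lambda>u. ennreal (real (card X) * (b + 1)) * indicator Q u"])
    show "AE u in Leb n. f m u * indicator Q u \<le> ennreal (real (card X) * (b + 1)) * indicator Q u" for m
      by (intro AE_I2 mult_right_mono bound) simp
    show "(\<integral>\<^sup>+u. ennreal (real (card X) * (b + 1)) * indicator Q u \<partial>Leb n) < \<infinity>"
      by (subst nn_integral_cmult_indicator) (auto simp: eQ ennreal_mult_less_top)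
  qed auto
  then have L1: "ennreal (c * T ^ n) \<le> (\<integral>\<^sup>+u. limsup (\<lambda>m. f m u * indicator Q u) \<partial>Leb n)"
    unfolding int c_def by (simp add: Limsup_const)
  have "\<exists>u\<in>Q. limsup (\<lambda>m. f m u) \<ge> ennreal c"
  proof (rule ccontr)
    assume "\<not> ?thesis"
    then have less: "u \<in> Q \<Longrightarrow> limsup (\<lambda>m. f m u) < ennreal c" for u by (auto simp: not_le)
    have ind: "limsup (\<lambda>m. f m u * indicator Q u) = limsup (\<lambda>m. f m u) * indicator Q u" for u
      by (cases "u \<in> Q") (auto simp: Limsup_const)
    have "(\<integral>\<^sup>+u. limsup (\<lambda>m. f m u) * indicator Q u \<partial>Leb n) < (\<integral>\<^sup>+u. ennreal c * indicator Q u \<partial>Leb n)"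
    proof (rule nn_integral_less)
      show "(\<lambda>u. limsup (\<lambda>m. f m u) * indicator Q u) \<in> borel_measurable (Leb n)" by measurable
      show "(\<lambda>u. ennreal c * indicator Q u) \<in> borel_measurable (Leb n)" by measurable
      have le: "limsup (\<lambda>m. f m u) * indicator Q u \<le> ennreal c * indicator Q u" for u
        using less[of u] by (cases "u \<in> Q") auto
      then show "AE u in Leb n. limsup (\<lambda>m. f m u) * indicator Q u \<le> ennreal c * indicator Q u" by simp
      have "(\<integral>\<^sup>+u. limsup (\<lambda>m. f m u) * indicator Q u \<partial>Leb n) \<le> (\<integral>\<^sup>+u. ennreal c * indicator Q u \<partial>Leb n)"
        by (rule nn_integral_mono) (rule le)
      also have "\<dots> < \<infinity>" by (subst nn_integral_cmult_indicator) (auto simp: eQ ennreal_mult_less_top)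
      finally show "(\<integral>\<^sup>+u. limsup (\<lambda>m. f m u) * indicator Q u \<partial>Leb n) \<noteq> \<infinity>" by simp
      show "\<not> (AE u in Leb n. ennreal c * indicator Q u \<le> limsup (\<lambda>m. f m u) * indicator Q u)"
      proof
        assume "AE u in Leb n. ennreal c * indicator Q u \<le> limsup (\<lambda>m. f m u) * indicator Q u"
        then have "AE u in Leb n. u \<notin> Q"
          by (rule AE_mp) (use less in \<open>force simp: not_le[symmetric]\<close>)
        then have "emeasure (Leb n) Q = 0"
          by (subst (asm) AE_iff_measurable[where N=Q]) (use sets.sets_into_space[OF Qm] in auto)
        then show False using eQ T by simp
      qed
    qed
    also have "\<dots> = ennreal c * ennreal (T ^ n)" by (subst nn_integral_cmult_indicator) (auto simp: eQ)
    also have "\<dots> = ennreal (c * T ^ n)" using T b0 by (simp add: ennreal_mult c_def)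
    finally show False using L1 by (simp add: ind)
  qed
  then obtain u where u: "limsup (\<lambda>m. f m u) \<ge> ennreal c" by auto
  show ?thesis
  proof (intro exI[of _ u] allI impI)
    fix e :: real assume e: "e > 0"
    define d where "d = e / (real (card X) + 1)"
    have "d * (real (card X) + 1) = e" unfolding d_def by simp
    then have d2: "real (card X) * d + d = e" by (simp add: algebra_simps)
    have "d > 0" using e by (simp add: d_def)
    note d = this d2
    obtain K2 where K2: "\<And>K v. K \<ge> K2 \<Longrightarrow> real (card (hits n T v (vscale n K ` B))) * T ^ n \<le> K ^ n * (b + d)"
      using hits_upper[OF B T d(1)] unfolding b_def by auto
    have ev: "\<forall>\<^sub>F m in sequentially. r m \<ge> K2" using rlim by (simp add: filterlim_at_top)
    have "\<exists>\<^sub>F m in sequentially. (\<Sum>p\<in>X. N (r m) p u) \<ge> c - d"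
    proof (rule ccontr)
      assume "\<not> ?thesis"
      then have ev': "\<forall>\<^sub>F m in sequentially. (\<Sum>p\<in>X. N (r m) p u) < c - d" by (simp add: not_frequently not_le)
      then have "\<forall>\<^sub>F m in sequentially. f m u \<le> ennreal (c - d)"
        unfolding f_eq by eventually_elim (auto intro: ennreal_leI)
      then have "limsup (\<lambda>m. f m u) \<le> ennreal (c - d)" by (rule Limsup_bounded)
      then have 1: "ennreal c \<le> ennreal (c - d)" using u by order
      obtain m where "(\<Sum>p\<in>X. N (r m) p u) < c - d" using ev' by (auto simp: eventually_sequentially)
      moreover have "(\<Sum>p\<in>X. N (r m) p u) \<ge> 0" using T r(2)[of m] by (intro sum_nonneg) (auto simp: N_def)
      ultimately have "c - d \<ge> 0" by linarith
      then show False using 1 d by (simp add: ennreal_le_iff)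
    qed
    then have "\<exists>\<^sub>F m in sequentially. \<forall>p\<in>X. real (card (hits n T (vadd n p u) (vscale n (r m) ` B))) * T ^ n \<ge> r m ^ n * (b - e)"
    proof (rule frequently_rev_mp, intro eventually_mono[OF ev] impI ballI)
      fix m p assume m: "K2 \<le> r m" and s: "c - d \<le> (\<Sum>p\<in>X. N (r m) p u)" and p: "p \<in> X"
      have up: "N (r m) q u \<le> b + d" for q
        using K2[OF m, of "vadd n q u"] r(2)[of m] by (simp add: N_def field_simps)
      have "(\<Sum>p\<in>X. N (r m) p u) = N (r m) p u + (\<Sum>q\<in>X - {p}. N (r m) q u)"
        using p X by (simp add: sum.remove)
      also have "(\<Sum>q\<in>X - {p}. N (r m) q u) \<le> real (card (X - {p})) * (b + d)"
        by (intro sum_bounded_above) (use up in auto)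
      also have "real (card (X - {p})) = real (card X) - 1"
        using p X by (metis card_Diff_singleton card_gt_0_iff empty_iff of_nat_diff of_nat_1 Suc_leI One_nat_def)
      finally have "N (r m) p u \<ge> c - d - (real (card X) - 1) * (b + d)" using s by linarith
      also have "c - d - (real (card X) - 1) * (b + d) = b - (real (card X) * d)" by (simp add: c_def algebra_simps)
      finally have "N (r m) p u \<ge> b - e" using d by linarith
      then show "real (card (hits n T (vadd n p u) (vscale n (r m) ` B))) * T ^ n \<ge> r m ^ n * (b - e)"
        using r(2)[of m] by (simp add: N_def field_simps)
    qed
    then have "\<exists>\<^sub>F K in at_top. \<forall>p\<in>X. real (card (hits n T (vadd n p u) (vscale n K ` B))) * T ^ n \<ge> K ^ n * (b - e)"
      by (rule frequently_filterlim[OF rlim])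
    then show "\<exists>\<^sub>F K in at_top. \<forall>p\<in>X. real (card (hits n T (vadd n p u) (vscale n K ` B))) * T ^ n \<ge> K ^ n * (measure (Leb n) B - e)"
      by (simp add: b_def)
  qed
qed

section \<open>Gaussian estimates\<close>

lemma sets_gaussian_noise [measurable_cong]: "sets (gaussian_noise n \<sigma>) = sets (Leb n)"
  unfolding gaussian_noise_def by (intro sets_PiM_cong) auto

lemma space_gaussian_noise: "space (gaussian_noise n \<sigma>) = Rn n"
  by (simp add: gaussian_noise_def space_PiM)

lemma prob_space_gaussian_noise: "\<sigma> > 0 \<Longrightarrow> prob_space (gaussian_noise n \<sigma>)"
  unfolding gaussian_noise_def by (intro prob_space_PiM prob_space_normal_density)

lemma product_sigma_finite_gaussian:
  "\<sigma> > 0 \<Longrightarrow> product_sigma_finite (\<lambda>i::nat. density lborel (\<lambda>t. ennreal (normal_density 0 \<sigma> t)))"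
  by (simp add: product_sigma_finite_def prob_space_normal_density prob_space_imp_sigma_finite)

lemma nn_integral_normal_density: "\<sigma> > 0 \<Longrightarrow> (\<integral>\<^sup>+t. ennreal (normal_density \<mu> \<sigma> t) \<partial>lborel) = 1"
  using prob_space.emeasure_space_1[OF prob_space_normal_density[of \<sigma> \<mu>]]
  by (simp add: emeasure_density)

text \<open>The parameter of the exponential is chosen so that the tilted density is again a multiple of a
  normal density, with variance \<open>\<sigma>\<^sup>2 (1 + s)\<close>.\<close>

lemma nn_integral_exp_sq_normal:
  assumes "\<sigma> > 0" "s \<ge> 0"
  shows "(\<integral>\<^sup>+t. ennreal (exp (s / (2 * \<sigma>\<^sup>2 * (1 + s)) * t\<^sup>2)) \<partial>density lborel (\<lambda>t. ennreal (normal_density 0 \<sigma> t)))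
     = ennreal (sqrt (1 + s))"
proof -
  have eq: "normal_density 0 \<sigma> t * exp (s / (2 * \<sigma>\<^sup>2 * (1 + s)) * t\<^sup>2) = sqrt (1 + s) * normal_density 0 (\<sigma> * sqrt (1 + s)) t" for t
  proof -
    have e: "- t\<^sup>2 / (2 * \<sigma>\<^sup>2) + s / (2 * \<sigma>\<^sup>2 * (1 + s)) * t\<^sup>2 = - t\<^sup>2 / (2 * (\<sigma> * sqrt (1 + s))\<^sup>2)"
    proof -
      have "1 + s \<noteq> 0" "\<sigma>\<^sup>2 \<noteq> 0" using assms by auto
      then show ?thesis using assms by (simp add: power_mult_distrib divide_simps) (simp add: algebra_simps)
    qed
    have "sqrt (2 * pi * (\<sigma> * sqrt (1 + s))\<^sup>2) = sqrt (1 + s) * sqrt (2 * pi * \<sigma>\<^sup>2)"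
      using assms by (simp add: power_mult_distrib real_sqrt_mult)
    then have c: "1 / sqrt (2 * pi * \<sigma>\<^sup>2) = sqrt (1 + s) * (1 / sqrt (2 * pi * (\<sigma> * sqrt (1 + s))\<^sup>2))"
      using assms by simp
    have "normal_density 0 \<sigma> t * exp (s / (2 * \<sigma>\<^sup>2 * (1 + s)) * t\<^sup>2)
       = 1 / sqrt (2 * pi * \<sigma>\<^sup>2) * exp (- t\<^sup>2 / (2 * \<sigma>\<^sup>2) + s / (2 * \<sigma>\<^sup>2 * (1 + s)) * t\<^sup>2)"
      unfolding normal_density_def by (simp only: exp_add diff_0_right mult.assoc)
    also have "\<dots> = sqrt (1 + s) * normal_density 0 (\<sigma> * sqrt (1 + s)) t"
      unfolding e c normal_density_def by simp
    finally show ?thesis .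
  qed
  have "(\<integral>\<^sup>+t. ennreal (exp (s / (2 * \<sigma>\<^sup>2 * (1 + s)) * t\<^sup>2)) \<partial>density lborel (\<lambda>t. ennreal (normal_density 0 \<sigma> t)))
     = (\<integral>\<^sup>+t. ennreal (sqrt (1 + s)) * ennreal (normal_density 0 (\<sigma> * sqrt (1 + s)) t) \<partial>lborel)"
  proof (subst nn_integral_density)
    have "ennreal (normal_density 0 \<sigma> t) * ennreal (exp (s / (2 * \<sigma>\<^sup>2 * (1 + s)) * t\<^sup>2))
        = ennreal (sqrt (1 + s)) * ennreal (normal_density 0 (\<sigma> * sqrt (1 + s)) t)" for t
      using assms(2) by (subst (1 2) ennreal_mult[symmetric]) (auto simp only: eq normal_density_nonneg exp_ge_zero real_sqrt_ge_zero)
    then show "(\<integral>\<^sup>+t. ennreal (normal_density 0 \<sigma> t) * ennreal (exp (s / (2 * \<sigma>\<^sup>2 * (1 + s)) * t\<^sup>2)) \<partial>lborel)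
      = (\<integral>\<^sup>+t. ennreal (sqrt (1 + s)) * ennreal (normal_density 0 (\<sigma> * sqrt (1 + s)) t) \<partial>lborel)" by simp
  qed auto
  also have "\<dots> = ennreal (sqrt (1 + s)) * (\<integral>\<^sup>+t. ennreal (normal_density 0 (\<sigma> * sqrt (1 + s)) t) \<partial>lborel)"
    by (rule nn_integral_cmult) simp
  also have "\<dots> = ennreal (sqrt (1 + s))"
    using assms by (subst nn_integral_normal_density) auto
  finally show ?thesis .
qed

lemma vnorm_sq: "(vnorm n x)\<^sup>2 = (\<Sum>i<n. (x i)\<^sup>2)"
  by (simp add: vnorm_def L2_set_def sum_nonneg)

lemma vdist_sq: "(vdist n x y)\<^sup>2 = (\<Sum>i<n. (x i - y i)\<^sup>2)"
  by (simp add: vdist_def L2_set_def sum_nonneg)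

lemma vnorm_nonneg [simp]: "vnorm n x \<ge> 0" by (simp add: vnorm_def)
lemma vdist_nonneg [simp]: "vdist n x y \<ge> 0" by (simp add: vdist_def)

lemma nn_integral_exp_sq_gaussian:
  assumes "\<sigma> > 0" "s \<ge> 0"
  shows "(\<integral>\<^sup>+g. ennreal (exp (s / (2 * \<sigma>\<^sup>2 * (1 + s)) * (vnorm n g)\<^sup>2)) \<partial>gaussian_noise n \<sigma>) = ennreal (sqrt (1 + s) ^ n)"
proof -
  interpret product_sigma_finite "\<lambda>i::nat. density lborel (\<lambda>t. ennreal (normal_density 0 \<sigma> t))"
    by (rule product_sigma_finite_gaussian[OF assms(1)])
  have "(\<integral>\<^sup>+g. ennreal (exp (s / (2 * \<sigma>\<^sup>2 * (1 + s)) * (vnorm n g)\<^sup>2)) \<partial>gaussian_noise n \<sigma>)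
     = (\<integral>\<^sup>+g. (\<Prod>i<n. ennreal (exp (s / (2 * \<sigma>\<^sup>2 * (1 + s)) * (g i)\<^sup>2))) \<partial>gaussian_noise n \<sigma>)"
    by (simp add: vnorm_sq sum_distrib_left exp_sum prod_ennreal)
  also have "\<dots> = (\<Prod>i<n. ennreal (sqrt (1 + s)))"
    unfolding gaussian_noise_def
    by (subst product_nn_integral_prod) (simp, simp, simp only: nn_integral_exp_sq_normal[OF assms])
  also have "\<dots> = ennreal (sqrt (1 + s) ^ n)" using assms by (simp add: ennreal_power)
  finally show ?thesis .
qed

lemma nn_integral_exp_neg_sq:
  assumes "l > 0"
  shows "(\<integral>\<^sup>+t. ennreal (exp (- l * (t - z)\<^sup>2)) \<partial>lborel) = ennreal (sqrt (pi / l))"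
proof -
  define \<sigma> where "\<sigma> = sqrt (1 / (2 * l))"
  have s: "\<sigma> > 0" "\<sigma>\<^sup>2 = 1 / (2 * l)" using assms by (auto simp: \<sigma>_def)
  have "exp (- l * (t - z)\<^sup>2) = sqrt (pi / l) * normal_density z \<sigma> t" for t
    using assms by (simp add: normal_density_def s(2))
  then have "(\<integral>\<^sup>+t. ennreal (exp (- l * (t - z)\<^sup>2)) \<partial>lborel) = (\<integral>\<^sup>+t. ennreal (sqrt (pi / l)) * ennreal (normal_density z \<sigma> t) \<partial>lborel)"
    using assms by (simp add: ennreal_mult)
  also have "\<dots> = ennreal (sqrt (pi / l))"
    by (subst nn_integral_cmult) (auto simp: nn_integral_normal_density[OF s(1)])
  finally show ?thesis .
qed

lemma measurable_vnorm [measurable]: "vnorm n \<in> borel_measurable (Leb n)"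
  unfolding vnorm_def L2_set_def by measurable

lemma measurable_vdist2 [measurable]:
  assumes [measurable]: "f \<in> measurable M (Leb n)" "h \<in> measurable M (Leb n)"
  shows "(\<lambda>x. vdist n (f x) (h x)) \<in> borel_measurable M"
proof -
  have [measurable]: "(\<lambda>x. f x i) \<in> borel_measurable M" "(\<lambda>x. h x i) \<in> borel_measurable M" if "i < n" for i
    using measurable_compose[OF assms(1) measurable_component_singleton[of i]]
      measurable_compose[OF assms(2) measurable_component_singleton[of i]] that by auto
  show ?thesis
    unfolding vdist_def L2_set_def by measurable
qed

lemma measurable_vadd2 [measurable]:
  assumes [measurable]: "f \<in> measurable M (Leb n)" "h \<in> measurable M (Leb n)"
  shows "(\<lambda>x. vadd n (f x) (h x)) \<in> measurable M (Leb n)"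
proof -
  have [measurable]: "(\<lambda>x. f x i) \<in> borel_measurable M" "(\<lambda>x. h x i) \<in> borel_measurable M" if "i < n" for i
    using measurable_compose[OF assms(1) measurable_component_singleton[of i]]
      measurable_compose[OF assms(2) measurable_component_singleton[of i]] that by auto
  show ?thesis
    unfolding vadd_def by (rule measurable_restrict) auto
qed

text \<open>A Chernoff bound replaces the exact volume of the Euclidean ball and loses nothing on the
  exponential scale.\<close>

lemma ball_volume_le:
  assumes n: "n \<ge> 1" and r: "r \<ge> 0"
  shows "emeasure (Leb n) {y \<in> Rn n. vdist n y z < r} \<le> ennreal (sqrt (2 * pi * exp 1 * r\<^sup>2 / n) ^ n)"
proof (cases "r = 0")
  case True
  have "\<not> vdist n y z < 0" for y by (simp add: not_less)
  then show ?thesis using True by simp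
next
  case False
  then have r0: "r > 0" using r by simp
  \<comment> \<open>this value minimises the bound \<open>exp (l r\<^sup>2) (pi / l) powr (n / 2)\<close>\<close>
  define l where "l = n / (2 * r\<^sup>2)"
  have l: "l > 0" using n r0 by (simp add: l_def)
  have "emeasure (Leb n) {y \<in> Rn n. vdist n y z < r} = (\<integral>\<^sup>+y. indicator {y \<in> Rn n. vdist n y z < r} y \<partial>Leb n)"
  proof (rule nn_integral_indicator[symmetric])
    have "vdist n y z = vdist n y (\<lambda>i\<in>{..<n}. z i)" for y by (simp add: vdist_def L2_set_def)
    moreover have "{y \<in> space (Leb n). vdist n y (\<lambda>i\<in>{..<n}. z i) < r} \<in> sets (Leb n)"
      by measurable (auto simp: space_PiM)
    ultimately show "{y \<in> Rn n. vdist n y z < r} \<in> sets (Leb n)" by (simp add: space_Leb)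
  qed
  also have "\<dots> \<le> (\<integral>\<^sup>+y. ennreal (exp (l * r\<^sup>2)) * (\<Prod>i<n. ennreal (exp (- l * (y i - z i)\<^sup>2))) \<partial>Leb n)"
  proof (rule nn_integral_mono)
    fix y
    have eq: "ennreal (exp (l * r\<^sup>2)) * (\<Prod>i<n. ennreal (exp (- l * (y i - z i)\<^sup>2))) = ennreal (exp (l * (r\<^sup>2 - (vdist n y z)\<^sup>2)))"
      by (simp add: prod_ennreal ennreal_mult[symmetric] exp_sum[symmetric] exp_add[symmetric] vdist_sq
          sum_distrib_left[symmetric] sum_negf right_diff_distrib)
    show "indicator {y \<in> Rn n. vdist n y z < r} y \<le> ennreal (exp (l * r\<^sup>2)) * (\<Prod>i<n. ennreal (exp (- l * (y i - z i)\<^sup>2)))"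
      unfolding eq
    proof (cases "vdist n y z < r")
      case True
      then have "(vdist n y z)\<^sup>2 \<le> r\<^sup>2" by (intro power_mono) auto
      then have "1 \<le> exp (l * (r\<^sup>2 - (vdist n y z)\<^sup>2))" using l by simp
      then have "1 \<le> ennreal (exp (l * (r\<^sup>2 - (vdist n y z)\<^sup>2)))" by (simp add: ennreal_1[symmetric] del: ennreal_1)
      then show "indicator {y \<in> Rn n. vdist n y z < r} y \<le> ennreal (exp (l * (r\<^sup>2 - (vdist n y z)\<^sup>2)))"
        by (auto simp: indicator_def)
    qed (auto simp: indicator_def)
  qed
  also have "\<dots> = ennreal (exp (l * r\<^sup>2)) * (\<integral>\<^sup>+y. (\<Prod>i<n. ennreal (exp (- l * (y i - z i)\<^sup>2))) \<partial>Leb n)"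
    by (rule nn_integral_cmult) measurable
  also have "(\<integral>\<^sup>+y. (\<Prod>i<n. ennreal (exp (- l * (y i - z i)\<^sup>2))) \<partial>Leb n) = (\<Prod>i<n. ennreal (sqrt (pi / l)))"
    by (subst lebesgue_factors.product_nn_integral_prod) (auto simp: nn_integral_exp_neg_sq[OF l, simplified])
  also have "ennreal (exp (l * r\<^sup>2)) * (\<Prod>i<n. ennreal (sqrt (pi / l))) = ennreal (exp (l * r\<^sup>2) * sqrt (pi / l) ^ n)"
    using l by (simp add: ennreal_power ennreal_mult)
  also have "exp (l * r\<^sup>2) * sqrt (pi / l) ^ n = sqrt (2 * pi * exp 1 * r\<^sup>2 / n) ^ n"
  proof -
    have "exp (l * r\<^sup>2) = exp (1/2 :: real) ^ n" using r0 by (simp add: l_def exp_of_nat_mult[symmetric])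
    also have "exp (1/2 :: real) = sqrt (exp 1)" by (rule real_sqrt_unique[symmetric]) (simp_all add: exp_of_nat_mult[symmetric])
    finally show ?thesis
      by (simp add: power_mult_distrib[symmetric] real_sqrt_mult[symmetric] l_def mult_ac)
  qed
  finally show ?thesis .
qed

lemma powr_le_exp:
  fixes t a l :: real
  assumes "t \<ge> 0" "a > 0" "l > 0"
  shows "t powr a \<le> (a / (exp 1 * l)) powr a * exp (l * t)"
proof (cases "t = 0")
  case False
  then have t: "t > 0" using assms by simp
  define x where "x = l * t / a"
  have x: "x > 0" using assms t by (simp add: x_def)
  have "ln x \<le> x - 1" by (rule ln_le_minus_one[OF x])
  then have "a * ln x \<le> a * (x - 1)" using assms(2) by (intro mult_left_mono) auto
  then have "a * ln x \<le> a * x - a" by (simp add: right_diff_distrib)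
  then have 1: "x powr a \<le> exp (a * x - a)" using x by (simp add: powr_def)
  have "t powr a = (a / l) powr a * x powr a" using assms t by (simp add: x_def powr_mult[symmetric])
  also have "\<dots> \<le> (a / l) powr a * exp (a * x - a)" using 1 by (intro mult_left_mono) auto
  also have "exp (a * x - a) = exp (l * t) * (1 / exp 1) powr a"
  proof -
    have "a * x = l * t" using assms(2) by (simp add: x_def)
    moreover have "(1 / exp 1 :: real) powr a = exp (- a)" by (simp add: powr_def ln_div)
    ultimately show ?thesis by (simp add: exp_diff exp_minus divide_inverse)
  qed
  also have "(a / l) powr a * (exp (l * t) * (1 / exp 1) powr a) = ((a / l) * (1 / exp 1)) powr a * exp (l * t)"
    using assms by (subst powr_mult) auto
  finally show ?thesis by (simp add: mult.commute)
qed (use assms in auto)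

text \<open>The moment method produces the exponent as a function of the Chernoff parameter \<open>s\<close>; at the
  optimal \<open>s\<close> it agrees with both branches of \<open>Er\<close>.\<close>

lemma Er_eq_exponent:
  assumes "\<alpha> \<ge> 1" "L \<ge> 2" and s: "s = min (\<alpha>\<^sup>2) (real L) - 1"
  shows "s / 2 * (ln (1 + s) - 1 - 2 * ln \<alpha>) + ln (1 + s) / 2 = - Er L \<alpha>"
proof (cases "\<alpha> \<le> sqrt (real L)")
  case True
  then have "\<alpha>\<^sup>2 \<le> real L" using assms(1) by (metis real_sqrt_le_iff real_sqrt_unique abs_of_nonneg real_sqrt_abs order_trans zero_le_one)
  then have s: "s = \<alpha>\<^sup>2 - 1" using s by simp
  have "ln (1 + s) = 2 * ln \<alpha>" using assms(1) by (simp add: s ln_realpow)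
  then show ?thesis using True by (simp add: Er_def s algebra_simps diff_divide_distrib add_divide_distrib)
next
  case False
  then have "\<alpha>\<^sup>2 > real L" by (simp add: real_less_rsqrt real_sqrt_less_iff not_le) (metis assms(1) not_le order_trans real_le_rsqrt zero_le_one)
  then have s: "s = real L - 1" using s by simp
  show ?thesis using False by (simp add: Er_def s algebra_simps diff_divide_distrib add_divide_distrib)
qed

lemma Er_nonneg:
  assumes "\<alpha> \<ge> 1" "L \<ge> 2"
  shows "Er L \<alpha> \<ge> 0"
proof -
  define s where "s = min (\<alpha>\<^sup>2) (real L) - 1"
  have s0: "s \<ge> 0" using assms one_le_power[OF assms(1), of 2] by (auto simp: s_def)
  have "1 + s \<le> \<alpha>\<^sup>2" by (simp add: s_def)
  then have "ln (1 + s) \<le> 2 * ln \<alpha>" using assms(1) s0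
    by (metis ln_le_cancel_iff ln_realpow numeral_eq_of_nat of_nat_numeral add_pos_nonneg zero_less_one zero_less_power order_less_le_trans)
  then have "s / 2 * (ln (1 + s) - 1 - 2 * ln \<alpha>) \<le> s / 2 * (- 1)"
    using s0 by (intro mult_left_mono) auto
  moreover have "ln (1 + s) \<le> s" using s0 ln_add_one_self_le_self by blast
  ultimately show ?thesis using Er_eq_exponent[OF assms s_def] by linarith
qed

text \<open>Given the noise, at most \<open>w\<close> other codewords are expected in the ball in which an error
  occurs.  Bounding the conditional error probability \<open>min 1 (w ^ (L - 1))\<close> by
  \<open>w powr s\<close> with \<open>s \<le> L - 1\<close> and optimising over \<open>s\<close> gives \<open>s = min (\<alpha>\<^sup>2) L - 1\<close>; the two branches of the exponent are the
  interior optimum and the boundary value \<open>s = L - 1\<close>.\<close>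

lemma gaussian_list_moment:
  assumes \<sigma>: "\<sigma> > 0" and \<alpha>: "\<alpha> \<ge> 1" and L: "L \<ge> 2" and n: "n \<ge> 1"
  shows "(\<integral>\<^sup>+g. min 1 (ennreal ((sqrt ((vnorm n g)\<^sup>2 / (n * \<sigma>\<^sup>2 * \<alpha>\<^sup>2)) ^ n) ^ (L - 1))) \<partial>gaussian_noise n \<sigma>)
     \<le> ennreal (exp (- real n * Er L \<alpha>))"
proof -
  interpret prob_space "gaussian_noise n \<sigma>" by (rule prob_space_gaussian_noise[OF \<sigma>])
  define s where "s = min (\<alpha>\<^sup>2) (real L) - 1"
  have s0: "s \<ge> 0" using L one_le_power[OF \<alpha>, of 2] by (auto simp: s_def)
  have sL: "s \<le> real (L - 1)" using L by (simp add: s_def of_nat_diff)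
  note ex = Er_eq_exponent[OF \<alpha> L s_def]
  let ?w = "\<lambda>g. (sqrt ((vnorm n g)\<^sup>2 / (n * \<sigma>\<^sup>2 * \<alpha>\<^sup>2)) ^ n) ^ (L - 1)"
  show ?thesis
  proof (cases "s = 0")
    case True
    then have "Er L \<alpha> = 0" using ex by simp
    moreover have "(\<integral>\<^sup>+g. min 1 (ennreal (?w g)) \<partial>gaussian_noise n \<sigma>) \<le> (\<integral>\<^sup>+g. 1 \<partial>gaussian_noise n \<sigma>)"
      by (rule nn_integral_mono) simp
    ultimately show ?thesis by (simp add: emeasure_space_1)
  next
    case False
    then have s1: "s > 0" using s0 by simp
    \<comment> \<open>with this \<open>l\<close> the bound \<open>t powr a \<le> c exp (l t)\<close> is tight at the value of the squared noise
      norm that dominates the moment\<close>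
    define l where "l = s / (2 * \<sigma>\<^sup>2 * (1 + s))"
    define a where "a = n * s / 2"
    have l: "l > 0" and a: "a > 0" using s1 \<sigma> n by (auto simp: l_def a_def)
    define c where "c = ((1 + s) / (exp 1 * \<alpha>\<^sup>2)) powr a"
    have al: "a / (exp 1 * l) = real n * \<sigma>\<^sup>2 * (1 + s) / exp 1"
      using s1 \<sigma> by (simp add: a_def l_def field_simps power2_eq_square)
    have pt: "min 1 (?w g) \<le> c * exp (l * (vnorm n g)\<^sup>2)" for g
    proof -
      define t where "t = (vnorm n g)\<^sup>2"
      have t: "t \<ge> 0" by (simp add: t_def)
      define k where "k = n * \<sigma>\<^sup>2 * \<alpha>\<^sup>2"
      have k: "k > 0" using n \<sigma> \<alpha> by (simp add: k_def)
      have "min 1 ((sqrt (t / k) ^ n) ^ (L - 1)) \<le> (t / k) powr a"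
      proof (cases "t = 0")
        case True
        have "(0::real) ^ n = 0" "(0::real) ^ (L - 1) = 0" using n L by (auto simp: power_0_left)
        then have "(sqrt (t / k) ^ n) ^ (L - 1) = 0" using True by (simp only: div_0 real_sqrt_zero)
        then show ?thesis using powr_ge_zero[of "t / k" a] by linarith
      next
        case False
        then have tk: "t / k > 0" using t k by simp
        have e: "(sqrt (t / k) ^ n) ^ (L - 1) = (t / k) powr (n * real (L - 1) / 2)"
        proof -
          have "(sqrt (t / k) ^ n) ^ (L - 1) = sqrt (t / k) ^ (n * (L - 1))" by (rule power_mult[symmetric])
          also have "\<dots> = sqrt (t / k) powr real (n * (L - 1))"
            by (rule powr_realpow[symmetric]) (use tk in simp)
          also have "\<dots> = ((t / k) powr (1 / 2)) powr real (n * (L - 1))" using tk by (simp only: powr_half_sqrt)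
          finally show ?thesis by (simp only: powr_powr of_nat_mult times_divide_eq_left mult_1)
        qed
        show ?thesis
        proof (cases "t / k \<le> 1")
          case True
          have "a \<le> n * real (L - 1) / 2" using sL by (simp add: a_def mult_left_mono)
          then have "(t / k) powr (n * real (L - 1) / 2) \<le> (t / k) powr a" using tk True by (intro powr_mono') auto
          then show ?thesis unfolding e by linarith
        next
          case False
          then have "1 \<le> (t / k) powr a" using a by (intro ge_one_powr_ge_zero) auto
          then show ?thesis by linarith
        qed
      qed
      also have "(t / k) powr a = t powr a / k powr a" using t k by (simp add: powr_divide)
      also have "\<dots> \<le> ((a / (exp 1 * l)) powr a * exp (l * t)) / k powr a"
        by (intro divide_right_mono powr_le_exp) (use t a l in auto)
      also have "\<dots> = ((a / (exp 1 * l)) / k) powr a * exp (l * t)"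
      proof -
        have "a / (exp 1 * l) \<ge> 0" using a l by simp
        then have "((a / (exp 1 * l)) / k) powr a = (a / (exp 1 * l)) powr a / k powr a"
          by (intro powr_divide)
        then show ?thesis by simp
      qed
      also have "(a / (exp 1 * l)) / k = (1 + s) / (exp 1 * \<alpha>\<^sup>2)"
        unfolding al k_def using n \<sigma> \<alpha> by (simp add: field_simps)
      finally show ?thesis by (simp add: c_def t_def k_def)
    qed
    have "(\<integral>\<^sup>+g. min 1 (ennreal (?w g)) \<partial>gaussian_noise n \<sigma>)
      \<le> (\<integral>\<^sup>+g. ennreal c * ennreal (exp (l * (vnorm n g)\<^sup>2)) \<partial>gaussian_noise n \<sigma>)"
    proof (rule nn_integral_mono)
      fix g
      have "min 1 (ennreal (?w g))
        \<le> ennreal (min 1 (?w g))"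
        unfolding min_def by auto
      also have "\<dots> \<le> ennreal (c * exp (l * (vnorm n g)\<^sup>2))" by (rule ennreal_leI[OF pt])
      also have "\<dots> = ennreal c * ennreal (exp (l * (vnorm n g)\<^sup>2))" by (rule ennreal_mult) (auto simp: c_def)
      finally show "min 1 (ennreal (?w g)) \<le> ennreal c * ennreal (exp (l * (vnorm n g)\<^sup>2))" .
    qed
    also have "\<dots> = ennreal c * (\<integral>\<^sup>+g. ennreal (exp (l * (vnorm n g)\<^sup>2)) \<partial>gaussian_noise n \<sigma>)"
      by (rule nn_integral_cmult) measurable
    also have "\<dots> = ennreal (c * sqrt (1 + s) ^ n)"
      unfolding l_def nn_integral_exp_sq_gaussian[OF \<sigma> s0] using s0 by (subst ennreal_mult) (auto simp: c_def)
    also have "c * sqrt (1 + s) ^ n = exp (- real n * Er L \<alpha>)"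
    proof -
      have "c = exp (a * (ln (1 + s) - 1 - 2 * ln \<alpha>))"
        using s1 \<alpha> by (simp add: c_def powr_def ln_div ln_mult ln_realpow algebra_simps)
      moreover have "sqrt (1 + s) ^ n = exp (n * (ln (1 + s) / 2))"
        unfolding exp_of_nat_mult using s1 by (simp add: powr_half_sqrt[symmetric] powr_def)
      ultimately have "c * sqrt (1 + s) ^ n = exp (a * (ln (1 + s) - 1 - 2 * ln \<alpha>) + n * (ln (1 + s) / 2))"
        by (simp add: exp_add)
      also have "a * (ln (1 + s) - 1 - 2 * ln \<alpha>) + n * (ln (1 + s) / 2) = n * (s / 2 * (ln (1 + s) - 1 - 2 * ln \<alpha>) + ln (1 + s) / 2)"
        by (simp add: a_def algebra_simps)
      finally show ?thesis unfolding ex by simp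
    qed
    finally show ?thesis .
  qed
qed

lemma gaussian_tail:
  assumes "\<sigma> > 0" "e > 0"
  obtains r where "r > 0" "measure (gaussian_noise n \<sigma>) {g \<in> space (gaussian_noise n \<sigma>). vnorm n g \<ge> r} \<le> e"
proof -
  interpret prob_space "gaussian_noise n \<sigma>" by (rule prob_space_gaussian_noise[OF assms(1)])
  define X where "X m = {g \<in> space (gaussian_noise n \<sigma>). vnorm n g \<ge> real m}" for m
  have X: "X m \<in> sets (gaussian_noise n \<sigma>)" for m unfolding X_def by measurable
  have "decseq X" unfolding decseq_def X_def by (auto simp: le_trans)
  then have "(\<lambda>m. measure (gaussian_noise n \<sigma>) (X m)) \<longlonglongrightarrow> measure (gaussian_noise n \<sigma>) (\<Inter>m. X m)"
    using X by (intro finite_Lim_measure_decseq) auto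
  moreover have "(\<Inter>m. X m) = {}"
  proof -
    have "\<exists>m. \<not> real m \<le> vnorm n g" for g using reals_Archimedean2[of "vnorm n g"] by (auto simp: not_le)
    then show ?thesis unfolding X_def by blast
  qed
  ultimately have "(\<lambda>m. measure (gaussian_noise n \<sigma>) (X m)) \<longlonglongrightarrow> 0" by simp
  then have "\<forall>\<^sub>F m in sequentially. measure (gaussian_noise n \<sigma>) (X m) < e" by (rule order_tendstoD) (use assms in simp)
  then have "\<forall>\<^sub>F m in sequentially. measure (gaussian_noise n \<sigma>) (X m) < e \<and> m > 0"
    by (intro eventually_conj eventually_gt_at_top)
  then obtain m where "measure (gaussian_noise n \<sigma>) (X m) < e" "m > 0" by (auto simp: eventually_sequentially)
  then show ?thesis using that[of "real m"] by (auto simp: X_def)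
qed

section \<open>Random coding\<close>

text \<open>Conditionally on the point with index \<open>i\<close> the other points are still independent, so the
  probabilities of the events that pair them with it multiply.\<close>

lemma iid_pairs_bound:
  fixes M :: "'a measure" and I :: "nat set"
  assumes "prob_space M" and I: "finite I" "i \<in> I" and J: "J \<subseteq> I - {i}"
    and S [measurable]: "S \<in> sets (M \<Otimes>\<^sub>M M)"
    and b: "\<And>y. y \<in> space M \<Longrightarrow> emeasure M {x \<in> space M. (y, x) \<in> S} \<le> b"
  shows "(\<integral>\<^sup>+\<omega>. (\<Prod>j\<in>J. indicator S (\<omega> i, \<omega> j)) \<partial>PiM I (\<lambda>_. M)) \<le> b ^ card J"
proof -
  interpret prob_space M by fact
  interpret product_sigma_finite "\<lambda>_::nat. M"
    by (simp add: product_sigma_finite_def sigma_finite_measure_axioms)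
  define I' where "I' = I - {i}"
  have I': "finite I'" "i \<notin> I'" "I = insert i I'" "J \<subseteq> I'" using I J by (auto simp: I'_def)
  have fJ: "finite J" using I' finite_subset by blast
  have m: "(\<lambda>\<omega>. (\<Prod>j\<in>J. indicator S (\<omega> i, \<omega> j) :: ennreal)) \<in> borel_measurable (PiM (insert i I') (\<lambda>_. M))"
  proof (rule borel_measurable_prod_ennreal)
    fix j assume "j \<in> J"
    then have [measurable]: "(\<lambda>\<omega>. \<omega> j) \<in> measurable (PiM (insert i I') (\<lambda>_. M)) M"
        "(\<lambda>\<omega>. \<omega> i) \<in> measurable (PiM (insert i I') (\<lambda>_. M)) M"
      using I' by (auto intro!: measurable_component_singleton)
    show "(\<lambda>\<omega>. indicator S (\<omega> i, \<omega> j) :: ennreal) \<in> borel_measurable (PiM (insert i I') (\<lambda>_. M))" by measurable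
  qed
  have "(\<integral>\<^sup>+\<omega>. (\<Prod>j\<in>J. indicator S (\<omega> i, \<omega> j)) \<partial>PiM I (\<lambda>_. M))
     = (\<integral>\<^sup>+y. (\<integral>\<^sup>+x. (\<Prod>j\<in>J. indicator S ((x(i := y)) i, (x(i := y)) j)) \<partial>PiM I' (\<lambda>_. M)) \<partial>M)"
    unfolding I'(3) by (rule product_nn_integral_insert_rev[OF I'(1,2) m])
  also have "\<dots> \<le> (\<integral>\<^sup>+y. b ^ card J \<partial>M)"
  proof (rule nn_integral_mono)
    fix y assume y: "y \<in> space M"
    have my: "(\<lambda>x. indicator S (y, x) :: ennreal) \<in> borel_measurable M" using y by measurable
    have "(\<integral>\<^sup>+x. (\<Prod>j\<in>J. indicator S ((x(i := y)) i, (x(i := y)) j)) \<partial>PiM I' (\<lambda>_. M))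
       = (\<integral>\<^sup>+x. (\<Prod>j\<in>I'. (\<lambda>j t. if j \<in> J then indicator S (y, t) else 1) j (x j)) \<partial>PiM I' (\<lambda>_. M))"
    proof (rule nn_integral_cong)
      fix x
      have "(\<Prod>j\<in>J. indicator S ((x(i := y)) i, (x(i := y)) j)) = (\<Prod>j\<in>J. indicator S (y, x j) :: ennreal)"
        by (rule prod.cong) (use I' in auto)
      also have "\<dots> = (\<Prod>j\<in>I' \<inter> J. indicator S (y, x j))" using I'(4) by (simp add: Int_absorb1)
      also have "\<dots> = (\<Prod>j\<in>I'. if j \<in> J then indicator S (y, x j) else 1)"
        by (rule prod.inter_restrict[OF I'(1)])
      finally show "(\<Prod>j\<in>J. indicator S ((x(i := y)) i, (x(i := y)) j)) = (\<Prod>j\<in>I'. (\<lambda>j t. if j \<in> J then indicator S (y, t) else 1 :: ennreal) j (x j))" .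
    qed
    also have "\<dots> = (\<Prod>j\<in>I'. \<integral>\<^sup>+t. (if j \<in> J then indicator S (y, t) else 1) \<partial>M)"
      by (rule product_nn_integral_prod[OF I'(1)]) (use my in auto)
    also have "\<dots> = (\<Prod>j\<in>I'. if j \<in> J then emeasure M {x \<in> space M. (y, x) \<in> S} else 1)"
    proof (rule prod.cong[OF refl])
      fix j
      have "(\<integral>\<^sup>+t. indicator S (y, t) \<partial>M) = (\<integral>\<^sup>+t. indicator {x \<in> space M. (y, x) \<in> S} t \<partial>M)"
        by (rule nn_integral_cong) (auto simp: indicator_def)
      also have "\<dots> = emeasure M {x \<in> space M. (y, x) \<in> S}"
        by (rule nn_integral_indicator) (use y in measurable)
      finally show "(\<integral>\<^sup>+t. (if j \<in> J then indicator S (y, t) else 1) \<partial>M) = (if j \<in> J then emeasure M {x \<in> space M. (y, x) \<in> S} else 1)"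
        by (simp add: emeasure_space_1)
    qed
    also have "\<dots> = (\<Prod>j\<in>J. emeasure M {x \<in> space M. (y, x) \<in> S})"
      using prod.inter_restrict[OF I'(1), of "\<lambda>_. emeasure M {x \<in> space M. (y, x) \<in> S}" J] I'(4) by (simp add: Int_absorb1)
    also have "\<dots> = emeasure M {x \<in> space M. (y, x) \<in> S} ^ card J" by simp
    also have "\<dots> \<le> b ^ card J" by (rule power_mono[OF b[OF y]]) simp
    finally show "(\<integral>\<^sup>+x. (\<Prod>j\<in>J. indicator S ((x(i := y)) i, (x(i := y)) j)) \<partial>PiM I' (\<lambda>_. M)) \<le> b ^ card J" .
  qed
  also have "\<dots> = b ^ card J" by (simp add: emeasure_space_1)
  finally show ?thesis .
qed

lemma exists_le_mean:
  assumes "prob_space M" and f: "f \<in> borel_measurable M" and "(\<integral>\<^sup>+x. f x \<partial>M) \<le> c" "c < \<infinity>" and P: "AE x in M. P x"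
  shows "\<exists>x\<in>space M. P x \<and> f x \<le> c"
proof (rule ccontr)
  interpret prob_space M by fact
  assume na: "\<not> ?thesis"
  have gt: "AE x in M. c < f x"
    by (rule AE_mp[OF P], intro AE_I2) (use na in \<open>auto simp: not_le\<close>)
  have "(\<integral>\<^sup>+x. c \<partial>M) < (\<integral>\<^sup>+x. f x \<partial>M)"
  proof (rule nn_integral_less)
    show "(\<integral>\<^sup>+x. c \<partial>M) \<noteq> \<infinity>" using assms(4) by (simp add: emeasure_space_1)
    show "AE x in M. c \<le> f x" using gt by eventually_elim auto
    show "\<not> (AE x in M. f x \<le> c)"
    proof
      assume "AE x in M. f x \<le> c"
      with gt have "AE x in M. False" by eventually_elim auto
      then show False by simp
    qed
  qed (use f in auto)
  then show False using assms(3) by (simp add: emeasure_space_1)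
qed

definition uniform_cube :: "nat \<Rightarrow> real \<Rightarrow> (nat \<Rightarrow> real) measure" where
  "uniform_cube n A = uniform_measure (Leb n) (cube n (\<lambda>_. 0) A)"

lemma sets_uniform_cube [measurable_cong]: "sets (uniform_cube n A) = sets (Leb n)"
  by (simp add: uniform_cube_def)

lemma space_uniform_cube: "space (uniform_cube n A) = Rn n"
  by (simp add: uniform_cube_def space_PiM)

lemma prob_space_uniform_cube: "A > 0 \<Longrightarrow> prob_space (uniform_cube n A)"
  unfolding uniform_cube_def by (intro prob_space_uniform_measure) (auto simp: emeasure_cube)

lemma emeasure_uniform_cube_le:
  assumes "A > 0" "X \<in> sets (Leb n)" "emeasure (Leb n) X \<le> ennreal v"
  shows "emeasure (uniform_cube n A) X \<le> ennreal (v / A ^ n)"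
proof -
  have "emeasure (uniform_cube n A) X = emeasure (Leb n) (cube n (\<lambda>_. 0) A \<inter> X) / ennreal (A ^ n)"
    unfolding uniform_cube_def using assms by (subst emeasure_uniform_measure) (auto simp: emeasure_cube)
  also have "\<dots> \<le> ennreal v / ennreal (A ^ n)"
  proof (rule divide_right_mono_ennreal)
    have "emeasure (Leb n) (cube n (\<lambda>_. 0) A \<inter> X) \<le> emeasure (Leb n) X"
      by (rule emeasure_mono) (use assms in auto)
    then show "emeasure (Leb n) (cube n (\<lambda>_. 0) A \<inter> X) \<le> ennreal v" using assms(3) by order
  qed
  also have "\<dots> \<le> ennreal (v / A ^ n)"
    using assms(1) by (cases "v \<ge> 0") (auto simp: divide_ennreal ennreal_neg)
  finally show ?thesis .
qed

text \<open>Lists of codewords are described by sets of indices: for a random code this keeps the error event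
  a finite union of events that depend on finitely many coordinates.\<close>

definition index_error :: "nat \<Rightarrow> nat \<Rightarrow> nat \<Rightarrow> nat \<Rightarrow> (nat \<Rightarrow> nat \<Rightarrow> real) \<Rightarrow> (nat \<Rightarrow> real) \<Rightarrow> bool" where
  "index_error n N L i \<omega> g \<longleftrightarrow> (\<exists>J\<in>{J. J \<subseteq> {..<N} - {i} \<and> card J = L - 1}.
     \<forall>j\<in>J. vdist n (\<omega> j) (vadd n (\<omega> i) g) < vnorm n g)"

lemma finite_index_sets: "finite {J. J \<subseteq> {..<N::nat} - {i} \<and> card J = (k::nat)}"
  by (rule finite_subset[of _ "Pow {..<N}"]) auto

lemma pred_index_error:
  assumes "i < N"
  shows "Measurable.pred (PiM {..<N} (\<lambda>_. uniform_cube n A) \<Otimes>\<^sub>M gaussian_noise n \<sigma>) (\<lambda>(\<omega>, g). index_error n N L i \<omega> g)"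
  unfolding index_error_def case_prod_beta'
proof (intro pred_intros_finite finite_index_sets)
  let ?M = "PiM {..<N} (\<lambda>_. uniform_cube n A) \<Otimes>\<^sub>M gaussian_noise n \<sigma>"
  fix J assume J: "J \<in> {J. J \<subseteq> {..<N} - {i} \<and> card J = L - 1}"
  show "finite J" using J finite_subset by blast
next
  let ?M = "PiM {..<N} (\<lambda>_. uniform_cube n A) \<Otimes>\<^sub>M gaussian_noise n \<sigma>"
  fix J j assume J: "J \<in> {J. J \<subseteq> {..<N} - {i} \<and> card J = L - 1}" "j \<in> J"
  have c: "(\<lambda>w. fst w k) \<in> measurable ?M (Leb n)" if "k < N" for k
  proof -
    have "(\<lambda>w. fst w k) \<in> measurable ?M (uniform_cube n A)"
      by (rule measurable_compose[OF measurable_fst measurable_component_singleton]) (use that in auto)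
    then show ?thesis by (simp cong: measurable_cong_sets add: measurable_cong_sets[OF refl sets_uniform_cube])
  qed
  have s: "snd \<in> measurable ?M (Leb n)"
    using measurable_snd[of "PiM {..<N} (\<lambda>_. uniform_cube n A)" "gaussian_noise n \<sigma>"]
    by (simp add: measurable_cong_sets[OF refl sets_gaussian_noise])
  note [measurable] = c[OF assms] s
  have [measurable]: "(\<lambda>w. fst w j) \<in> measurable ?M (Leb n)"
    using J by (intro c) auto
  have [measurable]: "(\<lambda>w. vnorm n (snd w)) \<in> borel_measurable ?M"
    by (rule measurable_compose[OF s measurable_vnorm])
  show "Measurable.pred ?M
     (\<lambda>w. vdist n (fst w j) (vadd n (fst w i) (snd w)) < vnorm n (snd w))"
    by measurable
qed

text \<open>For fixed noise the union bound over the lists of length \<open>L - 1\<close> gives a power of the expected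
  number of codewords in the error ball.  The density hypothesis says that the code has at most the
  rate of the theorem.\<close>

lemma index_error_given_noise:
  assumes A: "A > 0" and n: "n \<ge> 1" and i: "i < N" and g: "g \<in> Rn n"
    and dens: "real N / A ^ n * sqrt (2 * pi * exp 1 * \<sigma>\<^sup>2 * \<alpha>\<^sup>2) ^ n \<le> 1" and \<sigma>: "\<sigma> > 0" and \<alpha>: "\<alpha> \<ge> 1"
  shows "(\<integral>\<^sup>+\<omega>. indicator {\<omega>. index_error n N L i \<omega> g} \<omega> \<partial>PiM {..<N} (\<lambda>_. uniform_cube n A))
     \<le> min 1 (ennreal ((sqrt ((vnorm n g)\<^sup>2 / (n * \<sigma>\<^sup>2 * \<alpha>\<^sup>2)) ^ n) ^ (L - 1)))"
proof -
  define U where "U = uniform_cube n A"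
  interpret U: prob_space U unfolding U_def by (rule prob_space_uniform_cube[OF A])
  interpret Om: prob_space "PiM {..<N} (\<lambda>_. U)" by (rule prob_space_PiM) (rule U.prob_space_axioms)
  have sU: "sets U = sets (Leb n)" unfolding U_def by (rule sets_uniform_cube)
  have spU: "space U = Rn n" unfolding U_def by (rule space_uniform_cube)
  define r where "r = vnorm n g"
  define S where "S = {w \<in> space (U \<Otimes>\<^sub>M U). vdist n (snd w) (vadd n (fst w) g) < r}"
  have [measurable]: "fst \<in> measurable (U \<Otimes>\<^sub>M U) (Leb n)" "snd \<in> measurable (U \<Otimes>\<^sub>M U) (Leb n)"
    using measurable_fst[of U U] measurable_snd[of U U] by (simp_all add: measurable_cong_sets[OF refl sU])
  have [measurable]: "(\<lambda>w. g) \<in> measurable (U \<Otimes>\<^sub>M U) (Leb n)" using g by (simp add: space_Leb)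
  have S: "S \<in> sets (U \<Otimes>\<^sub>M U)" unfolding S_def by measurable
  define v where "v = sqrt (2 * pi * exp 1 * r\<^sup>2 / n) ^ n"
  have v0: "v \<ge> 0" by (simp add: v_def)
  define b where "b = ennreal (v / A ^ n)"
  have bS: "emeasure U {x \<in> space U. (y, x) \<in> S} \<le> b" if y: "y \<in> space U" for y
  proof -
    have eq: "{x \<in> space U. (y, x) \<in> S} = {x \<in> Rn n. vdist n x (vadd n y g) < r}"
      using y by (auto simp: S_def space_pair_measure spU)
    have "(\<lambda>x. (y, x)) -` S \<inter> space U \<in> sets U"
      by (rule measurable_sets[OF _ S]) (use y in simp)
    then have "{x \<in> Rn n. vdist n x (vadd n y g) < r} \<in> sets (Leb n)"
      unfolding eq[symmetric] by (simp add: vimage_def Int_def conj_commute sU)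
    from emeasure_uniform_cube_le[OF A this ball_volume_le[OF n]]
    show ?thesis unfolding eq unfolding b_def U_def v_def by (simp add: r_def)
  qed
  define JJ where "JJ = {J. J \<subseteq> {..<N} - {i} \<and> card J = L - 1}"
  have fJJ: "finite JJ" unfolding JJ_def by (rule finite_index_sets)
  have cJJ: "card JJ \<le> N ^ (L - 1)"
  proof -
    have "card JJ = card ({..<N} - {i}) choose (L - 1)" unfolding JJ_def by (rule n_subsets) simp
    also have "card ({..<N} - {i}) = N - 1" using i by simp
    also have "(N - 1) choose (L - 1) \<le> N ^ (L - 1)"
    proof (cases "L - 1 \<le> N - 1")
      case True
      then have "(N - 1) choose (L - 1) \<le> (N - 1) ^ (L - 1)" by (rule binomial_le_pow)
      also have "\<dots> \<le> N ^ (L - 1)" by (rule power_mono) auto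
      finally show ?thesis .
    next
      case False then show ?thesis by (simp add: binomial_eq_0)
    qed
    finally show ?thesis .
  qed
  have mprod: "(\<lambda>\<omega>. (\<Prod>j\<in>J. indicator S (\<omega> i, \<omega> j) :: ennreal)) \<in> borel_measurable (PiM {..<N} (\<lambda>_. U))" if "J \<in> JJ" for J
  proof (rule borel_measurable_prod_ennreal)
    fix j assume "j \<in> J"
    then have [measurable]: "(\<lambda>\<omega>. \<omega> j) \<in> measurable (PiM {..<N} (\<lambda>_. U)) U"
        "(\<lambda>\<omega>. \<omega> i) \<in> measurable (PiM {..<N} (\<lambda>_. U)) U"
      using that i by (auto simp: JJ_def intro!: measurable_component_singleton)
    note S [measurable]
    show "(\<lambda>\<omega>. indicator S (\<omega> i, \<omega> j) :: ennreal) \<in> borel_measurable (PiM {..<N} (\<lambda>_. U))" by measurable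
  qed
  have "(\<integral>\<^sup>+\<omega>. indicator {\<omega>. index_error n N L i \<omega> g} \<omega> \<partial>PiM {..<N} (\<lambda>_. U))
     \<le> (\<integral>\<^sup>+\<omega>. (\<Sum>J\<in>JJ. \<Prod>j\<in>J. indicator S (\<omega> i, \<omega> j)) \<partial>PiM {..<N} (\<lambda>_. U))"
  proof (rule nn_integral_mono)
    fix \<omega> assume w: "\<omega> \<in> space (PiM {..<N} (\<lambda>_. U))"
    show "indicator {\<omega>. index_error n N L i \<omega> g} \<omega> \<le> (\<Sum>J\<in>JJ. \<Prod>j\<in>J. indicator S (\<omega> i, \<omega> j) :: ennreal)"
    proof (cases "index_error n N L i \<omega> g")
      case True
      then obtain J where J: "J \<in> JJ" "\<forall>j\<in>J. vdist n (\<omega> j) (vadd n (\<omega> i) g) < vnorm n g"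
        by (auto simp: index_error_def JJ_def)
      have "(\<omega> i, \<omega> j) \<in> S" if "j \<in> J" for j
        using J that w i by (auto simp: S_def space_pair_measure space_PiM JJ_def PiE_iff r_def)
      then have "(1::ennreal) = (\<Prod>j\<in>J. indicator S (\<omega> i, \<omega> j))" by simp
      also have "\<dots> \<le> (\<Sum>J\<in>JJ. \<Prod>j\<in>J. indicator S (\<omega> i, \<omega> j))"
        by (rule member_le_sum[OF J(1)]) (use fJJ in auto)
      finally show ?thesis using True by simp
    qed simp
  qed
  also have "\<dots> = (\<Sum>J\<in>JJ. \<integral>\<^sup>+\<omega>. (\<Prod>j\<in>J. indicator S (\<omega> i, \<omega> j)) \<partial>PiM {..<N} (\<lambda>_. U))"
    by (rule nn_integral_sum) (rule mprod)
  also have "\<dots> \<le> (\<Sum>J\<in>JJ. b ^ (L - 1))"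
  proof (rule sum_mono)
    fix J assume J: "J \<in> JJ"
    have "(\<integral>\<^sup>+\<omega>. (\<Prod>j\<in>J. indicator S (\<omega> i, \<omega> j)) \<partial>PiM {..<N} (\<lambda>_. U)) \<le> b ^ card J"
      by (rule iid_pairs_bound[OF U.prob_space_axioms _ _ _ S bS]) (use i J in \<open>auto simp: JJ_def\<close>)
    then show "(\<integral>\<^sup>+\<omega>. (\<Prod>j\<in>J. indicator S (\<omega> i, \<omega> j)) \<partial>PiM {..<N} (\<lambda>_. U)) \<le> b ^ (L - 1)"
      using J by (simp add: JJ_def)
  qed
  also have "\<dots> = of_nat (card JJ) * b ^ (L - 1)" by simp
  also have "\<dots> \<le> of_nat (N ^ (L - 1)) * b ^ (L - 1)"
    by (rule mult_right_mono) (use cJJ in \<open>auto simp del: of_nat_power\<close>)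
  also have "\<dots> = ennreal ((real N * (v / A ^ n)) ^ (L - 1))"
  proof -
    have "of_nat (N ^ (L - 1)) * b ^ (L - 1) = (ennreal (real N) * ennreal (v / A ^ n)) ^ (L - 1)"
      by (simp add: power_mult_distrib ennreal_of_nat_eq_real_of_nat[symmetric] b_def)
    also have "ennreal (real N) * ennreal (v / A ^ n) = ennreal (real N * (v / A ^ n))"
      using v0 A by (intro ennreal_mult[symmetric]) auto
    finally show ?thesis using v0 A by (simp add: ennreal_power)
  qed
  also have "\<dots> \<le> ennreal ((sqrt (r\<^sup>2 / (n * \<sigma>\<^sup>2 * \<alpha>\<^sup>2)) ^ n) ^ (L - 1))"
  proof (intro ennreal_leI power_mono)
    have "v = sqrt (2 * pi * exp 1 * \<sigma>\<^sup>2 * \<alpha>\<^sup>2) ^ n * sqrt (r\<^sup>2 / (n * \<sigma>\<^sup>2 * \<alpha>\<^sup>2)) ^ n"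
      unfolding v_def power_mult_distrib[symmetric] real_sqrt_mult[symmetric] using \<sigma> \<alpha> by (simp add: mult_ac)
    then have "real N * (v / A ^ n) = (real N / A ^ n * sqrt (2 * pi * exp 1 * \<sigma>\<^sup>2 * \<alpha>\<^sup>2) ^ n) * sqrt (r\<^sup>2 / (n * \<sigma>\<^sup>2 * \<alpha>\<^sup>2)) ^ n"
      by simp
    also have "\<dots> \<le> 1 * sqrt (r\<^sup>2 / (n * \<sigma>\<^sup>2 * \<alpha>\<^sup>2)) ^ n"
      by (rule mult_right_mono[OF dens]) simp
    finally show "real N * (v / A ^ n) \<le> sqrt (r\<^sup>2 / (n * \<sigma>\<^sup>2 * \<alpha>\<^sup>2)) ^ n" by simp
  qed (use v0 A in auto)
  finally have 1: "(\<integral>\<^sup>+\<omega>. indicator {\<omega>. index_error n N L i \<omega> g} \<omega> \<partial>PiM {..<N} (\<lambda>_. U))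
     \<le> ennreal ((sqrt (r\<^sup>2 / (n * \<sigma>\<^sup>2 * \<alpha>\<^sup>2)) ^ n) ^ (L - 1))" .
  have "(\<integral>\<^sup>+\<omega>. indicator {\<omega>. index_error n N L i \<omega> g} \<omega> \<partial>PiM {..<N} (\<lambda>_. U)) \<le> (\<integral>\<^sup>+\<omega>. 1 \<partial>PiM {..<N} (\<lambda>_. U))"
    by (rule nn_integral_mono) (simp add: indicator_def)
  then have 2: "(\<integral>\<^sup>+\<omega>. indicator {\<omega>. index_error n N L i \<omega> g} \<omega> \<partial>PiM {..<N} (\<lambda>_. U)) \<le> 1"
    by (simp add: Om.emeasure_space_1)
  show ?thesis using 1 2 by (simp add: U_def r_def)
qed

lemma AE_distinct_codewords:
  fixes N :: nat
  assumes A: "A > 0" and n: "n \<ge> 1" and ij: "i < N" "j < N" "i \<noteq> j"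
  shows "AE \<omega> in PiM {..<N} (\<lambda>_. uniform_cube n A). \<omega> i \<noteq> \<omega> j"
proof -
  define U where "U = uniform_cube n A"
  interpret U: prob_space U unfolding U_def by (rule prob_space_uniform_cube[OF A])
  have sU: "sets U = sets (Leb n)" unfolding U_def by (rule sets_uniform_cube)
  have spU: "space U = Rn n" unfolding U_def by (rule space_uniform_cube)
  define S where "S = {w \<in> space (U \<Otimes>\<^sub>M U). vdist n (snd w) (fst w) = 0}"
  have [measurable]: "fst \<in> measurable (U \<Otimes>\<^sub>M U) (Leb n)" "snd \<in> measurable (U \<Otimes>\<^sub>M U) (Leb n)"
    using measurable_fst[of U U] measurable_snd[of U U] by (simp_all add: measurable_cong_sets[OF refl sU])
  have S [measurable]: "S \<in> sets (U \<Otimes>\<^sub>M U)" unfolding S_def by measurable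
  have v0: "vdist n x y = 0 \<longleftrightarrow> (\<forall>k<n. x k = y k)" for x y
    by (auto simp: vdist_def L2_set_eq_0_iff)
  have bS: "emeasure U {x \<in> space U. (y, x) \<in> S} \<le> 0" if y: "y \<in> space U" for y
  proof -
    have eq: "{x \<in> space U. (y, x) \<in> S} = (\<Pi>\<^sub>E k\<in>{..<n}. {y k})"
    proof -
      have "{x \<in> space U. (y, x) \<in> S} = {x \<in> Rn n. vdist n x y = 0}"
        using y unfolding S_def by (auto simp: space_pair_measure spU)
      also have "\<dots> = (\<Pi>\<^sub>E k\<in>{..<n}. {y k})"
        unfolding v0 by (rule set_eqI) (simp add: PiE_iff Ball_def conj_commute)
      finally show ?thesis .
    qed
    have s: "(\<Pi>\<^sub>E k\<in>{..<n}. {y k}) \<in> sets (Leb n)" by (intro sets_PiM_I_finite) auto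
    have "emeasure (Leb n) (\<Pi>\<^sub>E k\<in>{..<n}. {y k}) = 0"
      using n by (subst lebesgue_factors.emeasure_PiM) (auto simp: power_0_left)
    then have "emeasure U (\<Pi>\<^sub>E k\<in>{..<n}. {y k}) \<le> ennreal (0 / A ^ n)"
      unfolding U_def by (intro emeasure_uniform_cube_le A s) simp
    then show ?thesis unfolding eq by simp
  qed
  have "(\<integral>\<^sup>+\<omega>. (\<Prod>k\<in>{j}. indicator S (\<omega> i, \<omega> k)) \<partial>PiM {..<N} (\<lambda>_. U)) \<le> 0 ^ card {j}"
    by (rule iid_pairs_bound[OF U.prob_space_axioms _ _ _ S bS]) (use ij in auto)
  then have z: "(\<integral>\<^sup>+\<omega>. indicator S (\<omega> i, \<omega> j) \<partial>PiM {..<N} (\<lambda>_. U)) = 0" by simp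
  have [measurable]: "(\<lambda>\<omega>. \<omega> j) \<in> measurable (PiM {..<N} (\<lambda>_. U)) U"
        "(\<lambda>\<omega>. \<omega> i) \<in> measurable (PiM {..<N} (\<lambda>_. U)) U"
    using ij by (auto intro!: measurable_component_singleton)
  have "AE \<omega> in PiM {..<N} (\<lambda>_. U). indicator S (\<omega> i, \<omega> j) = (0::ennreal)"
    using z by (subst (asm) nn_integral_0_iff_AE) auto
  then have "AE \<omega> in PiM {..<N} (\<lambda>_. U). \<omega> i \<noteq> \<omega> j"
  proof (rule AE_mp, intro AE_I2 impI notI)
    fix \<omega> assume w: "\<omega> \<in> space (PiM {..<N} (\<lambda>_. U))" "indicator S (\<omega> i, \<omega> j) = (0::ennreal)" "\<omega> i = \<omega> j"
    then have "(\<omega> i, \<omega> j) \<in> S" using ij by (auto simp: S_def space_pair_measure v0 space_PiM PiE_iff)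
    then show False using w by simp
  qed
  then show ?thesis unfolding U_def .
qed

lemma AE_codewords_in_cube:
  fixes N :: nat
  assumes A: "A > 0" and i: "i < N"
  shows "AE \<omega> in PiM {..<N} (\<lambda>_. uniform_cube n A). \<omega> i \<in> cube n (\<lambda>_. 0) A"
proof (rule AE_PiM_component)
  show "prob_space (uniform_cube n A)" by (rule prob_space_uniform_cube[OF A])
  show "AE x in uniform_cube n A. x \<in> cube n (\<lambda>_. 0) A"
    unfolding uniform_cube_def by (rule AE_uniform_measureI) auto
qed (use i in auto)

lemma list_error_le_index_error:
  assumes \<sigma>: "\<sigma> > 0" and i: "i \<in> I" "I \<subseteq> {..<N}" and inj: "inj_on \<omega> {..<N}"
    and w: "\<omega> \<in> space (PiM {..<N} (\<lambda>_. uniform_cube n A))"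
  shows "ennreal (list_error_prob n \<sigma> L (\<omega> ` I) (\<omega> i)) \<le> (\<integral>\<^sup>+g. indicator {g. index_error n N L i \<omega> g} g \<partial>gaussian_noise n \<sigma>)"
proof -
  interpret prob_space "gaussian_noise n \<sigma>" by (rule prob_space_gaussian_noise[OF \<sigma>])
  have iN: "i < N" using i by auto
  define E where "E = {g \<in> space (gaussian_noise n \<sigma>). index_error n N L i \<omega> g}"
  have E: "E \<in> events"
  proof -
    have "Measurable.pred (gaussian_noise n \<sigma>) (\<lambda>g. (case (\<omega>, g) of (\<omega>, g) \<Rightarrow> index_error n N L i \<omega> g))"
      by (rule measurable_compose[OF measurable_Pair1'[OF w] pred_index_error[OF iN]])
    then show ?thesis unfolding E_def by simp
  qed
  have "list_error_prob n \<sigma> L (\<omega> ` I) (\<omega> i) \<le> prob E"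
    unfolding list_error_prob_def
  proof (rule finite_measure_mono[OF _ E], safe)
    fix g xs assume g: "g \<in> space (gaussian_noise n \<sigma>)" and xs: "length xs = L - 1" "distinct xs" "set xs \<subseteq> \<omega> ` I - {\<omega> i}"
      "\<forall>y\<in>set xs. vdist n y (vadd n (\<omega> i) g) < vnorm n g"
    define J where "J = {j\<in>I. \<omega> j \<in> set xs}"
    have im: "\<omega> ` J = set xs" using xs(3) by (auto simp: J_def)
    have "inj_on \<omega> J" by (rule inj_on_subset[OF inj]) (use i in \<open>auto simp: J_def\<close>)
    then have "card J = L - 1" using card_image[of \<omega> J] im distinct_card[OF xs(2)] xs(1) by simp
    moreover have "J \<subseteq> {..<N} - {i}" using i xs(3) by (auto simp: J_def)
    moreover have "\<forall>j\<in>J. vdist n (\<omega> j) (vadd n (\<omega> i) g) < vnorm n g" using xs(4) by (auto simp: J_def)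
    ultimately have "index_error n N L i \<omega> g" by (auto simp: index_error_def)
    then show "g \<in> E" using g by (simp add: E_def)
  qed
  then have "ennreal (list_error_prob n \<sigma> L (\<omega> ` I) (\<omega> i)) \<le> emeasure (gaussian_noise n \<sigma>) E"
    by (simp add: emeasure_eq_measure ennreal_leI)
  also have "\<dots> = (\<integral>\<^sup>+g. indicator E g \<partial>gaussian_noise n \<sigma>)" using E by simp
  also have "\<dots> = (\<integral>\<^sup>+g. indicator {g. index_error n N L i \<omega> g} g \<partial>gaussian_noise n \<sigma>)"
    by (rule nn_integral_cong) (simp add: E_def indicator_def)
  finally show ?thesis .
qed

text \<open>Random coding with expurgation: among \<open>2 * M\<close> random points at least \<open>M\<close> have at most twice
  the mean error probability, and discarding codewords only helps the others.\<close>

lemma good_finite_code: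
  fixes \<sigma> \<alpha> A :: real and n L M :: nat
  assumes \<sigma>: "\<sigma> > 0" and \<alpha>: "\<alpha> \<ge> 1" and L: "L \<ge> 2" and n: "n \<ge> 1" and A: "A > 0" and M: "M \<ge> 1"
    and dens: "real (2 * M) / A ^ n * sqrt (2 * pi * exp 1 * \<sigma>\<^sup>2 * \<alpha>\<^sup>2) ^ n \<le> 1"
  shows "\<exists>F. F \<subseteq> cube n (\<lambda>_. 0) A \<and> finite F \<and> card F = M \<and>
     (\<forall>x\<in>F. list_error_prob n \<sigma> L F x \<le> 2 * exp (- real n * Er L \<alpha>))"
proof -
  define N where "N = 2 * M"
  define \<phi> where "\<phi> = exp (- real n * Er L \<alpha>)"
  have \<phi>: "\<phi> > 0" by (simp add: \<phi>_def)
  define Om where "Om = PiM {..<N} (\<lambda>_. uniform_cube n A)"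
  have pOm: "prob_space Om" unfolding Om_def by (intro prob_space_PiM prob_space_uniform_cube A)
  interpret Om: prob_space Om by fact
  interpret G: prob_space "gaussian_noise n \<sigma>" by (rule prob_space_gaussian_noise[OF \<sigma>])
  interpret OG: pair_sigma_finite Om "gaussian_noise n \<sigma>"
    by (simp add: pair_sigma_finite_def Om.sigma_finite_measure_axioms G.sigma_finite_measure_axioms)
  define q where "q i \<omega> = (\<integral>\<^sup>+g. indicator {g. index_error n N L i \<omega> g} g \<partial>gaussian_noise n \<sigma>)" for i \<omega>
  define h where "h i = (\<lambda>(\<omega>, g). if index_error n N L i \<omega> g then 1 else 0 :: ennreal)" for i
  have h: "h i \<in> borel_measurable (Om \<Otimes>\<^sub>M gaussian_noise n \<sigma>)" if "i < N" for i
  proof -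
    have "Measurable.pred (Om \<Otimes>\<^sub>M gaussian_noise n \<sigma>) (\<lambda>w. index_error n N L i (fst w) (snd w))"
      using pred_index_error[OF that, where n=n and A=A and \<sigma>=\<sigma> and L=L] by (simp add: Om_def case_prod_beta')
    then show ?thesis unfolding h_def case_prod_beta'
      by (intro measurable_If measurable_const) (auto simp: pred_def)
  qed
  have q_eq: "q i \<omega> = (\<integral>\<^sup>+g. h i (\<omega>, g) \<partial>gaussian_noise n \<sigma>)" for i \<omega>
    unfolding q_def h_def by (intro nn_integral_cong) (simp add: indicator_def)
  have qm: "q i \<in> borel_measurable Om" if "i < N" for i
    using G.borel_measurable_nn_integral_fst[OF h[OF that]] by (subst measurable_cong[OF q_eq])
  have qint: "(\<integral>\<^sup>+\<omega>. q i \<omega> \<partial>Om) \<le> ennreal \<phi>" if i: "i < N" for i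
  proof -
    have "(\<integral>\<^sup>+\<omega>. q i \<omega> \<partial>Om) = (\<integral>\<^sup>+g. (\<integral>\<^sup>+\<omega>. h i (\<omega>, g) \<partial>Om) \<partial>gaussian_noise n \<sigma>)"
      unfolding q_eq by (rule OG.Fubini[OF h[OF i], symmetric])
    also have "\<dots> \<le> (\<integral>\<^sup>+g. min 1 (ennreal ((sqrt ((vnorm n g)\<^sup>2 / (n * \<sigma>\<^sup>2 * \<alpha>\<^sup>2)) ^ n) ^ (L - 1))) \<partial>gaussian_noise n \<sigma>)"
    proof (rule nn_integral_mono)
      fix g assume "g \<in> space (gaussian_noise n \<sigma>)"
      then have g: "g \<in> Rn n" by (simp add: space_gaussian_noise)
      have "(\<integral>\<^sup>+\<omega>. h i (\<omega>, g) \<partial>Om) = (\<integral>\<^sup>+\<omega>. indicator {\<omega>. index_error n N L i \<omega> g} \<omega> \<partial>Om)"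
        unfolding h_def by (intro nn_integral_cong) (simp add: indicator_def)
      also have "\<dots> \<le> min 1 (ennreal ((sqrt ((vnorm n g)\<^sup>2 / (n * \<sigma>\<^sup>2 * \<alpha>\<^sup>2)) ^ n) ^ (L - 1)))"
        unfolding Om_def by (rule index_error_given_noise[OF A n i g _ \<sigma> \<alpha>]) (use dens in \<open>simp add: N_def\<close>)
      finally show "(\<integral>\<^sup>+\<omega>. h i (\<omega>, g) \<partial>Om) \<le> min 1 (ennreal ((sqrt ((vnorm n g)\<^sup>2 / (n * \<sigma>\<^sup>2 * \<alpha>\<^sup>2)) ^ n) ^ (L - 1)))" .
    qed
    also have "\<dots> \<le> ennreal \<phi>" unfolding \<phi>_def by (rule gaussian_list_moment[OF \<sigma> \<alpha> L n])
    finally show ?thesis .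
  qed
  have "\<exists>\<omega>\<in>space Om. ((\<forall>i<N. \<forall>j<N. i \<noteq> j \<longrightarrow> \<omega> i \<noteq> \<omega> j) \<and> (\<forall>i<N. \<omega> i \<in> cube n (\<lambda>_. 0) A)) \<and> (\<Sum>i<N. q i \<omega>) \<le> ennreal (N * \<phi>)"
  proof (rule exists_le_mean[OF pOm])
    show "(\<lambda>\<omega>. \<Sum>i<N. q i \<omega>) \<in> borel_measurable Om" using qm by (intro borel_measurable_sum) auto
    have "(\<integral>\<^sup>+\<omega>. (\<Sum>i<N. q i \<omega>) \<partial>Om) = (\<Sum>i<N. \<integral>\<^sup>+\<omega>. q i \<omega> \<partial>Om)"
      by (rule nn_integral_sum) (use qm in auto)
    also have "\<dots> \<le> (\<Sum>i<N. ennreal \<phi>)" by (rule sum_mono) (use qint in auto)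
    also have "\<dots> = ennreal (N * \<phi>)" using \<phi> by (simp add: ennreal_mult ennreal_of_nat_eq_real_of_nat)
    finally show "(\<integral>\<^sup>+\<omega>. (\<Sum>i<N. q i \<omega>) \<partial>Om) \<le> ennreal (N * \<phi>)" .
    have "AE \<omega> in Om. \<forall>i\<in>{..<N}. \<forall>j\<in>{..<N}. i \<noteq> j \<longrightarrow> \<omega> i \<noteq> \<omega> j"
      unfolding Om_def by (intro AE_finite_allI finite_lessThan AE_impI AE_distinct_codewords A n) auto
    moreover have "AE \<omega> in Om. \<forall>i\<in>{..<N}. \<omega> i \<in> cube n (\<lambda>_. 0) A"
      unfolding Om_def by (intro AE_finite_allI finite_lessThan AE_codewords_in_cube A) auto
    ultimately show "AE \<omega> in Om. (\<forall>i<N. \<forall>j<N. i \<noteq> j \<longrightarrow> \<omega> i \<noteq> \<omega> j) \<and> (\<forall>i<N. \<omega> i \<in> cube n (\<lambda>_. 0) A)"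
      by eventually_elim auto
  qed simp
  then obtain \<omega> where w: "\<omega> \<in> space Om" "\<forall>i<N. \<forall>j<N. i \<noteq> j \<longrightarrow> \<omega> i \<noteq> \<omega> j" "\<forall>i<N. \<omega> i \<in> cube n (\<lambda>_. 0) A"
    "(\<Sum>i<N. q i \<omega>) \<le> ennreal (N * \<phi>)" by blast
  have inj: "inj_on \<omega> {..<N}" using w(2) by (auto simp: inj_on_def)
  define I where "I = {i\<in>{..<N}. q i \<omega> \<le> ennreal (2 * \<phi>)}"
  have "card I \<ge> M"
  proof (rule ccontr)
    assume "\<not> card I \<ge> M"
    then have "card ({..<N} - I) > M" by (subst card_Diff_subset) (auto simp: I_def N_def)
    then have "real N * \<phi> < real (card ({..<N} - I)) * (2 * \<phi>)" using \<phi> by (simp add: N_def)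
    then have "ennreal (N * \<phi>) < ennreal (real (card ({..<N} - I)) * (2 * \<phi>))" using \<phi> by (intro ennreal_lessI) auto
    also have "\<dots> = (\<Sum>i\<in>{..<N} - I. ennreal (2 * \<phi>))" using \<phi> by (simp add: ennreal_mult ennreal_of_nat_eq_real_of_nat)
    also have "\<dots> \<le> (\<Sum>i\<in>{..<N} - I. q i \<omega>)" by (rule sum_mono) (auto simp: I_def)
    also have "\<dots> \<le> (\<Sum>i<N. q i \<omega>)" by (rule sum_mono2) auto
    finally show False using w(4) by simp
  qed
  then obtain I' where I': "I' \<subseteq> I" "card I' = M" "finite I'" by (rule obtain_subset_with_card_n)
  have sub: "I' \<subseteq> {..<N}" using I' by (auto simp: I_def)
  have "list_error_prob n \<sigma> L (\<omega> ` I') (\<omega> i) \<le> 2 * \<phi>" if "i \<in> I'" for i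
  proof -
    have "ennreal (list_error_prob n \<sigma> L (\<omega> ` I') (\<omega> i)) \<le> q i \<omega>"
      unfolding q_def by (rule list_error_le_index_error[OF \<sigma> that sub inj w(1)[unfolded Om_def]])
    also have "\<dots> \<le> ennreal (2 * \<phi>)" using that I' by (auto simp: I_def)
    finally show ?thesis using \<phi> by simp
  qed
  moreover have "card (\<omega> ` I') = M" using I'(2) inj_on_subset[OF inj sub] by (simp add: card_image)
  moreover have "\<omega> ` I' \<subseteq> cube n (\<lambda>_. 0) A" using w(3) sub by auto
  ultimately show ?thesis using I'(3) by (intro exI[of _ "\<omega> ` I'"]) (auto simp: \<phi>_def)
qed

section \<open>List errors in periodic codes\<close>

text \<open>The code is infinite, but it has only countably many lists.\<close>

lemma list_error_event_sets:
  assumes C: "countable C" "C \<subseteq> Rn n" and x: "x \<in> Rn n"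
  shows "{g \<in> space (gaussian_noise n \<sigma>). \<exists>xs. length xs = k \<and> distinct xs \<and> set xs \<subseteq> C - {x} \<and>
     (\<forall>y\<in>set xs. vdist n y (vadd n x g) < vnorm n g)} \<in> sets (gaussian_noise n \<sigma>)"
proof -
  define XS where "XS = {xs \<in> lists C. length xs = k \<and> distinct xs \<and> set xs \<subseteq> C - {x}}"
  have c: "countable XS" unfolding XS_def
    by (rule countable_subset[OF _ countable_lists[OF C(1)]]) auto
  have eq: "{g \<in> space (gaussian_noise n \<sigma>). \<exists>xs. length xs = k \<and> distinct xs \<and> set xs \<subseteq> C - {x} \<and>
     (\<forall>y\<in>set xs. vdist n y (vadd n x g) < vnorm n g)}
   = (\<Union>xs\<in>XS. {g \<in> space (gaussian_noise n \<sigma>). \<forall>y\<in>set xs. vdist n y (vadd n x g) < vnorm n g})"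
    by (auto simp: XS_def lists_eq_set)
  have i: "(\<lambda>g. g) \<in> measurable (gaussian_noise n \<sigma>) (Leb n)"
    by (rule measurable_ident_sets) (rule sets_gaussian_noise)
  have one: "{g \<in> space (gaussian_noise n \<sigma>). \<forall>y\<in>set xs. vdist n y (vadd n x g) < vnorm n g} \<in> sets (gaussian_noise n \<sigma>)"
    if "xs \<in> XS" for xs
  proof -
    have "Measurable.pred (gaussian_noise n \<sigma>) (\<lambda>g. \<forall>y\<in>set xs. vdist n y (vadd n x g) < vnorm n g)"
    proof (rule pred_intros_finite)
      fix y assume "y \<in> set xs"
      then have y: "y \<in> Rn n" using that C(2) by (auto simp: XS_def)
      have "(\<lambda>g. vdist n y (vadd n x g)) \<in> borel_measurable (gaussian_noise n \<sigma>)"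
        by (intro measurable_vdist2 measurable_vadd2 measurable_const i) (use x y in \<open>auto simp: space_Leb\<close>)
      moreover have "(\<lambda>g. vnorm n g) \<in> borel_measurable (gaussian_noise n \<sigma>)"
        by (rule measurable_compose[OF i measurable_vnorm])
      ultimately show "Measurable.pred (gaussian_noise n \<sigma>) (\<lambda>g. vdist n y (vadd n x g) < vnorm n g)"
        by (rule borel_measurable_pred_less)
    qed simp
    then show ?thesis by (simp add: pred_def)
  qed
  show ?thesis unfolding eq by (rule sets.countable_UN'[OF c]) (use one in blast)
qed

text \<open>Any threshold would do in place of \<open>1\<close>; what matters is a positive value that does not depend on
  the dimension.\<close>

definition one_sided_tail :: "real \<Rightarrow> real" where
  "one_sided_tail \<sigma> = min (measure (density lborel (\<lambda>t. ennreal (normal_density 0 \<sigma> t))) {1<..})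
     (measure (density lborel (\<lambda>t. ennreal (normal_density 0 \<sigma> t))) {..<-1})"

lemma normal_open_pos:
  assumes \<sigma>: "\<sigma> > 0" and S: "S \<in> sets borel" and ab: "a < b" "{a<..<b} \<subseteq> S"
  shows "measure (density lborel (\<lambda>t. ennreal (normal_density 0 \<sigma> t))) S > 0"
proof -
  define N where "N = density lborel (\<lambda>t. ennreal (normal_density 0 \<sigma> t))"
  interpret prob_space N unfolding N_def by (rule prob_space_normal_density[OF \<sigma>])
  have "emeasure N S \<noteq> 0"
  proof
    assume "emeasure N S = 0"
    then have "AE t in lborel. t \<in> S \<longrightarrow> ennreal (normal_density 0 \<sigma> t) = 0"
      using S unfolding N_def by (subst (asm) emeasure_density) (auto simp: nn_integral_0_iff_AE indicator_def)
    then have "AE t in lborel. t \<notin> {a<..<b}"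
    proof eventually_elim
      case (elim t)
      have "ennreal (normal_density 0 \<sigma> t) \<noteq> 0"
        using normal_density_pos[OF \<sigma>, of 0 t] by (simp add: ennreal_eq_0_iff not_le)
      then show ?case using elim ab(2) by blast
    qed
    then have "emeasure lborel {a<..<b} = 0"
      by (subst (asm) AE_iff_measurable[where N="{a<..<b}"]) auto
    then show False using ab(1) by simp
  qed
  then show ?thesis unfolding N_def[symmetric] by (simp add: emeasure_eq_measure zero_less_measure_iff)
qed

lemma one_sided_tail_pos: "\<sigma> > 0 \<Longrightarrow> one_sided_tail \<sigma> > 0"
  unfolding one_sided_tail_def
proof -
  assume \<sigma>: "\<sigma> > 0"
  have "{1<..<2} \<subseteq> {1::real<..}" "{-2<..<-1} \<subseteq> {..<-1::real}" by (simp_all add: subset_eq)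
  then show "0 < min (measure (density lborel (\<lambda>t. ennreal (normal_density 0 \<sigma> t))) {1<..})
     (measure (density lborel (\<lambda>t. ennreal (normal_density 0 \<sigma> t))) {..<-1})"
    using normal_open_pos[OF \<sigma>, of "{1<..}" 1 2] normal_open_pos[OF \<sigma>, of "{..<-1}" "-2" "-1"] by simp
qed

lemma gaussian_first_coordinate:
  assumes \<sigma>: "\<sigma> > 0" and n: "n \<ge> 1" and S: "S \<in> sets borel"
  shows "{g \<in> space (gaussian_noise n \<sigma>). g 0 \<in> S} \<in> sets (gaussian_noise n \<sigma>)"
    "measure (gaussian_noise n \<sigma>) {g \<in> space (gaussian_noise n \<sigma>). g 0 \<in> S} = measure (density lborel (\<lambda>t. ennreal (normal_density 0 \<sigma> t))) S"
proof -
  define N where "N = density lborel (\<lambda>t. ennreal (normal_density 0 \<sigma> t))"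
  have pN: "prob_space N" unfolding N_def by (rule prob_space_normal_density[OF \<sigma>])
  interpret product_sigma_finite "\<lambda>i::nat. N"
    using prob_space_imp_sigma_finite[OF pN] by (simp add: product_sigma_finite_def)
  have eq: "{g \<in> space (gaussian_noise n \<sigma>). g 0 \<in> S} = (\<Pi>\<^sub>E i\<in>{..<n}. if i = 0 then S else UNIV)"
  proof (intro equalityI subsetI)
    fix g assume "g \<in> {g \<in> space (gaussian_noise n \<sigma>). g 0 \<in> S}"
    then have g: "g \<in> Rn n" "g 0 \<in> S" by (simp_all add: space_gaussian_noise)
    show "g \<in> (\<Pi>\<^sub>E i\<in>{..<n}. if i = 0 then S else UNIV)"
    proof (rule PiE_I)
      show "g i \<in> (if i = 0 then S else UNIV)" for i using g(2) by simp
      show "g i = undefined" if "i \<notin> {..<n}" for i using PiE_arb[OF g(1) that] .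
    qed
  next
    fix g assume g: "g \<in> (\<Pi>\<^sub>E i\<in>{..<n}. if i = 0 then S else UNIV)"
    have "g \<in> Rn n" by (rule PiE_I) (use PiE_arb[OF g] in simp_all)
    moreover have "g 0 \<in> S" using PiE_mem[OF g, of 0] n by simp
    ultimately show "g \<in> {g \<in> space (gaussian_noise n \<sigma>). g 0 \<in> S}" by (simp add: space_gaussian_noise)
  qed
  have s: "(if i = 0 then S else UNIV) \<in> sets N" for i :: nat using S by (auto simp: N_def)
  have G: "gaussian_noise n \<sigma> = PiM {..<n} (\<lambda>_. N)" by (simp add: gaussian_noise_def N_def)
  show "{g \<in> space (gaussian_noise n \<sigma>). g 0 \<in> S} \<in> sets (gaussian_noise n \<sigma>)"
    unfolding eq unfolding G by (rule sets_PiM_I_finite) (use s in auto)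
  have "emeasure (gaussian_noise n \<sigma>) {g \<in> space (gaussian_noise n \<sigma>). g 0 \<in> S} = (\<Prod>i<n. emeasure N (if i = 0 then S else UNIV))"
    unfolding eq unfolding G by (rule emeasure_PiM) (use s in auto)
  also have "\<dots> = (\<Prod>i<n. if i = 0 then emeasure N S else 1)"
    using prob_space.emeasure_space_1[OF pN] by (intro prod.cong) (auto simp: N_def)
  also have "\<dots> = emeasure N S" using n by (subst prod.delta) auto
  finally show "measure (gaussian_noise n \<sigma>) {g \<in> space (gaussian_noise n \<sigma>). g 0 \<in> S} = measure (density lborel (\<lambda>t. ennreal (normal_density 0 \<sigma> t))) S"
    by (simp add: measure_def N_def)
qed

text \<open>The multiple \<open>t\<close> of the first unit vector.\<close>

definition along :: "nat \<Rightarrow> real \<Rightarrow> nat \<Rightarrow> real" where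
  "along n t = (\<lambda>i\<in>{..<n}. if i = 0 then t else 0)"

lemma along_in_Rn [simp]: "along n t \<in> Rn n" by (auto simp: along_def)

lemma vdist_along:
  assumes n: "n \<ge> 1" and t: "t \<noteq> 0" "\<bar>t\<bar> \<le> 2" and g: "sgn t * g 0 > 1"
  shows "vdist n (vadd n x (along n t)) (vadd n x g) < vnorm n g"
proof -
  have "(\<Sum>i<n. (along n t i - g i)\<^sup>2) < (\<Sum>i<n. (g i)\<^sup>2)"
  proof (rule sum_strict_mono_ex1)
    have "t * t < 2 * t * g 0"
    proof (cases "t > 0")
      case True then have "t < 2 * g 0" using t g by simp
      then show ?thesis using True by simp
    next
      case False then have "t < 0" using t by simp
      then have "t > 2 * g 0" using t g by simp
      then have "t * t < t * (2 * g 0)" using \<open>t < 0\<close> by (simp only: mult_less_cancel_left_neg)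
      then show ?thesis by simp
    qed
    then have *: "(t - g 0)\<^sup>2 < (g 0)\<^sup>2" by (simp add: power2_eq_square algebra_simps)
    show "\<exists>a\<in>{..<n}. (along n t a - g a)\<^sup>2 < (g a)\<^sup>2" using * n by (intro bexI[of _ 0]) (auto simp: along_def)
    show "\<forall>i\<in>{..<n}. (along n t i - g i)\<^sup>2 \<le> (g i)\<^sup>2" using * by (auto simp: along_def)
  qed simp
  moreover have "(\<Sum>i<n. (vadd n x (along n t) i - vadd n x g i)\<^sup>2) = (\<Sum>i<n. (along n t i - g i)\<^sup>2)"
    by (rule sum.cong) (auto simp: vadd_def)
  ultimately show ?thesis by (simp add: vdist_def vnorm_def L2_set_def)
qed

text \<open>A codeword with \<open>L - 1\<close> other codewords very close to it on a half-line is list-decoded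
  wrongly as soon as the noise has a moderate component in that direction.\<close>

lemma clustered_list_error:
  assumes \<sigma>: "\<sigma> > 0" and n: "n \<ge> 1" and C: "countable C" "C \<subseteq> Rn n" and x: "x \<in> Rn n"
    and e: "e \<noteq> 0" "real (L - 1) * \<bar>e\<bar> \<le> 2"
    and near: "\<And>k. 1 \<le> k \<Longrightarrow> k \<le> L - 1 \<Longrightarrow> vadd n x (along n (real k * e)) \<in> C"
  shows "list_error_prob n \<sigma> L C x \<ge> one_sided_tail \<sigma>"
proof -
  interpret prob_space "gaussian_noise n \<sigma>" by (rule prob_space_gaussian_noise[OF \<sigma>])
  define S where "S = (if e > 0 then {1<..} else {..<-1::real})"
  have S: "S \<in> sets borel" by (simp add: S_def)
  define f where "f k = vadd n x (along n (real k * e))" for k :: nat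
  have f0: "f k 0 = x 0 + real k * e" for k using n by (simp add: f_def vadd_def along_def)
  have inj: "inj_on f {1..L-1}" by (rule inj_onI) (metis f0 e(1) add_left_cancel mult_right_cancel of_nat_eq_iff)
  have "one_sided_tail \<sigma> \<le> measure (density lborel (\<lambda>t. ennreal (normal_density 0 \<sigma> t))) S"
    by (auto simp: one_sided_tail_def S_def)
  also have "\<dots> = prob {g \<in> space (gaussian_noise n \<sigma>). g 0 \<in> S}"
    by (rule gaussian_first_coordinate(2)[OF \<sigma> n S, symmetric])
  also have "\<dots> \<le> list_error_prob n \<sigma> L C x"
    unfolding list_error_prob_def
  proof (rule finite_measure_mono[OF _ list_error_event_sets[OF C x]], safe)
    fix g :: "nat \<Rightarrow> real" assume g: "g 0 \<in> S"
    define xs where "xs = map f [1..<L]"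
    have set: "set xs = f ` {1..L-1}" by (auto simp: xs_def)
    have "distinct xs" unfolding xs_def distinct_map using inj
      by (auto simp: inj_on_def)
    moreover have "length xs = L - 1" by (simp add: xs_def)
    moreover have "set xs \<subseteq> C - {x}"
    proof -
      have "f k \<noteq> x" if "k \<ge> 1" for k using f0[of k] e(1) that by (metis add_cancel_left_right mult_eq_0_iff of_nat_eq_0_iff not_one_le_zero)
      then show ?thesis unfolding set using near by (auto simp: f_def)
    qed
    moreover have "vdist n y (vadd n x g) < vnorm n g" if y: "y \<in> set xs" for y
    proof -
      obtain k where k: "1 \<le> k" "k \<le> L - 1" "y = f k" using y unfolding set by auto
      have "\<bar>real k * e\<bar> = real k * \<bar>e\<bar>" by (simp add: abs_mult)
      also have "\<dots> \<le> real (L - 1) * \<bar>e\<bar>" using k by (intro mult_right_mono) auto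
      finally have "\<bar>real k * e\<bar> \<le> 2" using e by linarith
      moreover have "sgn (real k * e) * g 0 > 1"
        using g k(1) e(1) by (auto simp: S_def sgn_mult split: if_splits)
      ultimately show ?thesis unfolding k(3) f_def using k(1) e(1) by (intro vdist_along n) auto
    qed
    ultimately show "\<exists>xs. length xs = L - 1 \<and> distinct xs \<and> set xs \<subseteq> C - {x} \<and> (\<forall>y\<in>set xs. vdist n y (vadd n x g) < vnorm n g)"
      by blast
  qed
  finally show ?thesis .
qed

subsection \<open>Periodic codes\<close>

definition zmod :: "nat \<Rightarrow> nat \<Rightarrow> (nat \<Rightarrow> int) \<Rightarrow> nat \<Rightarrow> int" where
  "zmod n k z = (\<lambda>i\<in>{..<n}. z i mod int k)"

definition residues_box :: "nat \<Rightarrow> nat \<Rightarrow> (nat \<Rightarrow> int) set" where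
  "residues_box n k = (\<Pi>\<^sub>E i\<in>{..<n}. {0..<int k})"

text \<open>Space is divided into cells indexed by the integer vectors, and the finite set of codewords put
  into a cell depends on the index of the cell modulo \<open>k\<close>.  In this way finitely many residue classes
  of cells can be altered independently while the code remains periodic.\<close>

definition pcode :: "nat \<Rightarrow> real \<Rightarrow> nat \<Rightarrow> (nat \<Rightarrow> real) \<Rightarrow> ((nat \<Rightarrow> int) \<Rightarrow> (nat \<Rightarrow> real) set) \<Rightarrow> (nat \<Rightarrow> real) set" where
  "pcode n T k u G = {lat n T (vadd n p u) z | z p. z \<in> Zn n \<and> p \<in> G (zmod n k z)}"

lemma finite_residues_box: "finite (residues_box n k)"
  unfolding residues_box_def by (intro finite_PiE) auto

lemma card_residues_box: "card (residues_box n k) = k ^ n"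
  unfolding residues_box_def by (subst card_PiE) auto

lemma zmod_in_box: "k \<ge> 1 \<Longrightarrow> zmod n k z \<in> residues_box n k"
  by (auto simp: zmod_def residues_box_def)

lemma mem_pcode: "x \<in> pcode n T k u G \<longleftrightarrow> (\<exists>z p. z \<in> Zn n \<and> p \<in> G (zmod n k z) \<and> x = lat n T (vadd n p u) z)"
  by (auto simp: pcode_def)

lemma pcode_sub_Rn: "pcode n T k u G \<subseteq> Rn n"
  unfolding pcode_def using lat_in_Rn by blast

lemma vadd_nth [simp]: "i < n \<Longrightarrow> vadd n x y i = x i + y i" by (simp add: vadd_def)

lemma different_cells_far:
  assumes T: "T = A + 2 * \<rho>" and A: "A > 0" "\<rho> > 0" and p: "p \<in> cube n (\<lambda>_. 0) A" "q \<in> cube n (\<lambda>_. 0) A"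
    and z: "z \<in> Zn n" "w \<in> Zn n" "z \<noteq> w"
  shows "vdist n (lat n T (vadd n p u) z) (lat n T (vadd n q u) w) > 2 * \<rho>"
proof -
  obtain i where i: "i < n" "z i \<noteq> w i" using Zn_eqI[OF z(1,2)] z(3) by blast
  have pq: "0 \<le> p i" "p i < A" "0 \<le> q i" "q i < A" using p i by (auto simp: mem_cube)
  have "\<bar>(p i - q i) + T * (of_int (z i) - of_int (w i))\<bar> > 2 * \<rho>"
  proof (cases "z i < w i")
    case True
    then have "of_int (z i) - of_int (w i) \<le> (-1 :: real)" by linarith
    then have "T * (of_int (z i) - of_int (w i)) \<le> T * (-1)" using T A by (intro mult_left_mono) auto
    then show ?thesis using pq T by linarith
  next
    case False
    then have "of_int (z i) - of_int (w i) \<ge> (1 :: real)" using i(2) by linarith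
    then have "T * (of_int (z i) - of_int (w i)) \<ge> T * 1" using T A by (intro mult_left_mono) auto
    then show ?thesis using pq T by linarith
  qed
  also have "(p i - q i) + T * (of_int (z i) - of_int (w i)) = lat n T (vadd n p u) z i - lat n T (vadd n q u) w i"
    using i by (simp add: algebra_simps)
  also have "\<bar>\<dots>\<bar> \<le> vdist n (lat n T (vadd n p u) z) (lat n T (vadd n q u) w)"
  proof -
    define d where "d j = lat n T (vadd n p u) z j - lat n T (vadd n q u) w j" for j
    have "(d i)\<^sup>2 \<le> (\<Sum>j<n. (d j)\<^sup>2)" by (rule member_le_sum) (use i in auto)
    then have "sqrt ((d i)\<^sup>2) \<le> sqrt (\<Sum>j<n. (d j)\<^sup>2)" by (rule real_sqrt_le_mono)
    then show ?thesis by (simp add: vdist_def L2_set_def d_def)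
  qed
  finally show ?thesis .
qed

lemma vdist_self [simp]: "vdist n x x = 0" by (simp add: vdist_def L2_set_def)

lemma pcode_point_unique:
  assumes T: "T = A + 2 * \<rho>" and A: "A > 0" "\<rho> > 0" and p: "p \<in> cube n (\<lambda>_. 0) A" "q \<in> cube n (\<lambda>_. 0) A"
    and z: "z \<in> Zn n" "w \<in> Zn n" and eq: "lat n T (vadd n p u) z = lat n T (vadd n q u) w"
  shows "z = w" "p = q"
proof -
  show zw: "z = w"
    using different_cells_far[OF T A p z, of u] A unfolding eq by force
  show "p = q"
  proof (rule Rn_eqI)
    show "p \<in> Rn n" "q \<in> Rn n" using p by (auto simp: mem_cube)
    fix i assume "i < n"
    then show "p i = q i" using fun_cong[OF eq, of i] zw by simp
  qed
qed

text \<open>Noise shorter than half the gap between cells only confuses codewords of the same cell.\<close>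

lemma list_error_pcode_le:
  assumes \<sigma>: "\<sigma> > 0" and T: "T = A + 2 * \<rho>" and A: "A > 0" "\<rho> > 0"
    and G: "\<And>r. G r \<subseteq> cube n (\<lambda>_. 0) A" and F: "countable (G (zmod n k z))"
    and z: "z \<in> Zn n" and p: "p \<in> G (zmod n k z)"
  shows "list_error_prob n \<sigma> L (pcode n T k u G) (lat n T (vadd n p u) z)
     \<le> list_error_prob n \<sigma> L (G (zmod n k z)) p + measure (gaussian_noise n \<sigma>) {g \<in> space (gaussian_noise n \<sigma>). vnorm n g \<ge> \<rho>}"
proof -
  interpret prob_space "gaussian_noise n \<sigma>" by (rule prob_space_gaussian_noise[OF \<sigma>])
  define F0 where "F0 = G (zmod n k z)"
  define x where "x = lat n T (vadd n p u) z"
  have F0: "F0 \<subseteq> Rn n" using G by (force simp: F0_def mem_cube)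
  have pc: "p \<in> cube n (\<lambda>_. 0) A" using G p by blast
  define E1 where "E1 = {g \<in> space (gaussian_noise n \<sigma>). \<exists>xs. length xs = L - 1 \<and> distinct xs \<and> set xs \<subseteq> F0 - {p} \<and>
     (\<forall>y\<in>set xs. vdist n y (vadd n p g) < vnorm n g)}"
  define E2 where "E2 = {g \<in> space (gaussian_noise n \<sigma>). vnorm n g \<ge> \<rho>}"
  have E1: "E1 \<in> events" unfolding E1_def
    by (rule list_error_event_sets) (use F F0 p in \<open>auto simp: F0_def\<close>)
  have i: "(\<lambda>g. g) \<in> measurable (gaussian_noise n \<sigma>) (Leb n)"
    by (rule measurable_ident_sets) (rule sets_gaussian_noise)
  have [measurable]: "(\<lambda>g. vnorm n g) \<in> borel_measurable (gaussian_noise n \<sigma>)"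
    by (rule measurable_compose[OF i measurable_vnorm])
  have E2: "E2 \<in> events" unfolding E2_def by measurable
  have "list_error_prob n \<sigma> L (pcode n T k u G) x \<le> prob (E1 \<union> E2)"
    unfolding list_error_prob_def
  proof (rule finite_measure_mono)
    show "E1 \<union> E2 \<in> events" using E1 E2 by blast
    show "{g \<in> space (gaussian_noise n \<sigma>). \<exists>xs. length xs = L - 1 \<and> distinct xs \<and> set xs \<subseteq> pcode n T k u G - {x} \<and>
     (\<forall>y\<in>set xs. vdist n y (vadd n x g) < vnorm n g)} \<subseteq> E1 \<union> E2"
    proof (intro subsetI)
      fix g assume "g \<in> {g \<in> space (gaussian_noise n \<sigma>). \<exists>xs. length xs = L - 1 \<and> distinct xs \<and> set xs \<subseteq> pcode n T k u G - {x} \<and>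
        (\<forall>y\<in>set xs. vdist n y (vadd n x g) < vnorm n g)}"
      then obtain xs where g: "g \<in> space (gaussian_noise n \<sigma>)" and xs: "length xs = L - 1" "distinct xs" "set xs \<subseteq> pcode n T k u G - {x}"
        "\<forall>y\<in>set xs. vdist n y (vadd n x g) < vnorm n g" by blast
      show "g \<in> E1 \<union> E2"
      proof (cases "vnorm n g \<ge> \<rho>")
        case True then show ?thesis using g by (auto simp: E2_def)
      next
        case False
        have "\<exists>q\<in>F0. y = lat n T (vadd n q u) z" if y: "y \<in> set xs" for y
        proof -
          obtain w q where wq: "w \<in> Zn n" "q \<in> G (zmod n k w)" "y = lat n T (vadd n q u) w"
          proof -
            have "y \<in> pcode n T k u G" using xs(3) y by blast
            then show ?thesis using that unfolding mem_pcode by blast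
          qed
          have "vdist n y x \<le> vdist n y (vadd n x g) + vnorm n g"
          proof -
            have "vdist n y x = L2_set (\<lambda>i. (y i - vadd n x g i) + g i) {..<n}"
              unfolding vdist_def by (rule L2_set_cong) auto
            also have "\<dots> \<le> vdist n y (vadd n x g) + vnorm n g"
              unfolding vdist_def vnorm_def by (rule L2_set_triangle_ineq)
            finally show ?thesis .
          qed
          also have "\<dots> < 2 * \<rho>" using xs(4) y False by fastforce
          finally have "w = z"
            using different_cells_far[OF T A _ pc wq(1) z, of q u] G wq(2,3) unfolding x_def by force
          then show ?thesis using wq by (auto simp: F0_def)
        qed
        then obtain f where f: "\<And>y. y \<in> set xs \<Longrightarrow> f y \<in> F0 \<and> y = lat n T (vadd n (f y) u) z" by metis
        define ys where "ys = map f xs"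
        have "inj_on f (set xs)" by (rule inj_onI) (metis f)
        then have "distinct ys" unfolding ys_def distinct_map using xs(2) by simp
        moreover have "length ys = L - 1" using xs(1) by (simp add: ys_def)
        moreover have "set ys \<subseteq> F0 - {p}" using f xs(3) by (force simp: ys_def x_def)
        moreover have "\<forall>q\<in>set ys. vdist n q (vadd n p g) < vnorm n g"
        proof
          fix q assume "q \<in> set ys"
          then obtain y where y: "y \<in> set xs" "q = f y" by (auto simp: ys_def)
          have yi: "y i = q i + u i + T * of_int (z i)" if "i < n" for i
            using f[OF y(1)] that unfolding y(2) by (metis lat_nth vadd_nth)
          have "vdist n q (vadd n p g) = vdist n y (vadd n x g)"
            unfolding vdist_def by (rule L2_set_cong) (auto simp: yi x_def)
          then show "vdist n q (vadd n p g) < vnorm n g" using xs(4) y by simp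
        qed
        ultimately have "g \<in> E1" using g unfolding E1_def by blast
        then show ?thesis by blast
      qed
    qed
  qed
  also have "\<dots> \<le> prob E1 + prob E2" by (rule measure_Un_le[OF E1 E2])
  finally show ?thesis by (simp add: list_error_prob_def E1_def E2_def F0_def x_def)
qed

lemma finite_pcode_bounded:
  assumes T: "T > 0" and k: "k \<ge> 1" and G: "\<And>r. finite (G r)"
  shows "finite {x \<in> pcode n T k u G. \<forall>i<n. \<bar>x i\<bar> \<le> b}"
proof -
  let ?I = "\<lambda>p i. {\<lfloor>(- b - p i - u i) / T\<rfloor>..\<lceil>(b - p i - u i) / T\<rceil>}"
  define P where "P = (\<Union>r\<in>residues_box n k. G r)"
  have P: "finite P" unfolding P_def using finite_residues_box G by blast
  have "{x \<in> pcode n T k u G. \<forall>i<n. \<bar>x i\<bar> \<le> b} \<subseteq>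
    (\<Union>p\<in>P. lat n T (vadd n p u) ` (\<Pi>\<^sub>E i\<in>{..<n}. ?I p i))"
  proof
    fix x assume "x \<in> {x \<in> pcode n T k u G. \<forall>i<n. \<bar>x i\<bar> \<le> b}"
    then obtain z p where zp: "z \<in> Zn n" "p \<in> G (zmod n k z)" "x = lat n T (vadd n p u) z" and b: "\<forall>i<n. \<bar>x i\<bar> \<le> b"
      by (auto simp: mem_pcode)
    have "p \<in> P" using zp(2) zmod_in_box[OF k] by (auto simp: P_def)
    moreover have "z i \<in> ?I p i" if "i < n" for i
    proof -
      have "\<bar>p i + u i + T * of_int (z i)\<bar> \<le> b" using b that by (simp add: zp(3))
      then have "(- b - p i - u i) / T \<le> of_int (z i)" "of_int (z i) \<le> (b - p i - u i) / T"
        using T by (auto simp: field_simps abs_le_iff)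
      then show ?thesis by (simp add: floor_le_iff le_ceiling_iff)
    qed
    then have "z \<in> (\<Pi>\<^sub>E i\<in>{..<n}. ?I p i)" using zp(1) by (auto simp: PiE_iff)
    ultimately show "x \<in> (\<Union>p\<in>P. lat n T (vadd n p u) ` (\<Pi>\<^sub>E i\<in>{..<n}. ?I p i))"
      using zp(3) by blast
  qed
  then show ?thesis by (rule finite_subset) (intro finite_UN_I P finite_imageI finite_PiE; simp)
qed

lemma zmod_decomp:
  assumes k: "k \<ge> 1"
  shows "z \<in> Zn n \<Longrightarrow> (\<lambda>i\<in>{..<n}. zmod n k z i + int k * (z i div int k)) = z"
    "r \<in> residues_box n k \<Longrightarrow> zmod n k (\<lambda>i\<in>{..<n}. r i + int k * w i) = r"
proof -
  show "(\<lambda>i\<in>{..<n}. zmod n k z i + int k * (z i div int k)) = z" if "z \<in> Zn n"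
    by (rule Zn_eqI[OF _ that]) (auto simp: zmod_def)
  show "zmod n k (\<lambda>i\<in>{..<n}. r i + int k * w i) = r" if r: "r \<in> residues_box n k"
  proof (rule Zn_eqI)
    show "r \<in> Zn n" using r by (auto simp: residues_box_def)
    show "zmod n k (\<lambda>i\<in>{..<n}. r i + int k * w i) \<in> Zn n" by (auto simp: zmod_def)
    fix i assume "i < n"
    moreover from this have "0 \<le> r i" "r i < int k" using r by (auto simp: residues_box_def PiE_iff)
    ultimately show "zmod n k (\<lambda>i\<in>{..<n}. r i + int k * w i) i = r i" by (simp add: zmod_def)
  qed
qed

lemma lat_super:
  "lat n T (vadd n p u) (\<lambda>i\<in>{..<n}. r i + int k * w i) = lat n (real k * T) (vadd n (lat n T p r) u) w"
  by (auto simp: lat_def vadd_def fun_eq_iff algebra_simps)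

text \<open>A code whose cells of side \<open>T\<close> repeat modulo \<open>k\<close> is a disjoint union of lattices of period \<open>k T\<close>.\<close>

lemma card_pcode_inter:
  assumes T: "T = A + 2 * \<rho>" and A: "A > 0" "\<rho> > 0" and k: "k \<ge> 1"
    and G: "\<And>r. G r \<subseteq> cube n (\<lambda>_. 0) A" "\<And>r. finite (G r)"
    and fin: "\<And>v. finite (hits n (real k * T) v X)"
  shows "card (pcode n T k u G \<inter> X) = (\<Sum>r\<in>residues_box n k. \<Sum>p\<in>G r. card (hits n (real k * T) (vadd n (lat n T p r) u) X))"
proof -
  let ?h = "\<lambda>rp. hits n (real k * T) (vadd n (lat n T (snd rp) (fst rp)) u) X"
  define f where "f r p w = lat n T (vadd n p u) (\<lambda>i\<in>{..<n}. r i + int k * w i)" for r p w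
  have fl: "f r p w = lat n (real k * T) (vadd n (lat n T p r) u) w" for r p w
    unfolding f_def by (rule lat_super)
  have Z: "(\<lambda>i\<in>{..<n}. r i + int k * w i) \<in> Zn n" for r w by auto
  have uniq: "r = r' \<and> p = p' \<and> w = w'"
    if "r \<in> residues_box n k" "r' \<in> residues_box n k" "p \<in> G r" "p' \<in> G r'" "w \<in> Zn n" "w' \<in> Zn n" "f r p w = f r' p' w'" for r r' p p' w w'
  proof -
    have pp: "p \<in> cube n (\<lambda>_. 0) A" "p' \<in> cube n (\<lambda>_. 0) A" using G that by blast+
    have eq: "(\<lambda>i\<in>{..<n}. r i + int k * w i) = (\<lambda>i\<in>{..<n}. r' i + int k * w' i)" and p: "p = p'"
      using pcode_point_unique[OF T A pp Z Z that(7)[unfolded f_def]] by blast+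
    have r: "r = r'" using zmod_decomp(2)[OF k that(1), of w] zmod_decomp(2)[OF k that(2), of w'] eq by simp
    have "w = w'"
    proof (rule Zn_eqI[OF that(5,6)])
      fix i assume "i < n"
      then show "w i = w' i" using fun_cong[OF eq, of i] r k by simp
    qed
    then show ?thesis using r p by blast
  qed
  have eq: "pcode n T k u G \<inter> X = (\<Union>rp\<in>(SIGMA r:residues_box n k. G r). f (fst rp) (snd rp) ` ?h rp)"
  proof (intro equalityI subsetI)
    fix x assume "x \<in> pcode n T k u G \<inter> X"
    then obtain z p where zp: "z \<in> Zn n" "p \<in> G (zmod n k z)" "x = lat n T (vadd n p u) z" "x \<in> X" by (auto simp: mem_pcode)
    define w where "w = (\<lambda>i\<in>{..<n}. z i div int k)"
    have "(\<lambda>i\<in>{..<n}. zmod n k z i + int k * w i) = z"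
      using zmod_decomp(1)[OF k zp(1)] by (simp add: w_def cong: restrict_cong)
    then have x: "x = f (zmod n k z) p w" unfolding f_def using zp(3) by simp
    moreover have "w \<in> hits n (real k * T) (vadd n (lat n T p (zmod n k z)) u) X"
      unfolding hits_def using zp(4) x fl by (auto simp: w_def)
    ultimately show "x \<in> (\<Union>rp\<in>(SIGMA r:residues_box n k. G r). f (fst rp) (snd rp) ` ?h rp)"
      using zp(2) zmod_in_box[OF k] by (intro UN_I[of "(zmod n k z, p)"]) auto
  next
    fix x assume "x \<in> (\<Union>rp\<in>(SIGMA r:residues_box n k. G r). f (fst rp) (snd rp) ` ?h rp)"
    then obtain r p w where rpw: "r \<in> residues_box n k" "p \<in> G r" "w \<in> hits n (real k * T) (vadd n (lat n T p r) u) X" "x = f r p w" by auto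
    have "x \<in> X" using rpw(3,4) fl by (simp add: hits_def)
    moreover have "x \<in> pcode n T k u G"
      unfolding mem_pcode using rpw(2,4) zmod_decomp(2)[OF k rpw(1), of w] Z[of r w] unfolding f_def by metis
    ultimately show "x \<in> pcode n T k u G \<inter> X" by blast
  qed
  have "card (pcode n T k u G \<inter> X) = (\<Sum>rp\<in>(SIGMA r:residues_box n k. G r). card (f (fst rp) (snd rp) ` ?h rp))"
    unfolding eq
  proof (rule card_UN_disjoint)
    show "finite (SIGMA r:residues_box n k. G r)" using finite_residues_box G(2) by blast
    show "\<forall>rp\<in>(SIGMA r:residues_box n k. G r). finite (f (fst rp) (snd rp) ` ?h rp)"
      using fin by blast
    show "\<forall>rp\<in>(SIGMA r:residues_box n k. G r). \<forall>rp'\<in>(SIGMA r:residues_box n k. G r). rp \<noteq> rp' \<longrightarrow>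
      f (fst rp) (snd rp) ` ?h rp \<inter> f (fst rp') (snd rp') ` ?h rp' = {}"
    proof (intro ballI impI)
      fix rp rp' assume rp: "rp \<in> (SIGMA r:residues_box n k. G r)" "rp' \<in> (SIGMA r:residues_box n k. G r)" "rp \<noteq> rp'"
      show "f (fst rp) (snd rp) ` ?h rp \<inter> f (fst rp') (snd rp') ` ?h rp' = {}"
      proof (rule ccontr)
        assume "\<not> ?thesis"
        then obtain w w' where w: "w \<in> Zn n" "w' \<in> Zn n" "f (fst rp) (snd rp) w = f (fst rp') (snd rp') w'" by (auto simp: hits_def)
        have "fst rp = fst rp' \<and> snd rp = snd rp' \<and> w = w'"
          by (rule uniq[OF _ _ _ _ w]) (use rp in auto)
        then show False using rp(3) by (simp add: prod_eq_iff)
      qed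
    qed
  qed
  also have "\<dots> = (\<Sum>rp\<in>(SIGMA r:residues_box n k. G r). card (?h rp))"
  proof (rule sum.cong[OF refl], rule card_image, rule inj_onI)
    fix rp w w' assume "rp \<in> (SIGMA r:residues_box n k. G r)" "w \<in> ?h rp"
      "w' \<in> ?h rp" "f (fst rp) (snd rp) w = f (fst rp) (snd rp) w'"
    then have h: "fst rp \<in> residues_box n k" "snd rp \<in> G (fst rp)" "w \<in> Zn n" "w' \<in> Zn n" "f (fst rp) (snd rp) w = f (fst rp) (snd rp) w'"
      unfolding hits_def mem_Collect_eq mem_Times_iff by (cases rp; simp)+
    show "w = w'" using uniq[OF h(1) h(1) h(2) h(2) h(3-5)] by simp
  qed
  also have "\<dots> = (\<Sum>r\<in>residues_box n k. \<Sum>p\<in>G r. card (hits n (real k * T) (vadd n (lat n T p r) u) X))"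
    by (subst sum.Sigma[OF finite_residues_box]) (use G(2) in \<open>simp_all add: case_prod_beta'\<close>)
  finally show ?thesis .
qed

section \<open>The code in a fixed dimension\<close>

text \<open>Large cells hold many codewords, and the gaps between them waste at most half of the volume.\<close>

lemma cell_side_exists:
  fixes \<delta> \<rho> c :: real
  assumes n: "n \<ge> 1" and d: "\<delta> > 0"
  shows "\<exists>A>0. \<delta> * A ^ n / 2 \<ge> c \<and> ((A + 2 * \<rho>) / A) ^ n \<le> 2"
proof -
  have "filterlim (\<lambda>A::real. (\<delta> / 2) * A ^ n) at_top at_top"
    by (intro filterlim_tendsto_pos_mult_at_top[OF tendsto_const] filterlim_pow_at_top filterlim_ident) (use n d in auto)
  then have 1: "\<forall>\<^sub>F A in at_top. (\<delta> / 2) * A ^ n \<ge> c" by (simp add: filterlim_at_top)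
  have "((\<lambda>A::real. (1 + 2 * \<rho> / A) ^ n) \<longlongrightarrow> (1 + 0) ^ n) at_top"
    by (intro tendsto_intros tendsto_divide_0[OF tendsto_const] filterlim_at_top_imp_at_infinity filterlim_ident)
  then have "\<forall>\<^sub>F A::real in at_top. (1 + 2 * \<rho> / A) ^ n < 2" by (rule order_tendstoD) simp
  then have "\<forall>\<^sub>F A::real in at_top. (\<delta> / 2) * A ^ n \<ge> c \<and> (1 + 2 * \<rho> / A) ^ n < 2 \<and> A > 0"
    using 1 eventually_gt_at_top[of 0] by eventually_elim auto
  then obtain A where A: "(\<delta> / 2) * A ^ n \<ge> c" "(1 + 2 * \<rho> / A) ^ n < 2" "A > 0"
    using eventually_happens'[OF trivial_limit_at_top_linorder] by blast
  then have "(A + 2 * \<rho>) / A = 1 + 2 * \<rho> / A" by (simp add: field_simps)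
  then show ?thesis using A by (intro exI[of _ A]) auto
qed

text \<open>Equally spaced points on a very short segment are all decoded badly, since each has \<open>L - 1\<close>
  neighbours on at least one side.\<close>

lemma clustered_cell:
  fixes A \<sigma> :: real
  assumes \<sigma>: "\<sigma> > 0" and n: "n \<ge> 1" and L: "L \<ge> 2" and M: "M \<ge> 2 * L" and A: "A > 0"
  obtains F where "F \<subseteq> cube n (\<lambda>_. 0) A" "finite F" "card F = M"
    "\<And>C T u z p. countable C \<Longrightarrow> C \<subseteq> Rn n \<Longrightarrow> (\<And>q. q \<in> F \<Longrightarrow> lat n T (vadd n q u) z \<in> C) \<Longrightarrow> p \<in> F \<Longrightarrow>
       list_error_prob n \<sigma> L C (lat n T (vadd n p u) z) \<ge> one_sided_tail \<sigma>"
proof -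
  define e where "e = min (A / M) (2 / L)"
  have M0: "M > 0" using M L by simp
  have e: "e > 0" "real M * e \<le> A" "real (L - 1) * e \<le> 2"
  proof -
    show "e > 0" using A M0 L by (simp add: e_def)
    have "real M * e \<le> real M * (A / M)" unfolding e_def by (intro mult_left_mono) auto
    then show "real M * e \<le> A" using M0 by simp
    have "real (L - 1) * e \<le> real L * (2 / L)" unfolding e_def using L A M0 by (intro mult_mono) auto
    then show "real (L - 1) * e \<le> 2" using L by simp
  qed
  define f where "f j = along n (real j * e)" for j :: nat
  define F where "F = f ` {..<M}"
  have inj: "inj_on f {..<M}"
  proof (rule inj_onI)
    fix i j assume "f i = f j"
    then have "f i 0 = f j 0" by simp
    then show "i = j" using n e by (simp add: f_def along_def)
  qed
  show ?thesis
  proof (rule that[of F])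
    show "finite F" "card F = M" using inj by (simp_all add: F_def card_image)
    show "F \<subseteq> cube n (\<lambda>_. 0) A"
    proof
      fix x assume "x \<in> F"
      then obtain j where j: "j < M" "x = along n (real j * e)" by (auto simp: F_def f_def)
      have "real j * e < real M * e" using j e by simp
      then have "real j * e < A" using e by linarith
      then show "x \<in> cube n (\<lambda>_. 0) A" unfolding mem_cube j(2) using e(1) A along_in_Rn by (auto simp: along_def)
    qed
    fix C T u z p assume C: "countable C" "C \<subseteq> Rn n" and FC: "\<And>q. q \<in> F \<Longrightarrow> lat n T (vadd n q u) z \<in> C" and "p \<in> F"
    then obtain j where j: "j < M" "p = f j" by (auto simp: F_def)
    have shift: "vadd n (lat n T (vadd n (f j) u) z) (along n t) = lat n T (vadd n (f i) u) z" if "real i * e = real j * e + t" for i t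
      using that by (auto simp: fun_eq_iff vadd_def lat_def f_def along_def)
    show "list_error_prob n \<sigma> L C (lat n T (vadd n p u) z) \<ge> one_sided_tail \<sigma>"
    proof (cases "j + (L - 1) < M")
      case True
      show ?thesis
      proof (rule clustered_list_error[OF \<sigma> n C lat_in_Rn])
        show "e \<noteq> 0" "real (L - 1) * \<bar>e\<bar> \<le> 2" using e by auto
        fix k assume k: "1 \<le> k" "k \<le> L - 1"
        have "vadd n (lat n T (vadd n p u) z) (along n (real k * e)) = lat n T (vadd n (f (j + k)) u) z"
          unfolding j(2) by (rule shift) (simp add: algebra_simps)
        then show "vadd n (lat n T (vadd n p u) z) (along n (real k * e)) \<in> C"
          using FC[of "f (j + k)"] k True by (simp add: F_def)
      qed
    next
      case False
      show ?thesis
      proof (rule clustered_list_error[OF \<sigma> n C lat_in_Rn])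
        show "- e \<noteq> 0" "real (L - 1) * \<bar>- e\<bar> \<le> 2" using e by auto
        fix k assume k: "1 \<le> k" "k \<le> L - 1"
        then have kj: "k \<le> j" using False M by linarith
        have "vadd n (lat n T (vadd n p u) z) (along n (real k * - e)) = lat n T (vadd n (f (j - k)) u) z"
          unfolding j(2) by (rule shift) (use kj in \<open>simp add: of_nat_diff algebra_simps\<close>)
        then show "vadd n (lat n T (vadd n p u) z) (along n (real k * - e)) \<in> C"
          using FC[of "f (j - k)"] j(1) by (simp add: F_def)
      qed
    qed
  qed
qed

text \<open>A discrete intermediate value argument: if adding one element raises the fraction by at most
  \<open>\<phi>\<close>, a minimal set on which the fraction reaches \<open>\<phi>\<close> infinitely often cannot exceed \<open>2 * \<phi>\<close>
  eventually.\<close>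

lemma intermediate_fraction:
  fixes fr :: "'r set \<Rightarrow> 'k \<Rightarrow> real"
  assumes R: "finite R" and \<phi>: "\<phi> > 0" and E: "\<And>K. fr {} K = 0" and top: "\<exists>\<^sub>F K in F. fr R K \<ge> \<phi>"
    and step: "\<And>S r. S \<subseteq> R \<Longrightarrow> r \<in> R - S \<Longrightarrow> \<forall>\<^sub>F K in F. fr (insert r S) K \<le> fr S K + \<phi>"
  obtains S where "S \<subseteq> R" "\<exists>\<^sub>F K in F. fr S K \<ge> \<phi>" "\<forall>\<^sub>F K in F. fr S K \<le> 2 * \<phi>"
proof -
  define PS where "PS = {S. S \<subseteq> R \<and> (\<exists>\<^sub>F K in F. fr S K \<ge> \<phi>)}"
  have "finite PS" "R \<in> PS" using R top by (auto simp: PS_def)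
  then obtain S where S: "S \<in> PS" "\<And>S'. S' \<in> PS \<Longrightarrow> S' \<subseteq> S \<Longrightarrow> S' = S"
    using finite_has_minimal2[of PS R] by blast
  have "S \<noteq> {}" using S(1) E \<phi> by (auto simp: PS_def)
  then obtain r where r: "r \<in> S" by auto
  define S' where "S' = S - {r}"
  have S': "S' \<subseteq> R" "r \<in> R - S'" "insert r S' = S" using r S(1) by (auto simp: PS_def S'_def)
  have "S' \<notin> PS" using S(2)[of S'] r by (auto simp: S'_def)
  then have "\<forall>\<^sub>F K in F. fr S' K < \<phi>" using S'(1) by (simp add: PS_def not_frequently not_le)
  with step[OF S'(1,2)] have "\<forall>\<^sub>F K in F. fr S K \<le> 2 * \<phi>"
    unfolding S'(3) by eventually_elim linarith
  then show ?thesis using that[of S] S(1) by (auto simp: PS_def)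
qed

text \<open>Both the number \<open>a\<close> of badly decoded codewords and the total number \<open>t\<close> change by at most \<open>\<Delta>\<close>
  when one class of cells is altered.\<close>

lemma fraction_step:
  fixes a t a' t' \<Delta> N \<phi> :: real
  assumes "0 \<le> a" "a \<le> t" "N > 0" "N \<le> t" "N \<le> t'" "a' \<le> a + \<Delta>" "t \<le> t' + \<Delta>" "2 * \<Delta> \<le> \<phi> * N" "\<Delta> \<ge> 0"
  shows "a' / t' \<le> a / t + \<phi>"
proof -
  define x where "x = a / t"
  have t: "t > 0" "t' > 0" using assms by auto
  have x: "0 \<le> x" "x \<le> 1" "a = x * t" using assms t by (auto simp: x_def)
  have "x * t \<le> x * (t' + \<Delta>)" using assms x by (intro mult_left_mono) auto
  also have "\<dots> \<le> x * t' + \<Delta>" using x assms(9) by (simp add: distrib_left mult_left_le_one_le)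
  finally have "a' \<le> x * t' + 2 * \<Delta>" using assms(6) x(3) by linarith
  also have "\<dots> \<le> x * t' + \<phi> * t'"
  proof -
    have "\<phi> \<ge> 0" using assms by (metis mult_nonneg_nonneg order_trans zero_le_mult_iff zero_le_numeral not_le order_less_imp_le)
    then have "\<phi> * N \<le> \<phi> * t'" using assms by (intro mult_left_mono) auto
    then show ?thesis using assms(8) by linarith
  qed
  finally have "a' \<le> (x + \<phi>) * t'" by (simp add: distrib_right)
  then show ?thesis unfolding x_def[symmetric] using t by (simp add: field_simps)
qed

lemma Limsup_ge_frequently:
  fixes f :: "'a \<Rightarrow> 'b :: complete_linorder"
  assumes "\<exists>\<^sub>F x in F. c \<le> f x"
  shows "c \<le> Limsup F f"
proof (rule ccontr)
  assume "\<not> ?thesis"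
  then have "\<forall>\<^sub>F x in F. f x < c" by (intro Limsup_lessD) (simp add: not_le)
  then show False using assms by (simp add: frequently_def not_le)
qed

lemma eln_le: "x \<le> y \<Longrightarrow> y > 0 \<Longrightarrow> eln (ereal x) \<le> ereal (ln y)"
  by (auto simp: eln_def)

lemma eln_ge: "y \<le> x \<Longrightarrow> y > 0 \<Longrightarrow> ereal (ln y) \<le> eln (ereal x)"
  by (auto simp: eln_def)

lemma eln_mono: "x \<le> y \<Longrightarrow> eln x \<le> eln y"
  by (cases x; cases y) (auto simp: eln_def)

lemma vol_vscale:
  assumes "compact B" "B \<subseteq> Rn n" "K > 0"
  shows "vol n (vscale n K ` B) = K ^ n * measure (Leb n) B"
  unfolding vol_def vscale_eq_affmap
  by (rule measure_Leb_affmap_image[OF assms(3) compact_sets_Leb[OF assms(1,2)]])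

text \<open>In a fixed dimension all quantities are controlled up to constant factors, which vanish on the
  exponential scale.  The average error probability is bounded from both sides, so that its exponent
  has a limit.\<close>

lemma code_in_dimension:
  fixes \<sigma> \<alpha> :: real and L n :: nat
  assumes \<sigma>: "\<sigma> > 0" and \<alpha>: "\<alpha> \<ge> 1" and L: "L \<ge> 2" and n: "n \<ge> 1" and body: "reference_body n B"
  defines "\<phi> \<equiv> exp (- real n * Er L \<alpha>)" and "\<delta>0 \<equiv> 1 / sqrt (2 * pi * exp 1 * \<sigma>\<^sup>2 * \<alpha>\<^sup>2) ^ n"
  shows "\<exists>C. unbounded_code n C \<and>
     ereal (1 / real n * ln (\<delta>0 / 16)) \<le> code_rate n B C \<and> code_rate n B C \<le> ereal (1 / real n * ln \<delta>0) \<and>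
     ereal (one_sided_tail \<sigma> * \<phi>) \<le> avg_list_error_prob n B \<sigma> L C \<and> avg_list_error_prob n B \<sigma> L C \<le> ereal (5 * \<phi>)"
proof -
  interpret G: prob_space "gaussian_noise n \<sigma>" by (rule prob_space_gaussian_noise[OF \<sigma>])
  have \<phi>: "\<phi> > 0" "\<phi> \<le> 1" using Er_nonneg[OF \<alpha> L] by (auto simp: \<phi>_def)
  define D where "D = sqrt (2 * pi * exp 1 * \<sigma>\<^sup>2 * \<alpha>\<^sup>2)"
  have D: "D > 0" using \<sigma> \<alpha> by (simp add: D_def)
  have \<delta>0: "\<delta>0 > 0" "\<delta>0 * D ^ n = 1" using D by (auto simp: \<delta>0_def D_def[symmetric])
  obtain \<rho> where \<rho>: "\<rho> > 0" "measure (gaussian_noise n \<sigma>) {g \<in> space (gaussian_noise n \<sigma>). vnorm n g \<ge> \<rho>} \<le> \<phi>"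
    using gaussian_tail[OF \<sigma> \<phi>(1)] by blast
  obtain A where A: "A > 0" "\<delta>0 * A ^ n / 2 \<ge> 2 * real L + 1" "((A + 2 * \<rho>) / A) ^ n \<le> 2"
    using cell_side_exists[OF n \<delta>0(1)] by blast
  define T where "T = A + 2 * \<rho>"
  have T: "T > 0" using A \<rho> by (simp add: T_def)
  define M where "M = nat \<lfloor>\<delta>0 * A ^ n / 2\<rfloor>"
  have M: "real M \<le> \<delta>0 * A ^ n / 2" "real M \<ge> \<delta>0 * A ^ n / 2 - 1" "M \<ge> 2 * L"
    using A(2) unfolding M_def by linarith+
  have M4: "real M \<ge> \<delta>0 * A ^ n / 4" using M(2) A(2) L by linarith
  have M1: "M \<ge> 1" using M(3) L by linarith
  have AT: "T ^ n \<le> 2 * A ^ n" "A ^ n \<le> T ^ n"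
    using A \<rho> by (auto simp: T_def power_divide divide_le_eq intro!: power_mono)
  have dens: "real (2 * M) / A ^ n * sqrt (2 * pi * exp 1 * \<sigma>\<^sup>2 * \<alpha>\<^sup>2) ^ n \<le> 1"
  proof -
    have "real (2 * M) / A ^ n \<le> \<delta>0" using M(1) A(1) by (simp add: field_simps)
    then have "real (2 * M) / A ^ n * D ^ n \<le> \<delta>0 * D ^ n" using D by (intro mult_right_mono) auto
    then show ?thesis using \<delta>0(2) by (simp add: D_def)
  qed
  obtain F where F: "F \<subseteq> cube n (\<lambda>_. 0) A" "finite F" "card F = M" "\<And>x. x \<in> F \<Longrightarrow> list_error_prob n \<sigma> L F x \<le> 2 * \<phi>"
    using good_finite_code[OF \<sigma> \<alpha> L n A(1) M1 dens] unfolding \<phi>_def by blast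
  obtain F' where F': "F' \<subseteq> cube n (\<lambda>_. 0) A" "finite F'" "card F' = M"
    "\<And>C T u z p. countable C \<Longrightarrow> C \<subseteq> Rn n \<Longrightarrow> (\<And>q. q \<in> F' \<Longrightarrow> lat n T (vadd n q u) z \<in> C) \<Longrightarrow> p \<in> F' \<Longrightarrow>
       list_error_prob n \<sigma> L C (lat n T (vadd n p u) z) \<ge> one_sided_tail \<sigma>"
    using clustered_cell[OF \<sigma> n L M(3) A(1)] by blast
  note B = reference_body_compact[OF body]
  obtain a l where al: "l > 0" "cube n a l \<subseteq> B" using reference_body_cube[OF body] .
  define b where "b = measure (Leb n) B"
  have b: "b > 0"
  proof -
    have "l ^ n \<le> b" unfolding b_def using al compact_sets_Leb[OF B] emeasure_compact_finite[OF B]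
      by (subst measure_cube[symmetric, of l n a]) (auto intro!: measure_mono_fmeasurable simp: fmeasurable_def)
    then show ?thesis using al(1) by (meson less_le_trans zero_less_power)
  qed
  \<comment> \<open>so many residue classes that a single one carries at most the fraction \<open>\<phi>\<close> of the codewords in
    every large dilate, even if the body favours this class on its boundary\<close>
  obtain k :: nat where k: "k \<ge> 1" "4 * b \<le> \<phi> * real k * (l / 2) ^ n"
  proof -
    define c where "c = \<phi> * (l / 2) ^ n"
    have c: "c > 0" using \<phi> al(1) by (simp add: c_def)
    obtain k :: nat where "4 * b / c < real k" using reals_Archimedean2 by blast
    then have "4 * b < real k * c" using c by (simp add: pos_divide_less_eq)
    also have "\<dots> \<le> real (k + 1) * c" using c by (intro mult_right_mono) auto
    finally have "4 * b \<le> \<phi> * real (k + 1) * (l / 2) ^ n" by (simp add: c_def mult_ac)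
    then show ?thesis using that[of "k + 1"] by simp
  qed
  have kn: "4 * b \<le> \<phi> * real k ^ n * (l / 2) ^ n"
  proof -
    have "real k \<le> real k ^ n" using k(1) n by (intro self_le_power) auto
    then have "\<phi> * real k * (l / 2) ^ n \<le> \<phi> * real k ^ n * (l / 2) ^ n"
      using \<phi> al(1) by (intro mult_right_mono mult_left_mono) auto
    then show ?thesis using k(2) by linarith
  qed
  define T' where "T' = real k * T"
  have T': "T' > 0" "T' ^ n = real k ^ n * T ^ n" using k T by (auto simp: T'_def power_mult_distrib)
  define R where "R = residues_box n k"
  have R: "finite R" "card R = k ^ n" unfolding R_def by (rule finite_residues_box, rule card_residues_box)
  \<comment> \<open>the shift has to be fixed before the set of bad classes, hence it serves the codewords of good and
    of bad cells in every class\<close>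
  define X where "X = (\<Union>r\<in>R. (\<lambda>p. lat n T p r) ` (F \<union> F'))"
  have X: "finite X" using R F F' by (auto simp: X_def)
  obtain u where u: "\<And>e. e > 0 \<Longrightarrow> \<exists>\<^sub>F K in at_top. \<forall>p\<in>X.
     real (card (hits n T' (vadd n p u) (vscale n K ` B))) * T' ^ n \<ge> K ^ n * (b - e)"
    using simultaneous_shift[OF B T'(1) X] unfolding b_def by blast
  define N where "N K r p = real (card (hits n T' (vadd n (lat n T p r) u) (vscale n K ` B)))" for K r p
  define G where "G S r = (if r \<in> S then F' else F)" for S :: "(nat \<Rightarrow> int) set" and r
  define H where "H S r = (if r \<in> S then F' else {})" for S :: "(nat \<Rightarrow> int) set" and r
  have G: "G S r \<subseteq> cube n (\<lambda>_. 0) A" "finite (G S r)" "card (G S r) = M" for S r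
    using F F' by (auto simp: G_def)
  have H: "H S r \<subseteq> cube n (\<lambda>_. 0) A" "finite (H S r)" for S r
    using F F' by (auto simp: H_def)
  define C where "C S = pcode n T k u (G S)" for S
  define Bad where "Bad S = pcode n T k u (H S)" for S
  have BadC: "Bad S \<subseteq> C S" for S unfolding Bad_def C_def pcode_def H_def G_def by (auto split: if_splits)
  have CR: "C S \<subseteq> Rn n" for S unfolding C_def by (rule pcode_sub_Rn)
  have Cc: "countable (C S)" for S
  proof -
    have "C S \<subseteq> (\<Union>z\<in>Zn n. \<Union>p\<in>F \<union> F'. {lat n T (vadd n p u) z})"
      unfolding C_def pcode_def G_def by (auto split: if_splits)
    moreover have "countable (\<Union>z\<in>Zn n. \<Union>p\<in>F \<union> F'. {lat n T (vadd n p u) z})"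
      using F F' by (intro countable_UN countable_Zn) (auto intro: countable_finite)
    ultimately show ?thesis by (rule countable_subset)
  qed
  have unb: "unbounded_code n (C S)" for S
    unfolding unbounded_code_def
  proof (intro conjI allI CR Cc)
    fix r
    have "{x \<in> C S. vnorm n x \<le> r} \<subseteq> {x \<in> C S. \<forall>i<n. \<bar>x i\<bar> \<le> r}"
    proof safe
      fix x i assume x: "vnorm n x \<le> r" "i < n"
      have "(x i)\<^sup>2 \<le> (\<Sum>j<n. (x j)\<^sup>2)" by (rule member_le_sum) (use x in auto)
      then have "sqrt ((x i)\<^sup>2) \<le> sqrt (\<Sum>j<n. (x j)\<^sup>2)" by (rule real_sqrt_le_mono)
      then show "\<bar>x i\<bar> \<le> r" using x by (simp add: vnorm_def L2_set_def)
    qed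
    moreover have "finite {x \<in> C S. \<forall>i<n. \<bar>x i\<bar> \<le> r}"
      unfolding C_def by (rule finite_pcode_bounded[OF T k(1) G(2)])
    ultimately show "finite {x \<in> C S. vnorm n x \<le> r}" by (rule finite_subset)
  qed

  define t where "t S K = real (card (C S \<inter> vscale n K ` B))" for S K
  define s where "s S K = real (card (Bad S \<inter> vscale n K ` B))" for S K
  obtain K1 where K1: "K1 > 0" "\<And>K v. K \<ge> K1 \<Longrightarrow> finite (hits n T' v (vscale n K ` B)) \<and>
     real (card (hits n T' v (vscale n K ` B))) * T' ^ n \<le> K ^ n * (b + b)"
    using hits_upper[OF B T'(1) b] unfolding b_def by auto
  define K2 where "K2 = max K1 (2 * T' / l)"
  have K2: "K \<ge> K1" "K > 0" "K * l \<ge> 2 * T'" if "K \<ge> K2" for K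
  proof -
    show "K \<ge> K1" "K > 0" using that K1(1) by (auto simp: K2_def)
    have "K \<ge> 2 * T' / l" using that by (auto simp: K2_def)
    then show "K * l \<ge> 2 * T'" using al(1) by (simp add: field_simps)
  qed
  have Nle: "N K r p \<le> K ^ n * (2 * b) / T' ^ n" if "K \<ge> K2" for K r p
    using K1(2)[OF K2(1)[OF that], of "vadd n (lat n T p r) u"] T'(1) by (simp add: N_def field_simps)
  have Nge: "N K r p \<ge> (K * l / 2) ^ n / T' ^ n" if "K \<ge> K2" for K r p
    using hits_lower[OF al T'(1) K2(3)[OF that], of "vadd n (lat n T p r) u"] K1(2)[OF K2(1)[OF that], of "vadd n (lat n T p r) u"] T'(1)
    by (simp add: N_def field_simps)
  have N0: "N K r p \<ge> 0" for K r p by (simp add: N_def)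
  have tN: "t S K = (\<Sum>r\<in>R. \<Sum>p\<in>G S r. N K r p)" if "K \<ge> K2" for S K
  proof -
    have "finite (hits n (real k * T) v (vscale n K ` B))" for v using K1(2)[OF K2(1)[OF that]] by (simp add: T'_def)
    then show ?thesis
      unfolding t_def C_def R_def N_def T'_def
      by (subst card_pcode_inter[OF T_def A(1) \<rho>(1) k(1) G(1,2)]) simp_all
  qed
  have sN: "s S K = (\<Sum>r\<in>R. \<Sum>p\<in>H S r. N K r p)" if "K \<ge> K2" for S K
  proof -
    have "finite (hits n (real k * T) v (vscale n K ` B))" for v using K1(2)[OF K2(1)[OF that]] by (simp add: T'_def)
    then show ?thesis
      unfolding s_def Bad_def R_def N_def T'_def
      by (subst card_pcode_inter[OF T_def A(1) \<rho>(1) k(1) H(1,2)]) simp_all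
  qed
  have finC: "finite (C S \<inter> vscale n K ` B)" for S K
  proof -
    obtain c where c: "\<And>x i. x \<in> vscale n K ` B \<Longrightarrow> i < n \<Longrightarrow> \<bar>x i\<bar> \<le> c"
      using compact_bounded_Rn[OF compact_vscale[OF B]] by metis
    then have "C S \<inter> vscale n K ` B \<subseteq> {x \<in> C S. \<forall>i<n. \<bar>x i\<bar> \<le> c}" by blast
    moreover have "finite {x \<in> C S. \<forall>i<n. \<bar>x i\<bar> \<le> c}"
      unfolding C_def by (rule finite_pcode_bounded[OF T k(1) G(2)])
    ultimately show ?thesis by (rule finite_subset)
  qed
  define low where "low K = real (k ^ n) * (real M * ((K * l / 2) ^ n / T' ^ n))" for K
  define up where "up K = real M * (K ^ n * (2 * b) / T' ^ n)" for K
  have low: "low K > 0" if "K \<ge> K2" for K using K2(2)[OF that] k(1) M1 al(1) T'(1) by (simp add: low_def)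
  have t_low: "t S K \<ge> low K" if "K \<ge> K2" for S K
  proof -
    have "low K = (\<Sum>r\<in>R. \<Sum>p\<in>G S r. (K * l / 2) ^ n / T' ^ n)" by (simp add: low_def R G(3))
    also have "\<dots> \<le> t S K" unfolding tN[OF that] by (intro sum_mono Nge that)
    finally show ?thesis .
  qed
  have cell_up: "(\<Sum>p\<in>P. N K r p) \<le> up K" if "K \<ge> K2" "card P = M" for P K r
  proof -
    have "(\<Sum>p\<in>P. N K r p) \<le> real (card P) * (K ^ n * (2 * b) / T' ^ n)"
      by (rule sum_bounded_above) (rule Nle[OF that(1)])
    then show ?thesis by (simp add: up_def that(2))
  qed
  have s_le_t: "s S K \<le> t S K" for S K
    unfolding s_def t_def using BadC[of S] finC[of S K] by (intro of_nat_mono card_mono) auto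
  have up_low: "2 * up K \<le> \<phi> * low K" if "K \<ge> K2" for K
  proof -
    have "2 * up K = (real M * K ^ n / T' ^ n) * (4 * b)" by (simp add: up_def)
    also have "\<dots> \<le> (real M * K ^ n / T' ^ n) * (\<phi> * real k ^ n * (l / 2) ^ n)"
      using kn K2(2)[OF that] T'(1) by (intro mult_left_mono) auto
    also have "\<dots> = \<phi> * low K" by (simp add: low_def power_mult_distrib power_divide mult_ac)
    finally show ?thesis .
  qed
  define fr where "fr S K = s S K / t S K" for S K
  obtain S where S: "S \<subseteq> R" "\<exists>\<^sub>F K in at_top. fr S K \<ge> \<phi>" "\<forall>\<^sub>F K in at_top. fr S K \<le> 2 * \<phi>"
  proof (rule intermediate_fraction[of R \<phi> fr "at_top :: real filter"])
    show "finite R" "\<phi> > 0" by fact+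
    show "fr {} K = 0" for K by (simp add: fr_def s_def Bad_def pcode_def H_def)
    have "Bad R = C R"
      unfolding Bad_def C_def pcode_def G_def H_def R_def using zmod_in_box[OF k(1)] by simp
    then have "fr R K = 1" if "K \<ge> K2" for K
      using t_low[OF that, of R] low[OF that] by (simp add: fr_def s_def t_def)
    then have "\<forall>\<^sub>F K in at_top. fr R K \<ge> \<phi>" using \<phi>(2) by (intro eventually_at_top_linorderI[of K2]) auto
    then show "\<exists>\<^sub>F K in at_top. fr R K \<ge> \<phi>" by (rule eventually_frequently[rotated]) simp
  next
    fix S r assume Sr: "S \<subseteq> R" "r \<in> R - S"
    show "\<forall>\<^sub>F K in at_top. fr (insert r S) K \<le> fr S K + \<phi>"
    proof (rule eventually_at_top_linorderI)
      fix K assume K: "K \<ge> K2"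
      have rR: "r \<in> R" using Sr by simp
      have t1: "t (insert r S) K = (\<Sum>p\<in>F'. N K r p) + (\<Sum>q\<in>R - {r}. \<Sum>p\<in>G S q. N K q p)"
        unfolding tN[OF K] by (subst sum.remove[OF R(1) rR]) (auto simp: G_def intro!: sum.cong)
      have t2: "t S K = (\<Sum>p\<in>F. N K r p) + (\<Sum>q\<in>R - {r}. \<Sum>p\<in>G S q. N K q p)"
        unfolding tN[OF K] using Sr by (subst sum.remove[OF R(1) rR]) (auto simp: G_def)
      have s1: "s (insert r S) K = (\<Sum>p\<in>F'. N K r p) + (\<Sum>q\<in>R - {r}. \<Sum>p\<in>H S q. N K q p)"
        unfolding sN[OF K] by (subst sum.remove[OF R(1) rR]) (auto simp: H_def intro!: sum.cong)
      have s2: "s S K = (\<Sum>q\<in>R - {r}. \<Sum>p\<in>H S q. N K q p)"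
        unfolding sN[OF K] using Sr by (subst sum.remove[OF R(1) rR]) (auto simp: H_def)
      have F0: "(\<Sum>p\<in>F'. N K r p) \<ge> 0" by (intro sum_nonneg N0)
      show "fr (insert r S) K \<le> fr S K + \<phi>"
        unfolding fr_def
      proof (rule fraction_step[where N="low K" and \<Delta>="up K"])
        show "0 \<le> s S K" by (simp add: s_def)
        show "s (insert r S) K \<le> s S K + up K" using s1 s2 cell_up[OF K F'(3), of r] by linarith
        show "t S K \<le> t (insert r S) K + up K" using t1 t2 cell_up[OF K F(3), of r] F0 by linarith
        show "0 \<le> up K" using F0 cell_up[OF K F'(3), of r] by linarith
      qed (use s_le_t low t_low up_low K in auto)
    qed
  qed

  have Pbad: "list_error_prob n \<sigma> L (C S) x \<ge> one_sided_tail \<sigma>" if "x \<in> Bad S" for x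
  proof -
    obtain z p where zp: "z \<in> Zn n" "p \<in> H S (zmod n k z)" "x = lat n T (vadd n p u) z"
      using \<open>x \<in> Bad S\<close> unfolding Bad_def mem_pcode by blast
    then have z: "zmod n k z \<in> S" "p \<in> F'" by (auto simp: H_def split: if_splits)
    have "lat n T (vadd n q u) z \<in> C S" if "q \<in> F'" for q
      unfolding C_def mem_pcode using zp(1) z(1) that by (auto simp: G_def)
    then show ?thesis unfolding zp(3) by (intro F'(4) Cc CR z(2))
  qed
  have Pgood: "list_error_prob n \<sigma> L (C S) x \<le> 3 * \<phi>" if x: "x \<in> C S - Bad S" for x
  proof -
    obtain z p where zp: "z \<in> Zn n" "p \<in> G S (zmod n k z)" "x = lat n T (vadd n p u) z"
    proof -
      have "x \<in> pcode n T k u (G S)" using x by (simp add: C_def)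
      then show ?thesis using that unfolding mem_pcode by blast
    qed
    have "zmod n k z \<notin> S"
    proof
      assume "zmod n k z \<in> S"
      then have "x \<in> Bad S" unfolding Bad_def mem_pcode using zp by (auto simp: G_def H_def)
      then show False using x by blast
    qed
    then have GF: "G S (zmod n k z) = F" by (simp add: G_def)
    have "list_error_prob n \<sigma> L (C S) x \<le> list_error_prob n \<sigma> L (G S (zmod n k z)) p
        + measure (gaussian_noise n \<sigma>) {g \<in> space (gaussian_noise n \<sigma>). vnorm n g \<ge> \<rho>}"
      unfolding C_def zp(3) by (rule list_error_pcode_le[where G="G S", OF \<sigma> T_def A(1) \<rho>(1) G(1) countable_finite[OF G(2)] zp(1,2)])
    also have "\<dots> \<le> 2 * \<phi> + \<phi>" unfolding GF using F(4)[of p] zp(2) \<rho>(2) GF by simp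
    finally show ?thesis by simp
  qed
  have P01: "0 \<le> list_error_prob n \<sigma> L (C S) x" "list_error_prob n \<sigma> L (C S) x \<le> 1" for x
    unfolding list_error_prob_def by (simp_all add: G.prob_le_1)
  let ?P = "list_error_prob n \<sigma> L (C S)"
  define avgK where "avgK K = (1 / real (card (C S \<inter> vscale n K ` B))) * (\<Sum>x\<in>C S \<inter> vscale n K ` B. ?P x)" for K
  have avgK: "one_sided_tail \<sigma> * fr S K \<le> avgK K" "avgK K \<le> fr S K + 3 * \<phi>" if K: "K \<ge> K2" for K
  proof -
    have t0: "t S K > 0" using low[OF K] t_low[OF K, of S] by linarith
    define Y where "Y = C S \<inter> vscale n K ` B"
    have Y: "finite Y" "Bad S \<inter> vscale n K ` B \<subseteq> Y" using finC BadC by (auto simp: Y_def)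
    have split: "(\<Sum>x\<in>Y. ?P x) = (\<Sum>x\<in>Bad S \<inter> vscale n K ` B. ?P x)
       + (\<Sum>x\<in>Y - Bad S \<inter> vscale n K ` B. ?P x)"
      using sum.subset_diff[OF Y(2,1)] by (simp add: add.commute)
    have "(\<Sum>x\<in>Bad S \<inter> vscale n K ` B. ?P x) \<ge> s S K * one_sided_tail \<sigma>"
      unfolding s_def by (rule sum_bounded_below) (use Pbad in blast)
    moreover have "(\<Sum>x\<in>Y - Bad S \<inter> vscale n K ` B. ?P x) \<ge> 0"
      by (intro sum_nonneg P01)
    ultimately have 1: "(\<Sum>x\<in>Y. ?P x) \<ge> s S K * one_sided_tail \<sigma>" using split by linarith
    have "(\<Sum>x\<in>Bad S \<inter> vscale n K ` B. ?P x) \<le> s S K * 1"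
      unfolding s_def by (rule sum_bounded_above) (rule P01)
    moreover have "(\<Sum>x\<in>Y - Bad S \<inter> vscale n K ` B. ?P x) \<le> real (card (Y - Bad S \<inter> vscale n K ` B)) * (3 * \<phi>)"
      by (rule sum_bounded_above) (use Pgood in \<open>auto simp: Y_def\<close>)
    moreover have "real (card (Y - Bad S \<inter> vscale n K ` B)) * (3 * \<phi>) \<le> t S K * (3 * \<phi>)"
      unfolding t_def Y_def[symmetric] using Y \<phi> by (intro mult_right_mono of_nat_mono card_mono) auto
    ultimately have 2: "(\<Sum>x\<in>Y. ?P x) \<le> s S K + t S K * (3 * \<phi>)" using split by linarith
    have te: "avgK K = (\<Sum>x\<in>Y. ?P x) / t S K" by (simp add: avgK_def Y_def t_def)
    show "one_sided_tail \<sigma> * fr S K \<le> avgK K" unfolding te fr_def using 1 t0 by (simp add: divide_right_mono mult.commute)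
    have "avgK K \<le> (s S K + t S K * (3 * \<phi>)) / t S K" unfolding te using 2 t0 by (intro divide_right_mono) auto
    also have "\<dots> = fr S K + 3 * \<phi>" using t0 by (simp add: fr_def add_divide_distrib)
    finally show "avgK K \<le> fr S K + 3 * \<phi>" .
  qed
  have avg_le: "avg_list_error_prob n B \<sigma> L (C S) \<le> ereal (5 * \<phi>)"
    unfolding avg_list_error_prob_def
  proof (rule Limsup_bounded)
    show "\<forall>\<^sub>F K in at_top. ereal ((1 / real (card (C S \<inter> vscale n K ` B))) * (\<Sum>x\<in>C S \<inter> vscale n K ` B. ?P x)) \<le> ereal (5 * \<phi>)"
      unfolding avgK_def[symmetric] using S(3) eventually_ge_at_top[of K2]
      by eventually_elim (use avgK(2) in force)
  qed
  have avg_ge: "ereal (one_sided_tail \<sigma> * \<phi>) \<le> avg_list_error_prob n B \<sigma> L (C S)"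
    unfolding avg_list_error_prob_def
  proof (rule Limsup_ge_frequently)
    have "\<exists>\<^sub>F K in at_top. ereal (one_sided_tail \<sigma> * \<phi>) \<le> ereal (avgK K)"
    proof (rule frequently_rev_mp[OF S(2)], rule eventually_at_top_linorderI, intro impI)
      fix K assume K: "K \<ge> K2" "\<phi> \<le> fr S K"
      then have "one_sided_tail \<sigma> * \<phi> \<le> one_sided_tail \<sigma> * fr S K"
        using one_sided_tail_pos[OF \<sigma>] by (intro mult_left_mono) auto
      then show "ereal (one_sided_tail \<sigma> * \<phi>) \<le> ereal (avgK K)" using avgK(1)[OF K(1)] by simp
    qed
    then show "\<exists>\<^sub>F K in at_top. ereal (one_sided_tail \<sigma> * \<phi>) \<le> ereal ((1 / real (card (C S \<inter> vscale n K ` B))) * (\<Sum>x\<in>C S \<inter> vscale n K ` B. ?P x))"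
      unfolding avgK_def .
  qed

  have volK: "vol n (vscale n K ` B) = K ^ n * b" if "K \<ge> K2" for K
    unfolding b_def by (rule vol_vscale[OF B K2(2)[OF that]])
  have rate_le: "code_rate n B (C S) \<le> ereal (1 / real n * ln \<delta>0)"
    unfolding code_rate_def
  proof (rule Limsup_bounded, rule eventually_at_top_linorderI)
    fix K assume K: "K \<ge> K2"
    have "t S K \<le> (\<Sum>r\<in>R. up K)" unfolding tN[OF K] by (intro sum_mono cell_up K G(3))
    also have "\<dots> = real k ^ n * up K" by (simp add: R)
    also have "\<dots> = 2 * (real M / T ^ n) * (K ^ n * b)" using k(1) T by (simp add: up_def T'(2))
    finally have "t S K / (K ^ n * b) \<le> 2 * (real M / T ^ n)" using K2(2)[OF K] b by (simp add: field_simps)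
    also have "\<dots> \<le> \<delta>0"
    proof -
      have "\<delta>0 * A ^ n \<le> \<delta>0 * T ^ n" using AT(2) \<delta>0(1) by (intro mult_left_mono) auto
      then have "2 * real M \<le> \<delta>0 * T ^ n" using M(1) by linarith
      then show ?thesis using T by (simp add: field_simps)
    qed
    finally have "eln (ereal (t S K / vol n (vscale n K ` B))) \<le> ereal (ln \<delta>0)"
      unfolding volK[OF K] by (rule eln_le) (rule \<delta>0(1))
    then have "ereal (1 / real n) * eln (ereal (t S K / vol n (vscale n K ` B))) \<le> ereal (1 / real n) * ereal (ln \<delta>0)"
      by (intro ereal_mult_left_mono) auto
    then show "ereal (1 / real n) * eln (ereal (real (card (C S \<inter> vscale n K ` B)) / vol n (vscale n K ` B))) \<le> ereal (1 / real n * ln \<delta>0)"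
      unfolding t_def by simp
  qed
  have rate_ge: "ereal (1 / real n * ln (\<delta>0 / 16)) \<le> code_rate n B (C S)"
    unfolding code_rate_def
  proof (rule Limsup_ge_frequently)
    show "\<exists>\<^sub>F K in at_top. ereal (1 / real n * ln (\<delta>0 / 16)) \<le> ereal (1 / real n) * eln (ereal (real (card (C S \<inter> vscale n K ` B)) / vol n (vscale n K ` B)))"
    proof (rule frequently_rev_mp[OF u[of "b / 2"]])
      show "b / 2 > 0" using b by simp
      show "\<forall>\<^sub>F K in at_top. (\<forall>p\<in>X. real (card (hits n T' (vadd n p u) (vscale n K ` B))) * T' ^ n \<ge> K ^ n * (b - b / 2)) \<longrightarrow>
        ereal (1 / real n * ln (\<delta>0 / 16)) \<le> ereal (1 / real n) * eln (ereal (real (card (C S \<inter> vscale n K ` B)) / vol n (vscale n K ` B)))"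
      proof (rule eventually_at_top_linorderI, intro impI)
        fix K assume K: "K \<ge> K2" and h: "\<forall>p\<in>X. real (card (hits n T' (vadd n p u) (vscale n K ` B))) * T' ^ n \<ge> K ^ n * (b - b / 2)"
        have "N K r p \<ge> K ^ n * (b / 2) / T' ^ n" if "r \<in> R" "p \<in> G S r" for r p
        proof -
          have "lat n T p r \<in> X" using that by (auto simp: X_def G_def split: if_splits)
          then show ?thesis using h T'(1) by (force simp: N_def field_simps)
        qed
        then have "(\<Sum>r\<in>R. \<Sum>p\<in>G S r. K ^ n * (b / 2) / T' ^ n) \<le> t S K"
          unfolding tN[OF K] by (intro sum_mono) auto
        also have "(\<Sum>r\<in>R. \<Sum>p\<in>G S r. K ^ n * (b / 2) / T' ^ n) = real k ^ n * (real M * (K ^ n * (b / 2) / T' ^ n))"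
          by (simp add: R G(3))
        also have "\<dots> = (real M / T ^ n / 2) * (K ^ n * b)" using k(1) T by (simp add: T'(2))
        finally have "real M / T ^ n / 2 \<le> t S K / (K ^ n * b)" using K2(2)[OF K] b by (simp add: field_simps)
        moreover have "\<delta>0 / 16 \<le> real M / T ^ n / 2"
        proof -
          have "\<delta>0 * T ^ n \<le> \<delta>0 * (2 * A ^ n)" using AT(1) \<delta>0(1) by (intro mult_left_mono) auto
          then have "\<delta>0 * T ^ n \<le> 8 * real M" using M4 by linarith
          then show ?thesis using T by (simp add: field_simps)
        qed
        ultimately have "\<delta>0 / 16 \<le> t S K / (K ^ n * b)" by linarith
        then have "ereal (ln (\<delta>0 / 16)) \<le> eln (ereal (t S K / vol n (vscale n K ` B)))"
          unfolding volK[OF K] by (rule eln_ge) (use \<delta>0(1) in simp)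
        then have "ereal (1 / real n) * ereal (ln (\<delta>0 / 16)) \<le> ereal (1 / real n) * eln (ereal (t S K / vol n (vscale n K ` B)))"
          by (intro ereal_mult_left_mono) auto
        then show "ereal (1 / real n * ln (\<delta>0 / 16)) \<le> ereal (1 / real n) * eln (ereal (real (card (C S \<inter> vscale n K ` B)) / vol n (vscale n K ` B)))"
          unfolding t_def by simp
      qed
    qed
  qed
  show ?thesis using unb[of S] rate_ge rate_le avg_ge avg_le by blast
qed

theorem mainTheorem6:
  fixes \<sigma> \<alpha> :: real and L :: nat and B :: "nat \<Rightarrow> (nat \<Rightarrow> real) set"
  assumes "\<sigma> > 0" and "\<alpha> \<ge> 1" and "L \<ge> 2"
    and "\<And>n. n \<ge> 1 \<Longrightarrow> reference_body n (B n)"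
  shows "\<exists>C :: nat \<Rightarrow> (nat \<Rightarrow> real) set.
      (\<forall>n\<ge>1. unbounded_code n (C n)) \<and>
      (\<lambda>n. code_rate n (B n) (C n))
        \<longlonglongrightarrow> ereal (1 / 2 * ln (1 / (2 * pi * exp 1 * \<sigma>\<^sup>2 * \<alpha>\<^sup>2))) \<and>
      (\<exists>E :: ereal.
        (\<lambda>n. - (ereal (1 / real n) * eln (avg_list_error_prob n (B n) \<sigma> L (C n)))) \<longlonglongrightarrow> E \<and>
        E \<ge> ereal (Er L \<alpha>))"
proof -
  define \<phi> where "\<phi> n = exp (- real n * Er L \<alpha>)" for n :: nat
  define D where "D = 2 * pi * exp 1 * \<sigma>\<^sup>2 * \<alpha>\<^sup>2"
  have D: "D > 0" using assms by (simp add: D_def)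
  define R where "R = 1 / 2 * ln (1 / D)"
  define \<delta> where "\<delta> n = 1 / sqrt D ^ n" for n :: nat
  define c where "c = one_sided_tail \<sigma>"
  have c: "c > 0" unfolding c_def by (rule one_sided_tail_pos) fact
  have "\<forall>n. \<exists>C. n \<ge> 1 \<longrightarrow> unbounded_code n C \<and>
     ereal (1 / real n * ln (\<delta> n / 16)) \<le> code_rate n (B n) C \<and> code_rate n (B n) C \<le> ereal (1 / real n * ln (\<delta> n)) \<and>
     ereal (c * \<phi> n) \<le> avg_list_error_prob n (B n) \<sigma> L C \<and> avg_list_error_prob n (B n) \<sigma> L C \<le> ereal (5 * \<phi> n)"
    using code_in_dimension[OF assms(1-3) _ assms(4)] unfolding \<phi>_def \<delta>_def D_def c_def by blast
  then obtain C where C: "\<And>n. n \<ge> 1 \<Longrightarrow> unbounded_code n (C n)"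
    "\<And>n. n \<ge> 1 \<Longrightarrow> ereal (1 / real n * ln (\<delta> n / 16)) \<le> code_rate n (B n) (C n)"
    "\<And>n. n \<ge> 1 \<Longrightarrow> code_rate n (B n) (C n) \<le> ereal (1 / real n * ln (\<delta> n))"
    "\<And>n. n \<ge> 1 \<Longrightarrow> ereal (c * \<phi> n) \<le> avg_list_error_prob n (B n) \<sigma> L (C n)"
    "\<And>n. n \<ge> 1 \<Longrightarrow> avg_list_error_prob n (B n) \<sigma> L (C n) \<le> ereal (5 * \<phi> n)"
    by metis
  have inv: "(\<lambda>n. x - 1 / real n * y) \<longlonglongrightarrow> x" for x y :: real
  proof -
    have "(\<lambda>n. x - 1 / real n * y) \<longlonglongrightarrow> x - 0 * y" by (intro tendsto_intros lim_1_over_n)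
    then show ?thesis by simp
  qed
  have ln\<delta>: "1 / real n * ln (\<delta> n) = R" if "n \<ge> 1" for n
  proof -
    have "ln (\<delta> n) = - (real n * (ln D / 2))"
      using D by (simp add: \<delta>_def ln_div ln_realpow ln_sqrt)
    then show ?thesis using that D by (simp add: R_def ln_div)
  qed
  have rate: "(\<lambda>n. code_rate n (B n) (C n)) \<longlonglongrightarrow> ereal R"
  proof (rule tendsto_sandwich)
    show "(\<lambda>n. ereal (R - 1 / real n * ln 16)) \<longlonglongrightarrow> ereal R" using inv[of R "ln 16"] by simp
    show "(\<lambda>n. ereal R) \<longlonglongrightarrow> ereal R" by simp
    show "\<forall>\<^sub>F n in sequentially. ereal (R - 1 / real n * ln 16) \<le> code_rate n (B n) (C n)"
    proof (rule eventually_sequentiallyI[of 1])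
      fix n :: nat assume n: "1 \<le> n"
      have "\<delta> n > 0" using D by (simp add: \<delta>_def)
      then have "1 / real n * ln (\<delta> n / 16) = R - 1 / real n * ln 16"
        unfolding ln\<delta>[OF n, symmetric] by (simp add: ln_div diff_divide_distrib)
      then show "ereal (R - 1 / real n * ln 16) \<le> code_rate n (B n) (C n)" using C(2)[OF n] by simp
    qed
    show "\<forall>\<^sub>F n in sequentially. code_rate n (B n) (C n) \<le> ereal R"
      using C(3) ln\<delta> by (intro eventually_sequentiallyI[of 1]) simp
  qed
  have exponent: "(\<lambda>n. - (ereal (1 / real n) * eln (avg_list_error_prob n (B n) \<sigma> L (C n)))) \<longlonglongrightarrow> ereal (Er L \<alpha>)"
  proof (rule tendsto_sandwich)
    have ex: "- (ereal (1 / real n) * ereal (ln (x * \<phi> n))) = ereal (Er L \<alpha> - 1 / real n * ln x)" if "n \<ge> 1" "x > 0" for n x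
      using that by (simp add: \<phi>_def ln_mult field_simps)
    show "(\<lambda>n. ereal (Er L \<alpha> - 1 / real n * ln 5)) \<longlonglongrightarrow> ereal (Er L \<alpha>)" using inv[of "Er L \<alpha>" "ln 5"] by simp
    show "(\<lambda>n. ereal (Er L \<alpha> - 1 / real n * ln c)) \<longlonglongrightarrow> ereal (Er L \<alpha>)" using inv[of "Er L \<alpha>" "ln c"] by simp
    show "\<forall>\<^sub>F n in sequentially. ereal (Er L \<alpha> - 1 / real n * ln 5) \<le> - (ereal (1 / real n) * eln (avg_list_error_prob n (B n) \<sigma> L (C n)))"
    proof (rule eventually_sequentiallyI[of 1])
      fix n :: nat assume n: "1 \<le> n"
      have "eln (avg_list_error_prob n (B n) \<sigma> L (C n)) \<le> eln (ereal (5 * \<phi> n))" by (rule eln_mono[OF C(5)[OF n]])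
      also have "\<dots> \<le> ereal (ln (5 * \<phi> n))" by (rule eln_le) (simp_all add: \<phi>_def)
      finally have "ereal (1 / real n) * eln (avg_list_error_prob n (B n) \<sigma> L (C n)) \<le> ereal (1 / real n) * ereal (ln (5 * \<phi> n))"
        by (intro ereal_mult_left_mono) auto
      then show "ereal (Er L \<alpha> - 1 / real n * ln 5) \<le> - (ereal (1 / real n) * eln (avg_list_error_prob n (B n) \<sigma> L (C n)))"
        using ex[OF n, of 5] by (metis ereal_minus_le_minus zero_less_numeral)
    qed
    show "\<forall>\<^sub>F n in sequentially. - (ereal (1 / real n) * eln (avg_list_error_prob n (B n) \<sigma> L (C n))) \<le> ereal (Er L \<alpha> - 1 / real n * ln c)"
    proof (rule eventually_sequentiallyI[of 1])
      fix n :: nat assume n: "1 \<le> n"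
      have "ereal (ln (c * \<phi> n)) \<le> eln (ereal (c * \<phi> n))" by (rule eln_ge) (use c in \<open>simp_all add: \<phi>_def\<close>)
      also have "\<dots> \<le> eln (avg_list_error_prob n (B n) \<sigma> L (C n))" by (rule eln_mono[OF C(4)[OF n]])
      finally have "ereal (1 / real n) * ereal (ln (c * \<phi> n)) \<le> ereal (1 / real n) * eln (avg_list_error_prob n (B n) \<sigma> L (C n))"
        by (intro ereal_mult_left_mono) auto
      then show "- (ereal (1 / real n) * eln (avg_list_error_prob n (B n) \<sigma> L (C n))) \<le> ereal (Er L \<alpha> - 1 / real n * ln c)"
        using ex[OF n c] by (metis ereal_minus_le_minus)
    qed
  qed
  show ?thesis
    using C(1) rate exponent unfolding R_def D_def by (intro exI[of _ C] conjI exI[of _ "ereal (Er L \<alpha>)"]) auto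
qed

end
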